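(* For every $n\ge1$ and $q\in(0,\infty]$ there is a constant $C_{q,n}>0$, depending only on $q$ and $n$, such that for every $p\in(1,\infty)$ and every $w\in A_{p,\mathcal R}$ on $\mathbb R^n$, with $\sigma:=w^{1-p'}$, $$\|\mathrm M_{\mathcal R}\|_{L^{p,q}(w)}\le C_{q,n}\,(p')^{\,n-1+\frac1{\min(p,q)}}\,\log\big(e+[w]_{A_{p,\mathcal R}}\big)^{\frac1{\min(p,q)}}\,[w]_{A_{p,\mathcal R}}^{\frac1p+\frac{n-1}{p-1}}\,[\sigma]_{A_{\infty,\mathcal R}}^{\frac1{\min(p,q)}}.$$
   Context: $\mathcal R$ is the family of all rectangles in $\mathbb R^n$ with sides parallel to the coordinate axes. The strong maximal operator is $\mathrm M_{\mathcal R}f(x)=\sup_{R\in\mathcal R,\,R\ni x}\frac1{|R|}\int_R|f(y)|\,dy$. A weight is a locally integrable function positive a.e.; $w(E)=\int_E w\,dx$. For $1<p<\infty$, $p'=\frac p{p-1}$ and $$[w]_{A_{p,\mathcal R}}:=\sup_{R\in\mathcal R}\Big(\frac1{|R|}\int_R w\,dx\Big)\Big(\frac1{|R|}\int_R w^{-\frac1{p-1}}\,dx\Big)^{p-1};$$ $w\in A_{p,\mathcal R}$ means $[w]_{A_{p,\mathcal R}}<\infty$. Moreover $$[w]_{A_{\infty,\mathcal R}}:=\sup_{R\in\mathcal R}\frac1{w(R)}\int_R\mathrm M_{\mathcal R}(w\chi_R)\,dx.$$ Lorentz spaces: for $p,q\in(0,\infty)$, $\|f\|_{L^{p,q}(w)}:=\big(p\int_0^\infty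 s^q\,w(\{|f|>s\})^{q/p}\frac{ds}s\big)^{1/q}$, and $\|f\|_{L^{p,\infty}(w)}:=\sup_{s>0}s\,w(\{|f|>s\})^{1/p}$. The operator norm is $\|\mathrm M_{\mathcal R}\|_{L^{p,q}(w)}:=\sup_{f\ne0}\|\mathrm M_{\mathcal R}f\|_{L^{p,q}(w)}/\|f\|_{L^{p,q}(w)}$. If $q=\infty$, $\min(p,q)=p$. *)

theory Defs
  imports "HOL-Analysis.Analysis"
begin

text \<open>
  All suprema, integrals and norms take values in \<^typ>\<open>ennreal\<close>, so that none of them needs
  a finiteness side condition to be meaningful.
\<close>

text \<open>Real power on \<open>[0, \<infinity>]\<close>. Used only with exponents \<open>a > 0\<close>, where \<open>0\<close> and \<open>\<infinity>\<close> are fixed points.\<close>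

definition epowr :: "ennreal \<Rightarrow> real \<Rightarrow> ennreal" where
  "epowr x a = (if x = top then top else ennreal (enn2real x powr a))"

text \<open>
  Nondegenerate bounded rectangles with sides parallel to the axes. They are taken open; since the
  boundary is a null set and every closed rectangle is a limit of larger open ones, taking closed
  or half-open ones changes none of the suprema below.
\<close>

definition rectangles :: "(real ^ 'n::finite) set set" where
  "rectangles = {box a b | a b. box a b \<noteq> {}}"

definition avg :: "(real ^ 'n::finite) set \<Rightarrow> (real ^ 'n \<Rightarrow> real) \<Rightarrow> ennreal" where
  "avg R g = (\<integral>\<^sup>+ x\<in>R. ennreal (g x) \<partial>lebesgue) / emeasure lebesgue R"

definition strong_maximal :: "(real ^ 'n::finite \<Rightarrow> real) \<Rightarrow> real ^ 'n \<Rightarrow> ennreal" where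
  "strong_maximal f x = (SUP R\<in>{R \<in> rectangles. x \<in> R}. avg R (\<lambda>y. \<bar>f y\<bar>))"

definition weight :: "(real ^ 'n::finite \<Rightarrow> real) \<Rightarrow> bool" where
  "weight w \<longleftrightarrow> w \<in> borel_measurable lebesgue \<and>
     (\<forall>K. compact K \<longrightarrow> set_integrable lebesgue K w) \<and> (AE x in lebesgue. 0 < w x)"

definition wmass :: "(real ^ 'n::finite \<Rightarrow> real) \<Rightarrow> (real ^ 'n) set \<Rightarrow> ennreal" where
  "wmass w E = (\<integral>\<^sup>+ x\<in>E. ennreal (w x) \<partial>lebesgue)"

definition Ap_const :: "real \<Rightarrow> (real ^ 'n::finite \<Rightarrow> real) \<Rightarrow> ennreal" where
  "Ap_const p w =
     (SUP R\<in>rectangles. avg R w * epowr (avg R (\<lambda>x. w x powr (- (1 / (p - 1))))) (p - 1))"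

definition Ap_weight :: "real \<Rightarrow> (real ^ 'n::finite \<Rightarrow> real) \<Rightarrow> bool" where
  "Ap_weight p w \<longleftrightarrow> weight w \<and> Ap_const p w < top"

definition Ainf_const :: "(real ^ 'n::finite \<Rightarrow> real) \<Rightarrow> ennreal" where
  "Ainf_const w =
     (SUP R\<in>rectangles.
        (\<integral>\<^sup>+ x\<in>R. strong_maximal (\<lambda>y. w y * indicator R y) x \<partial>lebesgue) / wmass w R)"

text \<open>
  The Lorentz functional is applied to the absolute value \<open>g = \<bar>f\<bar>\<close>, which may be infinite
  (as it can be for a maximal function). The second index ranges over \<open>(0, \<infinity>]\<close>.
\<close>

definition lorentz_norm ::
    "real \<Rightarrow> ennreal \<Rightarrow> (real ^ 'n::finite \<Rightarrow> real) \<Rightarrow> (real ^ 'n \<Rightarrow> ennreal) \<Rightarrow> ennreal" where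
  "lorentz_norm p q w g =
     (if q = top
      then (SUP s\<in>{0<..}. ennreal s * epowr (wmass w {x. ennreal s < g x}) (1 / p))
      else (let r = enn2real q in
        epowr (ennreal p *
          (\<integral>\<^sup>+ s\<in>{0<..}. ennreal (s powr r) * epowr (wmass w {x. ennreal s < g x}) (r / p)
             / ennreal s \<partial>lborel)) (1 / r)))"

text \<open>
  The supremum over the nonzero \<open>f \<in> L\<^sup>p\<^sup>,\<^sup>q(w)\<close>, where functions equal almost everywhere are
  identified.
\<close>

definition strong_maximal_norm ::
    "real \<Rightarrow> ennreal \<Rightarrow> (real ^ 'n::finite \<Rightarrow> real) \<Rightarrow> ennreal" where
  "strong_maximal_norm p q w =
     (SUP f\<in>{f \<in> borel_measurable lebesgue.
               \<not> (AE x in lebesgue. f x = 0) \<and> lorentz_norm p q w (\<lambda>x. ennreal \<bar>f x\<bar>) < top}.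
        lorentz_norm p q w (strong_maximal f) / lorentz_norm p q w (\<lambda>x. ennreal \<bar>f x\<bar>))"

end

theory Submission
  imports Defs
begin

text \<open>
  Let \<open>w\<close> be an \<open>A\<^sub>p\<close> weight on rectangles with constant \<open>A\<close>, let \<open>\<sigma> = w powr (1 - p')\<close> be its dual
  weight, and let \<open>K\<close> be the \<open>A\<^sub>\<infinity>\<close> constant of \<open>\<sigma>\<close>.

  An average over a rectangle is an iteration of one-dimensional averages, one for each coordinate.
  Hence the strong maximal function is pointwise at most \<open>2 ^ n\<close> times the composition of the \<open>n\<close>
  Hardy-Littlewood maximal functions that act in a single coordinate (\<open>box_average_le_iter_HL\<close>), and
  estimates on the line suffice.

  The gain comes from the self-improvement of the weight. The \<open>A\<^sub>\<infinity>\<close> condition gives the reverse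
  Hoelder inequality for \<open>\<sigma>\<close> on every rectangle with constant \<open>2\<close> and exponent \<open>1 + 1 / (4 K)\<close>
  (\<open>reverse_Holder\<close>). Read as a statement on \<open>w\<close>, it says that the \<open>A\<^sub>s\<close> constant of \<open>w\<close> is at most
  \<open>2 powr p * A\<close> for an \<open>s < p\<close> with \<open>p - s\<close> of size \<open>(p - 1) / K\<close> (\<open>rect_Ap_open\<close>). By Lebesgue
  differentiation, almost every restriction of \<open>w\<close> to a line parallel to an axis is a one-dimensional
  \<open>A\<^sub>s\<close> weight with the same constant (\<open>AE_slice_Ap\<close>). On a line the Vitali covering lemma yields the
  weak type \<open>(s, s)\<close> with a constant that is linear in the \<open>A\<^sub>s\<close> constant (\<open>HL1_weak_type\<close>).
  Let \<open>r\<close> be the midpoint of \<open>s\<close> and \<open>p\<close>. Interpolation with the trivial \<open>L\<^sup>\<infinity>\<close> bound shows that the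
  \<open>r\<close>-th power of the norm of each coordinate maximal function on \<open>L\<^sup>r(w)\<close> is at most
  \<open>C powr p * A * p' * K\<close> (\<open>HLc_strong_type\<close>). With this bound for \<open>n - 1\<close> of the coordinates and the
  weak type \<open>(r, r)\<close> for the outermost one, the set where the maximal function of \<open>f\<close> exceeds \<open>t\<close> has
  weight at most \<open>C powr p * A * (A * p' * K) ^ (n - 1) / t powr r\<close> times the integral of
  \<open>\<bar>f\<bar> powr r * w\<close>. Here \<open>K\<close> is replaced by its upper bound \<open>C * A powr (1 / (p - 1))\<close>, which is
  elementary (\<open>Ainf_bound_of_Ap\<close>); this turns \<open>(A * K) ^ (n - 1)\<close> into the \<open>p\<close>-th power of
  \<open>A powr ((n - 1) / (p - 1))\<close>, up to constants (\<open>rect_max_weak_type_below_p\<close>).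

  Finally the weak type at \<open>r < p\<close> and the \<open>L\<^sup>\<infinity>\<close> bound are interpolated to \<open>L\<^sup>p\<^sup>,\<^sup>q(w)\<close>. Cutting \<open>f\<close> at
  half the level bounds the distribution function of the maximal function by a sum over dyadic
  dilates of the distribution function of \<open>f\<close> (\<open>rect_max_distribution\<close>). Summing up the Lorentz norms
  of the dilates costs \<open>(p / (p - r)) powr (1 / min p q)\<close>, which is the factor with \<open>p' * K\<close>
  (\<open>lorentz_interpolation_finite\<close>, \<open>lorentz_interpolation_top\<close>). The weak-type constant enters with the
  power \<open>1 / p\<close>, whatever \<open>r\<close> is, so no loss arises from \<open>r \<noteq> p\<close>.
\<close>

section \<open>Real powers on the extended half-line\<close>

lemma epowr_top [simp]: "epowr top a = top"
  by (simp add: epowr_def)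

lemma epowr_zero [simp]: "epowr 0 a = 0"
  by (simp add: epowr_def)

lemma epowr_ennreal: "0 \<le> x \<Longrightarrow> epowr (ennreal x) a = ennreal (x powr a)"
  by (simp add: epowr_def)

lemma epowr_one [simp]: "epowr 1 a = 1"
  by (simp add: epowr_def)

lemma epowr_exponent_one [simp]: "epowr x 1 = x"
  by (cases x) (auto simp: epowr_def)

lemma epowr_mono: "x \<le> y \<Longrightarrow> 0 \<le> a \<Longrightarrow> epowr x a \<le> epowr y a"
  by (cases x; cases y) (auto simp: epowr_ennreal top_unique intro!: ennreal_leI powr_mono2)

lemma epowr_mult: "0 < a \<Longrightarrow> epowr (x * y) a = epowr x a * epowr y a"
  apply (cases x; cases y)
  by (auto simp: epowr_ennreal ennreal_mult[symmetric] powr_mult ennreal_top_mult ennreal_mult_top)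

lemma epowr_epowr: "epowr (epowr x a) b = epowr x (a * b)"
  by (cases x) (auto simp: epowr_ennreal powr_powr)

lemma epowr_add: "0 < a \<Longrightarrow> 0 < b \<Longrightarrow> epowr x (a + b) = epowr x a * epowr x b"
  by (cases x) (auto simp: epowr_ennreal powr_add ennreal_mult)

lemma epowr_less_top_iff [simp]: "epowr x a < top \<longleftrightarrow> x < top"
  by (cases x) (auto simp: epowr_ennreal)

lemma epowr_le_iff: "0 < a \<Longrightarrow> epowr x a \<le> y \<longleftrightarrow> x \<le> epowr y (1 / a)"
  using epowr_mono[of "epowr x a" y "1/a"] epowr_mono[of x "epowr y (1/a)" a]
  by (auto simp: epowr_epowr)

lemma epowr_SUP:
  assumes "0 < a"
  shows "epowr (SUP i\<in>I. f i) a = (SUP i\<in>I. epowr (f i) a)"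
proof (rule antisym)
  have "f i \<le> epowr (SUP i\<in>I. epowr (f i) a) (1 / a)" if "i \<in> I" for i
    using that by (subst epowr_le_iff[OF assms, symmetric]) (rule SUP_upper)
  then show "epowr (SUP i\<in>I. f i) a \<le> (SUP i\<in>I. epowr (f i) a)"
    by (subst epowr_le_iff[OF assms]) (rule SUP_least)
  show "(SUP i\<in>I. epowr (f i) a) \<le> epowr (SUP i\<in>I. f i) a"
    using assms by (intro SUP_least epowr_mono SUP_upper) auto
qed

lemma epowr_measurable [measurable]:
  "f \<in> borel_measurable M \<Longrightarrow> (\<lambda>x. epowr (f x) a) \<in> borel_measurable M"
  unfolding epowr_def[abs_def] by (rule measurable_If) auto

lemma epowr_eq_0_iff: "0 < a \<Longrightarrow> epowr x a = 0 \<longleftrightarrow> x = 0"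
  by (cases x) (auto simp: epowr_ennreal)

lemma epowr_layer_cake_real:
  fixes x :: real assumes "0 < a" "0 \<le> x"
  shows "(\<integral>\<^sup>+ l\<in>{0<..}. ennreal (a * l powr (a - 1)) * indicator {..<x} l \<partial>lborel) = ennreal (x powr a)"
proof -
  have "((\<lambda>l. a * l powr (a - 1)) has_integral x powr a) {0..x}"
    using has_integral_mult_right[OF has_integral_powr_from_0[of "a - 1" x], of a] assms by simp
  then have "(\<integral>\<^sup>+ l. ennreal (indicator {0..x} l * (a * l powr (a - 1))) \<partial>lborel) = ennreal (x powr a)"
    by (rule nn_integral_has_integral_lebesgue[rotated]) (use assms in auto)
  moreover have "(\<integral>\<^sup>+ l\<in>{0<..}. ennreal (a * l powr (a - 1)) * indicator {..<x} l \<partial>lborel) =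
      (\<integral>\<^sup>+ l. ennreal (indicator {0..x} l * (a * l powr (a - 1))) \<partial>lborel)"
  proof (rule nn_integral_cong_AE)
    have "AE l in lborel. l \<noteq> 0" "AE l in lborel. l \<noteq> x" by (rule AE_lborel_singleton)+
    then show "AE l in lborel. ennreal (a * l powr (a - 1)) * indicator {..<x} l * indicator {0<..} l =
        ennreal (indicator {0..x} l * (a * l powr (a - 1)))"
      by eventually_elim (auto simp: indicator_def)
  qed
  ultimately show ?thesis by simp
qed

lemma epowr_layer_cake:
  assumes "0 < a"
  shows "epowr X a = (\<integral>\<^sup>+ l\<in>{0<..}. ennreal (a * l powr (a - 1)) * indicator {l. ennreal l < X} l \<partial>lborel)"
proof (cases X)
  case (real x)
  have "epowr X a = ennreal (x powr a)" using real by (simp add: epowr_ennreal)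
  also have "\<dots> = (\<integral>\<^sup>+ l\<in>{0<..}. ennreal (a * l powr (a - 1)) * indicator {..<x} l \<partial>lborel)"
    by (rule epowr_layer_cake_real[symmetric]) (use assms real in auto)
  also have "\<dots> = (\<integral>\<^sup>+ l\<in>{0<..}. ennreal (a * l powr (a - 1)) * indicator {l. ennreal l < X} l \<partial>lborel)"
  proof (rule nn_integral_cong)
    fix l :: real
    have "l > 0 \<Longrightarrow> ennreal l < X \<longleftrightarrow> l < x" using real by (simp add: ennreal_less_iff)
    then show "ennreal (a * l powr (a - 1)) * indicator {..<x} l * indicator {0<..} l =
       ennreal (a * l powr (a - 1)) * indicator {l. ennreal l < X} l * indicator {0<..} l"
      by (cases "0 < l") (auto simp: indicator_def)
  qed
  finally show ?thesis .
next
  case top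
  have "ennreal (real n powr a) \<le> (\<integral>\<^sup>+ l\<in>{0<..}. ennreal (a * l powr (a - 1)) * indicator {l. ennreal l < X} l \<partial>lborel)" for n :: nat
    unfolding epowr_layer_cake_real[OF assms of_nat_0_le_iff, symmetric]
    by (intro nn_integral_mono) (auto simp: top indicator_def)
  then have "epowr (SUP n. of_nat n) a \<le> (\<integral>\<^sup>+ l\<in>{0<..}. ennreal (a * l powr (a - 1)) * indicator {l. ennreal l < X} l \<partial>lborel)"
    unfolding epowr_SUP[OF assms]
    by (intro SUP_least) (auto simp: ennreal_of_nat_eq_real_of_nat epowr_ennreal)
  then show ?thesis
    using top by (simp add: ennreal_SUP_of_nat_eq_top top_unique)
qed

section \<open>Averages over rectangles as iterated coordinate averages\<close>

definition set_coord :: "'n \<Rightarrow> real \<Rightarrow> real ^ 'n::finite \<Rightarrow> real ^ 'n" where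
  "set_coord i t x = (\<chi> j. if j = i then t else x $ j)"

lemma set_coord_nth: "set_coord i t x $ j = (if j = i then t else x $ j)"
  by (simp add: set_coord_def)

lemma set_coord_set_coord [simp]: "set_coord i s (set_coord i t x) = set_coord i s x"
  by (simp add: set_coord_def vec_eq_iff)

lemma set_coord_self [simp]: "set_coord i (x $ i) x = x"
  by (simp add: set_coord_def vec_eq_iff)

lemma measurable_set_coord [measurable]:
  "(\<lambda>z. set_coord i (fst z) (snd z)) \<in> borel \<Otimes>\<^sub>M borel \<rightarrow>\<^sub>M (borel :: (real ^ 'n::finite) measure)"
  unfolding borel_prod set_coord_def
proof (intro borel_measurable_continuous_onI continuous_on_vec_lambda)
  fix j show "continuous_on UNIV (\<lambda>z::real \<times> (real ^ 'n). if j = i then fst z else snd z $ j)"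
    by (cases "j = i") (auto intro!: continuous_intros)
qed

lemma measurable_set_coord' [measurable (raw)]:
  assumes "f \<in> M \<rightarrow>\<^sub>M borel" "g \<in> M \<rightarrow>\<^sub>M borel"
  shows "(\<lambda>z. set_coord i (f z) (g z)) \<in> M \<rightarrow>\<^sub>M (borel :: (real ^ 'n::finite) measure)"
  using measurable_compose[OF measurable_Pair[OF assms] measurable_set_coord] by simp

lemma measurable_vec_nth [measurable]: "(\<lambda>x. x $ i) \<in> borel \<rightarrow>\<^sub>M (borel :: real measure)"
  by (intro borel_measurable_continuous_onI continuous_intros)

lemma emeasure_box_cart:
  fixes a b :: "real ^ 'n::finite"
  assumes "\<And>i. a $ i \<le> b $ i"
  shows "emeasure lborel (box a b) = (\<Prod>i\<in>UNIV. ennreal (b $ i - a $ i))"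
proof -
  have inj: "inj (\<lambda>i::'n. axis i (1::real))" by (auto simp: inj_on_def axis_eq_axis)
  have B: "(Basis :: (real ^ 'n) set) = range (\<lambda>i. axis i 1)"
    by (auto simp: Basis_vec_def)
  show ?thesis
    using assms
    by (subst emeasure_lborel_box_eq)
       (auto simp: B prod.reindex[OF inj] inner_axis prod_ennreal)
qed

lemma indicator_box_cart:
  fixes a b x :: "real ^ 'n::finite"
  shows "indicator (box a b) x = (\<Prod>i\<in>UNIV. indicator {a $ i<..<b $ i} (x $ i) :: ennreal)"
  by (auto simp: indicator_def mem_box_cart)

text \<open>
  The coordinate \<open>i\<close> is integrated first. Restricting the outer variable \<open>x\<close> to the slab \<open>0 < x $ i < 1\<close>
  makes its own, now irrelevant, \<open>i\<close>-th coordinate contribute a factor \<open>1\<close>, so that the remaining \<open>n - 1\<close>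
  coordinates need no space of their own.
\<close>

lemma fubini_coord:
  fixes F :: "real ^ 'n::finite \<Rightarrow> ennreal"
  assumes [measurable]: "F \<in> borel_measurable borel"
  shows "(\<integral>\<^sup>+ x. F x \<partial>lborel) =
    (\<integral>\<^sup>+ x. indicator {0<..<1} (x $ i) * (\<integral>\<^sup>+ t. F (set_coord i t x) \<partial>lborel) \<partial>lborel)"
proof -
  let ?N = "density lborel (\<lambda>x::real ^ 'n. indicator {0<..<1} (x $ i))"
  let ?P = "?N \<Otimes>\<^sub>M (lborel :: real measure)"
  let ?T = "\<lambda>z. set_coord i (snd z) (fst z) :: real ^ 'n"
  have sN[simp, measurable_cong]: "sets ?N = sets borel" by simp
  have [measurable]: "?T \<in> ?P \<rightarrow>\<^sub>M borel" by measurable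
  have int: "(\<integral>\<^sup>+ x. G x \<partial>distr ?P borel ?T) =
    (\<integral>\<^sup>+ x. indicator {0<..<1} (x $ i) * (\<integral>\<^sup>+ t. G (set_coord i t x) \<partial>lborel) \<partial>lborel)"
    if [measurable]: "G \<in> borel_measurable borel" for G :: "real ^ 'n \<Rightarrow> ennreal"
    by (simp add: nn_integral_distr lborel.nn_integral_fst[symmetric] nn_integral_density)
  \<comment> \<open>Both measures agree on boxes: the map exchanges the dummy coordinate in \<open>(0, 1)\<close> for \<open>t\<close>.\<close>
  have "lborel = distr ?P borel ?T"
  proof (rule lborel_eqI)
    fix l u :: "real ^ 'n" assume "\<And>b. b \<in> Basis \<Longrightarrow> l \<bullet> b \<le> u \<bullet> b"
    then have lu: "l $ j \<le> u $ j" for j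
      using axis_in_Basis_iff[of j "1::real"] by (auto simp: cart_eq_inner_axis)
    let ?l = "set_coord i 0 l" and ?u = "set_coord i 1 u"
    have "emeasure (distr ?P borel ?T) (box l u) = (\<integral>\<^sup>+ x. indicator (box l u) x \<partial>distr ?P borel ?T)"
      by simp
    also have "\<dots> = (\<integral>\<^sup>+ x. indicator {0<..<1} (x $ i) * (\<integral>\<^sup>+ t. indicator (box l u) (set_coord i t x) \<partial>lborel) \<partial>lborel)"
      by (rule int) simp
    also have "\<dots> = (\<integral>\<^sup>+ x. ennreal (u $ i - l $ i) * indicator (box ?l ?u) x \<partial>lborel)"
    proof (rule nn_integral_cong)
      fix x :: "real ^ 'n"
      have *: "indicator (box l u) (set_coord i t x) =
         (\<Prod>j\<in>UNIV-{i}. indicator {l $ j<..<u $ j} (x $ j)) * (indicator {l $ i<..<u $ i} t :: ennreal)" for t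
        unfolding indicator_box_cart
        by (subst prod.remove[of _ i]) (auto simp: set_coord_nth mult.commute intro!: prod.cong)
      have **: "indicator (box ?l ?u) x =
         (\<Prod>j\<in>UNIV-{i}. indicator {l $ j<..<u $ j} (x $ j)) * (indicator {0<..<1} (x $ i) :: ennreal)"
        unfolding indicator_box_cart
        by (subst prod.remove[of _ i]) (auto simp: set_coord_nth mult.commute intro!: prod.cong)
      show "indicator {0<..<1} (x $ i) * (\<integral>\<^sup>+ t. indicator (box l u) (set_coord i t x) \<partial>lborel) =
          ennreal (u $ i - l $ i) * indicator (box ?l ?u) x"
        unfolding * ** using lu[of i] by (subst nn_integral_cmult) (auto simp: mult_ac)
    qed
    also have "\<dots> = ennreal (u $ i - l $ i) * emeasure lborel (box ?l ?u)"
      by (simp add: nn_integral_cmult)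
    also have "emeasure lborel (box ?l ?u) = (\<Prod>j\<in>UNIV-{i}. ennreal (u $ j - l $ j))"
      using lu by (subst emeasure_box_cart)
        (auto simp: set_coord_nth prod.remove[of UNIV i] intro!: prod.cong)
    also have "ennreal (u $ i - l $ i) * (\<Prod>j\<in>UNIV-{i}. ennreal (u $ j - l $ j)) = emeasure lborel (box l u)"
      using lu by (simp add: emeasure_box_cart prod.remove[of UNIV i])
    also have "\<dots> = ennreal (\<Prod>b\<in>Basis. (u - l) \<bullet> b)"
      using \<open>\<And>b. b \<in> Basis \<Longrightarrow> l \<bullet> b \<le> u \<bullet> b\<close> by (auto simp: emeasure_lborel_box_eq)
    finally show "emeasure (distr ?P borel ?T) (box l u) = ennreal (\<Prod>b\<in>Basis. (u - l) \<bullet> b)" .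
  qed simp
  then show ?thesis using int[of F] by simp
qed

text \<open>
  Maximal functions on the line run over the countably many intervals with rational end points, which
  makes their measurability immediate.
\<close>

definition rat_ivals :: "(real \<times> real) set" where
  "rat_ivals = {(a, b). a \<in> \<rat> \<and> b \<in> \<rat> \<and> a < b}"

lemma countable_rat_ivals: "countable rat_ivals"
  by (rule countable_subset[of _ "\<rat> \<times> \<rat>"]) (auto simp: rat_ivals_def countable_rat)

definition HL1 :: "(real \<Rightarrow> ennreal) \<Rightarrow> real \<Rightarrow> ennreal" where
  "HL1 g t = (SUP (a, b)\<in>rat_ivals.
     indicator {a<..<b} t * ((\<integral>\<^sup>+ s\<in>{a<..<b}. g s \<partial>lborel) / ennreal (b - a)))"

definition coord_avg :: "real \<Rightarrow> real \<Rightarrow> 'n \<Rightarrow> (real ^ 'n::finite \<Rightarrow> ennreal) \<Rightarrow> real ^ 'n \<Rightarrow> ennreal" where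
  "coord_avg a b i F x = (\<integral>\<^sup>+ t\<in>{a<..<b}. F (set_coord i t x) \<partial>lborel) / ennreal (b - a)"

text \<open>
  The Hardy-Littlewood maximal function in the \<open>i\<close>-th coordinate.
\<close>

definition HLc :: "'n \<Rightarrow> (real ^ 'n::finite \<Rightarrow> ennreal) \<Rightarrow> real ^ 'n \<Rightarrow> ennreal" where
  "HLc i F x = HL1 (\<lambda>t. F (set_coord i t x)) (x $ i)"

lemma HLc_set_coord: "HLc i F (set_coord i t x) = HL1 (\<lambda>s. F (set_coord i s x)) t"
  by (simp add: HLc_def set_coord_nth)

lemma HLc_altdef: "HLc i F x = (SUP (a, b)\<in>rat_ivals. indicator {a<..<b} (x $ i) * coord_avg a b i F x)"
  by (simp add: HLc_def HL1_def coord_avg_def)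

lemma coord_avg_measurable [measurable]:
  assumes [measurable]: "F \<in> borel_measurable borel"
  shows "coord_avg a b i F \<in> borel_measurable borel"
  unfolding coord_avg_def[abs_def] by measurable

lemma HLc_measurable [measurable]:
  assumes [measurable]: "F \<in> borel_measurable borel"
  shows "HLc i F \<in> borel_measurable borel"
  unfolding HLc_altdef[abs_def] case_prod_beta
  by (rule borel_measurable_SUP[OF countable_rat_ivals]) measurable

lemma HL1_measurable [measurable]:
  assumes [measurable]: "F \<in> borel_measurable borel"
  shows "HL1 F \<in> borel_measurable borel"
  unfolding HL1_def[abs_def] case_prod_beta
  by (rule borel_measurable_SUP[OF countable_rat_ivals]) measurable

text \<open>
  An arbitrary interval lies in a rational one of at most twice its length.
\<close>

lemma coord_avg_le_HLc:
  assumes x: "a < x $ i" "x $ i < b"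
  shows "coord_avg a b i F x \<le> 2 * HLc i F x"
proof -
  define d where "d = (b - a) / 2"
  have d: "d > 0" using x by (simp add: d_def)
  obtain a' where a': "a' \<in> \<rat>" "a - d < a'" "a' < a" using Rats_dense_in_real[of "a - d" a] d by auto
  obtain b' where b': "b' \<in> \<rat>" "b < b'" "b' < b + d" using Rats_dense_in_real[of b "b + d"] d by auto
  have "coord_avg a b i F x \<le> (\<integral>\<^sup>+ t\<in>{a'<..<b'}. F (set_coord i t x) \<partial>lborel) / ennreal (b - a)"
    unfolding coord_avg_def using a' b'
    by (intro divide_right_mono_ennreal nn_integral_mono) (auto simp: indicator_def)
  also have "\<dots> \<le> 2 * coord_avg a' b' i F x"
  proof -
    have "inverse (ennreal (b - a)) \<le> 2 * inverse (ennreal (b' - a'))"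
    proof -
      have "b' - a' \<le> 2 * (b - a)" using a' b' by (simp add: d_def field_simps)
      then have "inverse (b - a) \<le> 2 * inverse (b' - a')" using x a' b' by (simp add: field_simps)
      then have "ennreal (inverse (b - a)) \<le> ennreal (2 * inverse (b' - a'))" by (rule ennreal_leI)
      then show ?thesis using x a' b' by (simp add: inverse_ennreal ennreal_mult)
    qed
    then show ?thesis
      unfolding coord_avg_def divide_ennreal_def
      by (metis (no_types, lifting) mult.left_commute mult_left_mono zero_le)
  qed
  also have "coord_avg a' b' i F x \<le> HLc i F x"
    unfolding HLc_altdef using x a' b'
    by (intro SUP_upper2[of "(a', b')"]) (auto simp: rat_ivals_def)
  finally show ?thesis by (simp add: mult_left_mono)
qed

fun iter_avg :: "real ^ 'n \<Rightarrow> real ^ 'n \<Rightarrow> 'n list \<Rightarrow> (real ^ 'n::finite \<Rightarrow> ennreal) \<Rightarrow> real ^ 'n \<Rightarrow> ennreal" where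
  "iter_avg a b [] F = F"
| "iter_avg a b (i # is) F = coord_avg (a $ i) (b $ i) i (iter_avg a b is F)"

fun iter_HL :: "'n list \<Rightarrow> (real ^ 'n::finite \<Rightarrow> ennreal) \<Rightarrow> real ^ 'n \<Rightarrow> ennreal" where
  "iter_HL [] F = F"
| "iter_HL (i # is) F = HLc i (iter_HL is F)"

lemma iter_HL_measurable [measurable]:
  "F \<in> borel_measurable borel \<Longrightarrow> iter_HL is F \<in> borel_measurable borel"
  by (induction "is") auto

lemma iter_avg_measurable [measurable]:
  "F \<in> borel_measurable borel \<Longrightarrow> iter_avg a b is F \<in> borel_measurable borel"
  by (induction "is") auto

lemma coord_avg_mono:
  assumes "\<And>t. a < t \<Longrightarrow> t < b \<Longrightarrow> F (set_coord i t x) \<le> G (set_coord i t x)"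
  shows "coord_avg a b i F x \<le> coord_avg a b i G x"
  unfolding coord_avg_def using assms
  by (intro divide_right_mono_ennreal nn_integral_mono) (auto simp: indicator_def)

lemma coord_avg_cmult:
  assumes [measurable]: "F \<in> borel_measurable borel"
  shows "coord_avg a b i (\<lambda>x. c * F x) x = c * coord_avg a b i F x"
  unfolding coord_avg_def divide_ennreal_def by (simp add: nn_integral_cmult mult.assoc)

text \<open>
  Averaging in a coordinate removes the dependence on it. Once all coordinates have been averaged, the
  result is a constant, namely the average over the box.
\<close>

lemma iter_avg_local:
  "(\<And>j. j \<notin> set is \<Longrightarrow> x $ j = y $ j) \<Longrightarrow> iter_avg a b is F x = iter_avg a b is F y"
proof (induction "is" arbitrary: x y)
  case Nil
  then have "x = y" by (simp add: vec_eq_iff)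
  then show ?case by simp
next
  case (Cons i "is")
  have "iter_avg a b is F (set_coord i t x) = iter_avg a b is F (set_coord i t y)" for t
    using Cons.prems by (intro Cons.IH) (auto simp: set_coord_nth)
  then show ?case by (simp add: coord_avg_def)
qed

lemma set_coord_in_box:
  "x \<in> box a b \<Longrightarrow> a $ i < t \<Longrightarrow> t < b $ i \<Longrightarrow> set_coord i t x \<in> box a b"
  by (auto simp: mem_box_cart set_coord_nth)

lemma iter_avg_le_iter_HL:
  assumes [measurable]: "F \<in> borel_measurable borel"
  shows "x \<in> box a b \<Longrightarrow> iter_avg a b is F x \<le> 2 ^ length is * iter_HL is F x"
proof (induction "is" arbitrary: x)
  case (Cons i "is")
  have "iter_avg a b (i # is) F x \<le> coord_avg (a $ i) (b $ i) i (\<lambda>x. 2 ^ length is * iter_HL is F x) x"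
    using Cons.IH Cons.prems by (auto intro!: coord_avg_mono set_coord_in_box)
  also have "\<dots> = 2 ^ length is * coord_avg (a $ i) (b $ i) i (iter_HL is F) x"
    by (rule coord_avg_cmult) simp
  also have "\<dots> \<le> 2 ^ length is * (2 * HLc i (iter_HL is F) x)"
    using Cons.prems by (intro mult_left_mono coord_avg_le_HLc) (auto simp: mem_box_cart)
  finally show ?case by (simp add: mult_ac)
qed simp

text \<open>
  In the \<open>i\<close>-th coordinate the side of the box is exchanged for the dummy side \<open>(0, 1)\<close>.
\<close>

lemma set_integral_coord:
  fixes F :: "real ^ 'n::finite \<Rightarrow> ennreal"
  assumes [measurable]: "F \<in> borel_measurable borel"
  shows "(\<integral>\<^sup>+ x\<in>box a b. F x \<partial>lborel) =
    (\<integral>\<^sup>+ x\<in>box (set_coord i 0 a) (set_coord i 1 b). (\<integral>\<^sup>+ t\<in>{a $ i<..<b $ i}. F (set_coord i t x) \<partial>lborel) \<partial>lborel)"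
proof -
  have *: "indicator (box a b) (set_coord i t x) =
     (\<Prod>j\<in>UNIV-{i}. indicator {a $ j<..<b $ j} (x $ j)) * (indicator {a $ i<..<b $ i} t :: ennreal)" for t x
    unfolding indicator_box_cart
    by (subst prod.remove[of _ i]) (auto simp: set_coord_nth mult.commute intro!: prod.cong)
  have **: "indicator (box (set_coord i 0 a) (set_coord i 1 b)) x =
     (\<Prod>j\<in>UNIV-{i}. indicator {a $ j<..<b $ j} (x $ j)) * (indicator {0<..<1} (x $ i) :: ennreal)" for x
    unfolding indicator_box_cart
    by (subst prod.remove[of _ i]) (auto simp: set_coord_nth mult.commute intro!: prod.cong)
  show ?thesis
    by (subst fubini_coord[of _ i], simp)
       (auto simp: * ** mult_ac nn_integral_cmult[symmetric] intro!: nn_integral_cong)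
qed

lemma set_integral_coord_avg:
  fixes F :: "real ^ 'n::finite \<Rightarrow> ennreal"
  assumes [measurable]: "F \<in> borel_measurable borel" and ab: "a $ i < b $ i"
  shows "(\<integral>\<^sup>+ x\<in>box a b. coord_avg (a $ i) (b $ i) i F x \<partial>lborel) = (\<integral>\<^sup>+ x\<in>box a b. F x \<partial>lborel)"
proof -
  have "(\<integral>\<^sup>+ t\<in>{a $ i<..<b $ i}. coord_avg (a $ i) (b $ i) i F (set_coord i t x) \<partial>lborel) =
    (\<integral>\<^sup>+ t\<in>{a $ i<..<b $ i}. F (set_coord i t x) \<partial>lborel)" for x
  proof -
    have "(\<integral>\<^sup>+ t\<in>{a $ i<..<b $ i}. coord_avg (a $ i) (b $ i) i F (set_coord i t x) \<partial>lborel) =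
        (\<integral>\<^sup>+ t\<in>{a $ i<..<b $ i}. coord_avg (a $ i) (b $ i) i F x \<partial>lborel)"
      by (simp add: coord_avg_def)
    also have "\<dots> = coord_avg (a $ i) (b $ i) i F x * ennreal (b $ i - a $ i)"
      using ab by (subst nn_integral_cmult) auto
    also have "\<dots> = (\<integral>\<^sup>+ t\<in>{a $ i<..<b $ i}. F (set_coord i t x) \<partial>lborel)"
      unfolding coord_avg_def using ab by (simp add: ennreal_divide_times ennreal_divide_self)
    finally show ?thesis .
  qed
  then show ?thesis
    by (subst (1 2) set_integral_coord[of _ _ _ i]) auto
qed

lemma set_integral_iter_avg:
  fixes F :: "real ^ 'n::finite \<Rightarrow> ennreal"
  assumes [measurable]: "F \<in> borel_measurable borel" and ab: "\<And>i. a $ i < b $ i"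
  shows "(\<integral>\<^sup>+ x\<in>box a b. iter_avg a b is F x \<partial>lborel) = (\<integral>\<^sup>+ x\<in>box a b. F x \<partial>lborel)"
  by (induction "is") (auto simp: set_integral_coord_avg ab)

lemma emeasure_box_pos:
  fixes a b :: "real ^ 'n::finite"
  assumes ab: "\<And>i. a $ i < b $ i"
  shows "0 < emeasure lborel (box a b)" "emeasure lborel (box a b) < top"
  using ab by (auto simp: emeasure_box_cart less_imp_le prod_ennreal intro!: prod_pos)

lemma box_average_le_iter_HL:
  fixes F :: "real ^ 'n::finite \<Rightarrow> ennreal"
  assumes F [measurable]: "F \<in> borel_measurable borel" and x: "x \<in> box a b" and "is": "set is = UNIV"
  shows "(\<integral>\<^sup>+ x\<in>box a b. F x \<partial>lborel) / emeasure lborel (box a b) \<le> 2 ^ length is * iter_HL is F x"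
proof -
  have ab: "a $ i < b $ i" for i using x by (auto simp: mem_box_cart intro: less_trans)
  have "(\<integral>\<^sup>+ y\<in>box a b. F y \<partial>lborel) = (\<integral>\<^sup>+ y\<in>box a b. iter_avg a b is F x \<partial>lborel)"
    unfolding set_integral_iter_avg[OF F ab, of "is", symmetric]
    by (intro nn_integral_cong arg_cong2[where f="(*)"] iter_avg_local) (auto simp: "is")
  also have "\<dots> = iter_avg a b is F x * emeasure lborel (box a b)"
    by (simp add: nn_integral_cmult)
  also have "\<dots> / emeasure lborel (box a b) = iter_avg a b is F x"
    using emeasure_box_pos[OF ab] by (simp add: ennreal_mult_divide_eq less_top)
  finally show ?thesis using iter_avg_le_iter_HL[OF F x] by simp
qed

section \<open>The weak type inequality on the line\<close>

abbreviation mass :: "('a::euclidean_space \<Rightarrow> real) \<Rightarrow> 'a set \<Rightarrow> ennreal" where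
  "mass v S \<equiv> (\<integral>\<^sup>+ x\<in>S. ennreal (v x) \<partial>lborel)"

abbreviation powint :: "real \<Rightarrow> ('a::euclidean_space \<Rightarrow> real) \<Rightarrow> ('a \<Rightarrow> ennreal) \<Rightarrow> ennreal" where
  "powint r w F \<equiv> (\<integral>\<^sup>+ x. epowr (F x) r * ennreal (w x) \<partial>lborel)"

definition dual :: "real \<Rightarrow> ('a \<Rightarrow> real) \<Rightarrow> 'a \<Rightarrow> real" where
  "dual s w x = w x powr (- (1 / (s - 1)))"

lemma dual_pos: "0 < w x \<Longrightarrow> 0 < dual s w x"
  by (simp add: dual_def)

lemma dual_measurable [measurable]:
  "w \<in> borel_measurable M \<Longrightarrow> dual s w \<in> borel_measurable M"
  unfolding dual_def[abs_def] by measurable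

text \<open>
  Young's inequality \<open>s * z * c powr (s - 1) \<le> z powr s + (s - 1) * c powr s\<close> for \<open>z = y / t\<close>,
  multiplied by \<open>t = w powr (- 1 / (s - 1))\<close>. It is the linearised form of the Hoelder inequality below.
\<close>

lemma Young_weighted:
  fixes w y c s :: real
  assumes "1 < s" "0 < w" "0 \<le> y" "0 < c"
  shows "s * c powr (s - 1) * y \<le> y powr s * w + (s - 1) * c powr s * w powr (- (1 / (s - 1)))"
proof -
  define t where "t = w powr (- (1 / (s - 1)))"
  have t: "t > 0" using assms by (simp add: t_def)
  have "- (1 / (s - 1)) * (1 - s) = 1" using assms by (simp add: field_simps)
  then have w: "w = t powr (1 - s)" unfolding t_def powr_powr using assms by simp
  define z where "z = y / t"
  have z: "0 \<le> z" "y = z * t" using assms t by (auto simp: z_def)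
  have "z * c powr (s - 1) \<le> z powr s / s + (c powr (s - 1)) powr (s / (s - 1)) / (s / (s - 1))"
    by (rule Youngs_inequality) (use assms z in \<open>auto simp: field_simps\<close>)
  then have "s * (z * c powr (s - 1)) \<le> s * (z powr s / s + (c powr (s - 1)) powr (s / (s - 1)) / (s / (s - 1)))"
    using assms by (intro mult_left_mono) auto
  also have "(c powr (s - 1)) powr (s / (s - 1)) = c powr s"
    using assms by (simp add: powr_powr)
  also have "s * (z powr s / s + c powr s / (s / (s - 1))) = z powr s + (s - 1) * c powr s"
    using assms by (simp add: field_simps)
  finally have "s * c powr (s - 1) * z \<le> z powr s + (s - 1) * c powr s"
    by (simp add: mult_ac)
  then have "s * c powr (s - 1) * z * t \<le> (z powr s + (s - 1) * c powr s) * t"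
    using t by (intro mult_right_mono) auto
  moreover have "z powr s * t = y powr s * w"
  proof -
    have "t powr s * t powr (1 - s) = t" using t by (simp add: powr_add[symmetric])
    then show ?thesis using z t by (simp add: powr_mult w mult.assoc)
  qed
  ultimately have "s * c powr (s - 1) * (z * t) \<le> y powr s * w + (s - 1) * c powr s * t"
    unfolding distrib_right by (simp only: mult.assoc)
  then show ?thesis by (simp only: z(2)[symmetric] t_def[symmetric])
qed

text \<open>
  Hoelder's inequality for \<open>f = (f * w powr (1 / s)) * w powr (- 1 / s)\<close>, raised to the power \<open>s\<close>. The measure is
  arbitrary: on an interval this is the use of the \<open>A\<^sub>s\<close> condition, and for the counting measure it
  serves as a weighted power mean inequality for series.
\<close>

lemma average_powr_le:
  fixes w :: "'a \<Rightarrow> real" and f :: "'a \<Rightarrow> ennreal"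
  assumes [measurable]: "f \<in> borel_measurable M" "w \<in> borel_measurable M"
    and w: "\<And>x. 0 < w x" and s: "1 < s"
    and T: "(\<integral>\<^sup>+ x. ennreal (dual s w x) \<partial>M) < top"
  shows "epowr (\<integral>\<^sup>+ x. f x \<partial>M) s \<le> (\<integral>\<^sup>+ x. epowr (f x) s * ennreal (w x) \<partial>M)
            * epowr (\<integral>\<^sup>+ x. ennreal (dual s w x) \<partial>M) (s - 1)"
proof -
  define T where "T = (\<integral>\<^sup>+ x. ennreal (dual s w x) \<partial>M)"
  define P where "P = (\<integral>\<^sup>+ x. epowr (f x) s * ennreal (w x) \<partial>M)"
  define I where "I = (\<integral>\<^sup>+ x. f x \<partial>M)"
  have young: "ennreal (s * c powr (s - 1)) * I \<le> P + ennreal ((s - 1) * c powr s) * T" if c: "0 < c" for c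
  proof -
    have "ennreal (s * c powr (s - 1)) * f x \<le> epowr (f x) s * ennreal (w x) + ennreal ((s - 1) * c powr s) * ennreal (dual s w x)" for x
    proof (cases "f x")
      case (real y)
      then show ?thesis
        using Young_weighted[OF s w[of x] _ c, of y] w[of x] s
        by (simp add: epowr_ennreal dual_def ennreal_mult[symmetric] ennreal_plus[symmetric] ennreal_leI del: ennreal_plus)
    next
      case top
      then show ?thesis using w[of x] by (simp add: ennreal_top_mult)
    qed
    then have "(\<integral>\<^sup>+ x. ennreal (s * c powr (s - 1)) * f x \<partial>M) \<le>
      (\<integral>\<^sup>+ x. epowr (f x) s * ennreal (w x) + ennreal ((s - 1) * c powr s) * ennreal (dual s w x) \<partial>M)"
      by (rule nn_integral_mono)
    then show ?thesis
      by (simp add: nn_integral_cmult nn_integral_add I_def P_def T_def)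
  qed
  obtain t where t: "T = ennreal t" "0 \<le> t" using T by (cases T) (auto simp: T_def)
  consider "t = 0" | "t > 0" "P = top" | "t > 0" "P < top" using t less_top by (metis order_le_less)
  then have "epowr I s \<le> P * epowr T (s - 1)"
  proof cases
    case 1
    then have "(\<integral>\<^sup>+ x. ennreal (dual s w x) \<partial>M) = 0" using t by (simp add: T_def)
    then have "AE x in M. ennreal (dual s w x) = 0" by (subst (asm) nn_integral_0_iff_AE) auto
    then have "AE x in M. False"
    proof eventually_elim
      case (elim x)
      then show ?case using dual_pos[of w x s] w[of x] by (simp add: ennreal_eq_0_iff)
    qed
    then have "AE x in M. f x = 0" by eventually_elim simp
    then have "I = 0" unfolding I_def by (subst nn_integral_0_iff_AE) auto
    then show ?thesis by simp
  next
    case 2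
    then show ?thesis using t by (simp add: epowr_ennreal ennreal_top_mult)
  next
    case 3
    then obtain q where q: "P = ennreal q" "0 \<le> q" by (cases P) auto
    have "ennreal (s * 1 powr (s - 1)) * I < top"
      using young[of 1] q t s by (auto intro: order.strict_trans1 simp: ennreal_mult[symmetric] ennreal_plus[symmetric] simp del: ennreal_plus)
    then obtain j where j: "I = ennreal j" "0 \<le> j" using s by (cases I) (auto simp: ennreal_mult_top)
    show ?thesis
    proof (cases "j = 0")
      case True then show ?thesis by (simp add: j)
    next
      case False
      \<comment> \<open>This \<open>c\<close> is optimal in the linearised inequality.\<close>
      define c where "c = j / t"
      have c: "c > 0" using False j 3 by (simp add: c_def)
      have jc: "j = c * t" using 3 by (simp add: c_def)
      have cs: "c powr (s - 1) * c = c powr s" using c by (simp add: powr_diff)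
      have "s * c powr (s - 1) * j \<le> q + (s - 1) * c powr s * t"
        using young[OF c] j t q s by (simp add: ennreal_mult[symmetric] ennreal_plus[symmetric] del: ennreal_plus)
      moreover have "s * c powr (s - 1) * j = s * (c powr s * t)" by (simp add: jc cs[symmetric])
      ultimately have "s * (c powr s * t) \<le> q + (s - 1) * (c powr s * t)"
        by (simp only: mult.assoc)
      then have "c powr s * t \<le> q" by (simp add: left_diff_distrib)
      then have "c powr s * t * t powr (s - 1) \<le> q * t powr (s - 1)" by (rule mult_right_mono) simp
      moreover have "c powr s * t * t powr (s - 1) = j powr s"
        using 3 c by (simp add: jc powr_mult powr_diff)
      ultimately show ?thesis
        using j t q by (simp add: epowr_ennreal ennreal_mult[symmetric] ennreal_leI)
    qed
  qed
  then show ?thesis by (simp add: I_def P_def T_def)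
qed

text \<open>
  Greedy selection of a longest interval: an interval that meets it and is no longer lies in its triple.
\<close>

lemma Vitali_finite_ivals:
  assumes "finite K" "\<And>I. I \<in> K \<Longrightarrow> fst I < (snd I :: real)"
  obtains C where "C \<subseteq> K" "pairwise (\<lambda>I J. disjnt {fst I<..<snd I} {fst J<..<snd J}) C"
    "(\<Union>I\<in>K. {fst I<..<snd I}) \<subseteq> (\<Union>I\<in>C. {2 * fst I - snd I<..<2 * snd I - fst I})"
  using assms
proof (induction "card K" arbitrary: K thesis rule: less_induct)
  case less
  show ?case
  proof (cases "K = {}")
    case True
    then show ?thesis using less(2)[of "{}"] by simp
  next
    case False
    define len where "len I = snd I - fst I" for I :: "real \<times> real"
    have "Max (len ` K) \<in> len ` K" using False less(3) by (intro Max_in) auto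
    then obtain J where J: "J \<in> K" "len J = Max (len ` K)" by force
    then have J_max: "len I \<le> len J" if "I \<in> K" for I using that less(3) by simp
    define K' where "K' = {I \<in> K. disjnt {fst I<..<snd I} {fst J<..<snd J}}"
    have "J \<notin> K'" using less(4)[OF J(1)] by (simp add: K'_def disjnt_def)
    moreover have "K' \<subseteq> K" by (auto simp: K'_def)
    ultimately have "K' \<subset> K" using J(1) by blast
    then have "card K' < card K" using less(3) by (rule psubset_card_mono[rotated])
    then obtain C where C: "C \<subseteq> K'" "pairwise (\<lambda>I J. disjnt {fst I<..<snd I} {fst J<..<snd J}) C"
      "(\<Union>I\<in>K'. {fst I<..<snd I}) \<subseteq> (\<Union>I\<in>C. {2 * fst I - snd I<..<2 * snd I - fst I})"
      using less(1)[of K'] less(3,4) by (auto simp: K'_def)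
    show ?thesis
    proof (rule less(2)[of "insert J C"])
      show "insert J C \<subseteq> K" using J(1) C(1) by (auto simp: K'_def)
      show "pairwise (\<lambda>I J. disjnt {fst I<..<snd I} {fst J<..<snd J}) (insert J C)"
        using C(1,2) by (auto simp: pairwise_insert K'_def disjnt_sym)
      have "{fst I<..<snd I} \<subseteq> {2 * fst J - snd J<..<2 * snd J - fst J}" if "I \<in> K" "I \<notin> K'" for I
        using that J_max[of I] unfolding K'_def len_def disjnt_def by fastforce
      then show "(\<Union>I\<in>K. {fst I<..<snd I}) \<subseteq> (\<Union>I\<in>insert J C. {2 * fst I - snd I<..<2 * snd I - fst I})"
        using C(3) by blast
    qed
  qed
qed

definition ival_Ap :: "real \<Rightarrow> (real \<Rightarrow> real) \<Rightarrow> real \<Rightarrow> bool" where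
  "ival_Ap s w W \<longleftrightarrow> (\<forall>(a, b)\<in>rat_ivals.
     (mass w {a<..<b}) * epowr (mass (dual s w) {a<..<b}) (s - 1)
       \<le> ennreal (W * (b - a) powr s))"

text \<open>
  The \<open>A\<^sub>s\<close> condition is applied on the triple of the interval to the function \<open>g\<close> cut off outside the
  interval itself. The weight of the triple is thus controlled at the cost of \<open>3 powr s\<close>, and the
  constant \<open>W\<close> is used only once; a separate doubling estimate would square it.
\<close>

lemma ival_Ap_triple:
  assumes ap: "ival_Ap s w W" and ab: "(a, b) \<in> rat_ivals" and [measurable]: "w \<in> borel_measurable borel" "g \<in> borel_measurable borel"
    and w: "\<And>x. 0 < w x" and s: "1 < s" and l: "0 < l" and W: "0 \<le> W"
    and big: "ennreal l * ennreal (b - a) \<le> (\<integral>\<^sup>+ t\<in>{a<..<b}. g t \<partial>lborel)"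
  shows "(mass w {2 * a - b<..<2 * b - a}) \<le>
    ennreal (3 powr s * W / l powr s) * (\<integral>\<^sup>+ t\<in>{a<..<b}. epowr (g t) s * ennreal (w t) \<partial>lborel)"
proof -
  let ?A = "{a<..<b}" and ?B = "{2 * a - b<..<2 * b - a}"
  have ab': "a < b" "a \<in> \<rat>" "b \<in> \<rat>" using ab by (auto simp: rat_ivals_def)
  have AB: "?A \<subseteq> ?B" using ab' by auto
  have B: "(2 * a - b, 2 * b - a) \<in> rat_ivals"
    using ab' by (auto simp: rat_ivals_def)
  define D where "D = (mass (dual s w) ?B)"
  define V where "V = (mass w ?B)"
  define P where "P = (\<integral>\<^sup>+ t\<in>?A. epowr (g t) s * ennreal (w t) \<partial>lborel)"
  have VD: "V * epowr D (s - 1) \<le> ennreal (W * (3 * (b - a)) powr s)"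
    using ap B unfolding ival_Ap_def D_def V_def by (auto simp: algebra_simps)
  \<comment> \<open>Positivity of \<open>V\<close> is what makes the dual integral \<open>D\<close> finite, although \<open>D\<close> occurs only in a product.\<close>
  have Vpos: "V > 0"
  proof -
    have "V \<noteq> 0"
    proof
      assume "V = 0"
      then have "AE t in lborel. ennreal (w t) * indicator ?B t = 0"
        unfolding V_def by (subst (asm) nn_integral_0_iff_AE) auto
      then have "AE t in lborel. t \<notin> ?B"
      proof eventually_elim
        case (elim t) then show ?case using w[of t] by (auto simp: indicator_def ennreal_eq_0_iff split: if_splits)
      qed
      then have "?B \<in> null_sets lborel" by (subst (asm) AE_iff_null_sets[symmetric]) auto
      then have "emeasure lborel ?B = 0" by (rule null_setsD1)
      then show False using ab' by simp
    qed
    then show ?thesis by (simp add: zero_less_iff_neq_zero)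
  qed
  have Dfin: "D < top"
  proof (rule ccontr)
    assume "\<not> D < top"
    then have "D = top" using less_top by metis
    moreover have "V \<noteq> 0" using Vpos by simp
    ultimately show False using VD by (simp add: ennreal_mult_top top_unique)
  qed
  let ?M = "density lborel (indicator ?A)"
  have restr: "(\<integral>\<^sup>+ t. h t \<partial>?M) = (\<integral>\<^sup>+ t\<in>?A. h t \<partial>lborel)" if [measurable]: "h \<in> borel_measurable borel" for h
    by (subst nn_integral_density) (auto simp: mult.commute)
  have Dle: "(mass (dual s w) ?A) \<le> D"
    unfolding D_def using AB by (intro nn_integral_mono) (auto simp: indicator_def)
  have "epowr (\<integral>\<^sup>+ t. g t \<partial>?M) s \<le> (\<integral>\<^sup>+ t. epowr (g t) s * ennreal (w t) \<partial>?M)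
            * epowr (\<integral>\<^sup>+ t. ennreal (dual s w t) \<partial>?M) (s - 1)"
    by (rule average_powr_le) (use w s Dle Dfin in \<open>auto simp: restr\<close>)
  also have "\<dots> \<le> P * epowr D (s - 1)"
    using Dle s by (auto simp: restr P_def intro!: mult_left_mono epowr_mono)
  finally have "epowr (ennreal l * ennreal (b - a)) s \<le> P * epowr D (s - 1)"
    using big s by (auto simp: restr intro: order.trans[OF epowr_mono])
  then have "ennreal ((l * (b - a)) powr s) * V \<le> P * epowr D (s - 1) * V"
    using l ab' by (intro mult_right_mono) (auto simp: epowr_ennreal ennreal_mult[symmetric])
  also have "\<dots> \<le> P * ennreal (W * (3 * (b - a)) powr s)"
    using mult_left_mono[OF VD, of P] by (simp add: mult_ac)
  finally have main: "ennreal ((l * (b - a)) powr s) * V \<le> P * ennreal (W * (3 * (b - a)) powr s)" .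
  have "V = ennreal (1 / (l * (b - a)) powr s) * (ennreal ((l * (b - a)) powr s) * V)"
    using l ab' by (simp add: mult.assoc[symmetric] ennreal_mult[symmetric])
  also have "\<dots> \<le> ennreal (1 / (l * (b - a)) powr s) * (P * ennreal (W * (3 * (b - a)) powr s))"
    using main by (rule mult_left_mono) simp
  also have "\<dots> = ennreal (1 / (l * (b - a)) powr s * (W * (3 * (b - a)) powr s)) * P"
  proof -
    have "ennreal k * (P * ennreal (W * m)) = ennreal (k * (W * m)) * P" if "0 \<le> k" "0 \<le> m" for k m
      using that W by (subst ennreal_mult) (auto simp: mult_ac)
    then show ?thesis by simp
  qed
  also have "1 / (l * (b - a)) powr s * (W * (3 * (b - a)) powr s) = 3 powr s * W / l powr s"
  proof -
    have "(3 * (b - a)) powr s = 3 powr s * (b - a) powr s" "(l * (b - a)) powr s = l powr s * (b - a) powr s"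
      using l ab' by (auto simp only: powr_mult)
    then show ?thesis using l ab' by simp
  qed
  finally show ?thesis by (simp add: V_def P_def)
qed

text \<open>
  The level set is a countable union of intervals with large average. For finitely many of them, a
  disjoint Vitali subfamily has triples that cover, and \<open>ival_Ap_triple\<close> is summed over it; continuity
  of the measure from below does the rest.
\<close>

lemma HL1_weak_type:
  assumes ap: "ival_Ap s w W" and [measurable]: "w \<in> borel_measurable borel" "g \<in> borel_measurable borel"
    and w: "\<And>x. 0 < w x" and s: "1 < s" and l: "0 < l" and W: "0 \<le> W"
  shows "(mass w {t. ennreal l < HL1 g t}) \<le>
    ennreal (3 powr s * W / l powr s) * (\<integral>\<^sup>+ t. epowr (g t) s * ennreal (w t) \<partial>lborel)"
proof -
  define c where "c = ennreal (3 powr s * W / l powr s)"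
  define G where "G = {I \<in> rat_ivals. ennreal l < (\<integral>\<^sup>+ t\<in>{fst I<..<snd I}. g t \<partial>lborel) / ennreal (snd I - fst I)}"
  have G: "countable G" unfolding G_def by (rule countable_subset[OF _ countable_rat_ivals]) auto
  have set_eq: "{t. ennreal l < HL1 g t} = (\<Union>I\<in>G. {fst I<..<snd I})"
  proof -
    have "ennreal l < indicator A t * X \<longleftrightarrow> t \<in> A \<and> ennreal l < X" for A :: "real set" and t and X :: ennreal
      by (cases "t \<in> A") auto
    then show ?thesis
      unfolding HL1_def less_SUP_iff G_def by (fastforce simp: case_prod_beta)
  qed
  define mu where "mu = density lborel (\<lambda>t. ennreal (w t))"
  have mu: "emeasure mu A = (mass w A)" if "A \<in> sets borel" for A
    unfolding mu_def using that by (subst emeasure_density) auto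
  have fin: "emeasure mu (\<Union>I\<in>K. {fst I<..<snd I}) \<le> c * (\<integral>\<^sup>+ t. epowr (g t) s * ennreal (w t) \<partial>lborel)"
    if K: "finite K" "K \<subseteq> G" for K
  proof -
    obtain C where C: "C \<subseteq> K" "pairwise (\<lambda>I J. disjnt {fst I<..<snd I} {fst J<..<snd J}) C"
      "(\<Union>I\<in>K. {fst I<..<snd I}) \<subseteq> (\<Union>I\<in>C. {2 * fst I - snd I<..<2 * snd I - fst I})"
    proof (rule Vitali_finite_ivals)
      show "fst I < snd I" if "I \<in> K" for I using that K by (auto simp: G_def rat_ivals_def)
    qed (use K in auto)
    have fC: "finite C" using C K finite_subset by blast
    have "emeasure mu (\<Union>I\<in>K. {fst I<..<snd I}) \<le> emeasure mu (\<Union>I\<in>C. {2 * fst I - snd I<..<2 * snd I - fst I})"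
      using C(3) fC by (intro emeasure_mono) (auto simp: mu_def intro!: sets.finite_UN)
    also have "\<dots> \<le> (\<Sum>I\<in>C. emeasure mu {2 * fst I - snd I<..<2 * snd I - fst I})"
      using fC by (intro emeasure_subadditive_finite) (auto simp: mu_def)
    also have "\<dots> \<le> (\<Sum>I\<in>C. c * (\<integral>\<^sup>+ t\<in>{fst I<..<snd I}. epowr (g t) s * ennreal (w t) \<partial>lborel))"
    proof (rule sum_mono)
      fix I assume "I \<in> C"
      then have I: "I \<in> G" using C K by auto
      have "0 < ennreal (snd I - fst I)" using I by (auto simp: G_def rat_ivals_def)
      then have "ennreal l * ennreal (snd I - fst I) \<le> (\<integral>\<^sup>+ t\<in>{fst I<..<snd I}. g t \<partial>lborel) / ennreal (snd I - fst I) * ennreal (snd I - fst I)"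
        using I by (intro mult_right_mono) (auto simp: G_def)
      also have "\<dots> = (\<integral>\<^sup>+ t\<in>{fst I<..<snd I}. g t \<partial>lborel)"
        using \<open>0 < ennreal (snd I - fst I)\<close> by (simp add: ennreal_divide_times ennreal_mult_divide_eq)
      finally show "emeasure mu {2 * fst I - snd I<..<2 * snd I - fst I} \<le> c * (\<integral>\<^sup>+ t\<in>{fst I<..<snd I}. epowr (g t) s * ennreal (w t) \<partial>lborel)"
        unfolding c_def using I
        by (subst mu) (auto simp: G_def intro!: ival_Ap_triple[OF ap _ _ _ w s l W])
    qed
    also have "\<dots> = c * (\<integral>\<^sup>+ t\<in>(\<Union>I\<in>C. {fst I<..<snd I}). epowr (g t) s * ennreal (w t) \<partial>lborel)"
    proof -
      have "disjoint_family_on (\<lambda>I. {fst I<..<snd I}) C"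
        using C(2) by (auto simp: disjoint_family_on_def pairwise_def disjnt_def)
      then have "(\<integral>\<^sup>+ t\<in>(\<Union>I\<in>C. {fst I<..<snd I}). epowr (g t) s * ennreal (w t) \<partial>lborel) =
        (\<integral>\<^sup>+ t. (\<Sum>I\<in>C. epowr (g t) s * ennreal (w t) * indicator {fst I<..<snd I} t) \<partial>lborel)"
        using fC by (simp add: indicator_UN_disjoint sum_distrib_left)
      also have "\<dots> = (\<Sum>I\<in>C. \<integral>\<^sup>+ t\<in>{fst I<..<snd I}. epowr (g t) s * ennreal (w t) \<partial>lborel)"
        by (rule nn_integral_sum) simp
      finally show ?thesis by (simp add: sum_distrib_left)
    qed
    also have "\<dots> \<le> c * (\<integral>\<^sup>+ t. epowr (g t) s * ennreal (w t) \<partial>lborel)"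
      by (intro mult_left_mono nn_integral_mono) (auto simp: indicator_def)
    finally show ?thesis .
  qed
  show ?thesis
  proof (cases "G = {}")
    case True
    then show ?thesis unfolding set_eq by simp
  next
    case False
    define K where "K n = from_nat_into G ` {..<n}" for n
    have K: "finite (K n)" "K n \<subseteq> G" for n
      using from_nat_into[OF False] by (auto simp: K_def)
    have UK: "(\<Union>n. K n) = G"
      using range_from_nat_into[OF False G] by (auto simp: K_def)
    define E where "E n = (\<Union>I\<in>K n. {fst I<..<snd I})" for n
    have "(\<Union>I\<in>G. {fst I<..<snd I}) = (\<Union>n. E n)"
      unfolding UK[symmetric] E_def by auto
    moreover have "emeasure mu (\<Union>n. E n) = (SUP n. emeasure mu (E n))"
    proof (rule SUP_emeasure_incseq[symmetric])
      show "range E \<subseteq> sets mu" unfolding mu_def E_def using K(1) by (auto intro!: sets.finite_UN)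
      show "incseq E" unfolding incseq_def E_def K_def by fastforce
    qed
    moreover have "\<dots> \<le> c * (\<integral>\<^sup>+ t. epowr (g t) s * ennreal (w t) \<partial>lborel)"
      unfolding E_def by (intro SUP_least fin K)
    moreover have "(\<Union>I\<in>G. {fst I<..<snd I}) \<in> sets borel" using G by auto
    ultimately show ?thesis by (simp add: set_eq mu[symmetric] c_def)
  qed
qed

section \<open>Coordinate maximal functions and the strong maximal function on weighted spaces\<close>

lemma ennreal_mult_real_assoc:
  "0 \<le> a \<Longrightarrow> 0 \<le> b \<Longrightarrow> ennreal a * (ennreal b * X) = ennreal (a * b) * X"
  by (simp add: ennreal_mult mult.assoc)

definition slice_Ap :: "real \<Rightarrow> (real ^ 'n::finite \<Rightarrow> real) \<Rightarrow> real \<Rightarrow> bool" where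
  "slice_Ap s w W \<longleftrightarrow> (\<forall>i. AE x in lborel. ival_Ap s (\<lambda>t. w (set_coord i t x)) W)"

lemma HLc_weak_type:
  fixes w :: "real ^ 'n::finite \<Rightarrow> real"
  assumes ap: "slice_Ap s w W" and [measurable]: "w \<in> borel_measurable borel" "F \<in> borel_measurable borel"
    and w: "\<And>x. 0 < w x" and s: "1 < s" and l: "0 < l" and W: "0 \<le> W"
  shows "(mass w {x. ennreal l < HLc i F x}) \<le>
    ennreal (3 powr s * W / l powr s) * (powint s w F)"
proof -
  define c where "c = ennreal (3 powr s * W / l powr s)"
  have "(mass w {x. ennreal l < HLc i F x}) =
    (\<integral>\<^sup>+ x. indicator {0<..<1} (x $ i) * (\<integral>\<^sup>+ t\<in>{t. ennreal l < HL1 (\<lambda>s. F (set_coord i s x)) t}. ennreal (w (set_coord i t x)) \<partial>lborel) \<partial>lborel)"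
    by (subst fubini_coord[of _ i]) (auto simp: HLc_set_coord indicator_def)
  also have "\<dots> \<le> (\<integral>\<^sup>+ x. indicator {0<..<1} (x $ i) * (c * (\<integral>\<^sup>+ t. epowr (F (set_coord i t x)) s * ennreal (w (set_coord i t x)) \<partial>lborel)) \<partial>lborel)"
  proof (rule nn_integral_mono_AE)
    have "AE x in lborel. ival_Ap s (\<lambda>t. w (set_coord i t x)) W" using ap by (simp add: slice_Ap_def)
    then show "AE x in lborel. indicator {0<..<1} (x $ i) * (\<integral>\<^sup>+ t\<in>{t. ennreal l < HL1 (\<lambda>s. F (set_coord i s x)) t}. ennreal (w (set_coord i t x)) \<partial>lborel)
      \<le> indicator {0<..<1} (x $ i) * (c * (\<integral>\<^sup>+ t. epowr (F (set_coord i t x)) s * ennreal (w (set_coord i t x)) \<partial>lborel))"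
    proof eventually_elim
      case (elim x)
      show ?case
        unfolding c_def by (intro mult_left_mono HL1_weak_type[OF elim _ _ w s l W]) auto
    qed
  qed
  also have "\<dots> = c * (\<integral>\<^sup>+ x. indicator {0<..<1} (x $ i) * (\<integral>\<^sup>+ t. epowr (F (set_coord i t x)) s * ennreal (w (set_coord i t x)) \<partial>lborel) \<partial>lborel)"
    by (subst nn_integral_cmult[symmetric]) (auto simp: mult_ac)
  also have "\<dots> = c * (powint s w F)"
    by (subst (2) fubini_coord[of _ i]) auto
  finally show ?thesis by (simp add: c_def)
qed

lemma HL1_split:
  assumes [measurable]: "g \<in> borel_measurable borel"
  shows "HL1 g t \<le> HL1 (\<lambda>t. g t * indicator {t. ennreal m < g t} t) t + ennreal m"
  unfolding HL1_def[of g]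
proof (rule SUP_least, clarify)
  fix a b assume ab: "(a, b) \<in> rat_ivals"
  then have lt: "a < b" by (simp add: rat_ivals_def)
  let ?h = "\<lambda>t. g t * indicator {t. ennreal m < g t} t"
  have "(\<integral>\<^sup>+ s\<in>{a<..<b}. g s \<partial>lborel) \<le> (\<integral>\<^sup>+ s. ?h s * indicator {a<..<b} s + ennreal m * indicator {a<..<b} s \<partial>lborel)"
    by (intro nn_integral_mono) (auto simp: indicator_def not_less)
  also have "\<dots> = (\<integral>\<^sup>+ s\<in>{a<..<b}. ?h s \<partial>lborel) + ennreal m * ennreal (b - a)"
    using lt by (subst nn_integral_add) (auto simp: nn_integral_cmult)
  finally have "(\<integral>\<^sup>+ s\<in>{a<..<b}. g s \<partial>lborel) / ennreal (b - a) \<le>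
     ((\<integral>\<^sup>+ s\<in>{a<..<b}. ?h s \<partial>lborel) + ennreal m * ennreal (b - a)) / ennreal (b - a)"
    by (rule divide_right_mono_ennreal)
  also have "\<dots> = (\<integral>\<^sup>+ s\<in>{a<..<b}. ?h s \<partial>lborel) / ennreal (b - a) + ennreal m"
    using lt by (simp add: add_divide_distrib_ennreal ennreal_mult_divide_eq)
  finally have *: "(\<integral>\<^sup>+ s\<in>{a<..<b}. g s \<partial>lborel) / ennreal (b - a) \<le> (\<integral>\<^sup>+ s\<in>{a<..<b}. ?h s \<partial>lborel) / ennreal (b - a) + ennreal m" .
  have "indicator {a<..<b} t * ((\<integral>\<^sup>+ s\<in>{a<..<b}. g s \<partial>lborel) / ennreal (b - a)) \<le>
      indicator {a<..<b} t * ((\<integral>\<^sup>+ s\<in>{a<..<b}. ?h s \<partial>lborel) / ennreal (b - a)) + ennreal m"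
    using * by (cases "t \<in> {a<..<b}") auto
  also have "\<dots> \<le> HL1 ?h t + ennreal m"
    unfolding HL1_def using ab by (intro add_right_mono SUP_upper2[of "(a, b)"]) auto
  finally show "indicator {a<..<b} t * ((\<integral>\<^sup>+ s\<in>{a<..<b}. g s \<partial>lborel) / ennreal (b - a)) \<le> HL1 ?h t + ennreal m" .
qed

text \<open>
  The part of \<open>F\<close> below \<open>l / 2\<close> contributes at most \<open>l / 2\<close> to any average.
\<close>

lemma HLc_level_split:
  assumes [measurable]: "F \<in> borel_measurable borel" and l: "0 < l" and less: "ennreal l < HLc i F x"
  shows "ennreal (l / 2) < HLc i (\<lambda>x. F x * indicator {x. ennreal (l / 2) < F x} x) x"
proof (rule ccontr)
  assume "\<not> ?thesis"
  then have "HLc i (\<lambda>x. F x * indicator {x. ennreal (l / 2) < F x} x) x + ennreal (l / 2) \<le> ennreal (l/2) + ennreal (l/2)"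
    by (intro add_right_mono) simp
  also have "\<dots> = ennreal l" using l by (simp add: ennreal_plus[symmetric] del: ennreal_plus)
  finally have "HLc i (\<lambda>x. F x * indicator {x. ennreal (l / 2) < F x} x) x + ennreal (l / 2) \<le> ennreal l" .
  moreover have "HLc i F x \<le> HLc i (\<lambda>x. F x * indicator {x. ennreal (l / 2) < F x} x) x + ennreal (l / 2)"
    using HL1_split[of "\<lambda>t. F (set_coord i t x)" "x $ i" "l/2"]
    by (simp add: HLc_def indicator_def)
  ultimately show False using less by (meson leD order_trans)
qed

text \<open>
  Marcinkiewicz interpolation between the weak type \<open>(s, s)\<close> and \<open>L\<^sup>\<infinity>\<close>: in the layer-cake formula, the
  level set at height \<open>l\<close> is estimated with the part of \<open>F\<close> above \<open>l / 2\<close>. The order of integration is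
  then exchanged twice. The weak-type constant \<open>W\<close> enters linearly.
\<close>

lemma HLc_strong_type:
  fixes w :: "real ^ 'n::finite \<Rightarrow> real"
  assumes ap: "slice_Ap s w W" and [measurable]: "w \<in> borel_measurable borel" "F \<in> borel_measurable borel"
    and w: "\<And>x. 0 < w x" and s: "1 < s" "s < r" and W: "0 \<le> W"
  shows "(powint r w (HLc i F)) \<le>
    ennreal (6 powr r * W * (r / (r - s))) * (powint r w F)"
proof -
  let ?H = "HLc i F"
  let ?B = "\<lambda>x l. ennreal (6 powr s * W * r * l powr (r - s - 1)) * indicator {l. ennreal (l / 2) < F x} l * indicator {0<..} l * (epowr (F x) s * ennreal (w x))"
  let ?A = "\<lambda>x l. ennreal (r * l powr (r - 1)) * indicator {l. ennreal l < ?H x} l * indicator {0<..} l * ennreal (w x)"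
  have "(powint r w ?H) =
    (\<integral>\<^sup>+ x. \<integral>\<^sup>+ l. (?A x l) \<partial>lborel \<partial>lborel)"
    using s by (subst epowr_layer_cake) (auto simp: nn_integral_multc)
  also have "\<dots> = (\<integral>\<^sup>+ l. \<integral>\<^sup>+ x. (?A x l) \<partial>lborel \<partial>lborel)"
    by (rule lborel_pair.Fubini') measurable
  also have "\<dots> \<le> (\<integral>\<^sup>+ l. \<integral>\<^sup>+ x. (?B x l) \<partial>lborel \<partial>lborel)"
  proof (rule nn_integral_mono)
    fix l :: real
    show "(\<integral>\<^sup>+ x. (?A x l) \<partial>lborel) \<le>
      (\<integral>\<^sup>+ x. (?B x l) \<partial>lborel)"
    proof (cases "0 < l")
      case l: True
      let ?G = "\<lambda>x. F x * indicator {x. ennreal (l / 2) < F x} x"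
      have "(\<integral>\<^sup>+ x. (?A x l) \<partial>lborel) =
         ennreal (r * l powr (r - 1)) * (mass w {x. ennreal l < ?H x})"
        using l by (subst nn_integral_cmult[symmetric]) (auto simp: mult_ac indicator_def intro!: nn_integral_cong)
      also have "\<dots> \<le> ennreal (r * l powr (r - 1)) * (mass w {x. ennreal (l / 2) < HLc i ?G x})"
        using HLc_level_split[OF _ l, of F i] by (intro mult_left_mono nn_integral_mono) (auto simp: indicator_def)
      also have "\<dots> \<le> ennreal (r * l powr (r - 1)) * (ennreal (3 powr s * W / (l / 2) powr s) * (powint s w ?G))"
        using l by (intro mult_left_mono HLc_weak_type[OF ap _ _ w s(1) _ W]) auto
      also have "\<dots> = ennreal (6 powr s * W * r * l powr (r - s - 1)) * (powint s w ?G)"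
      proof -
        have "(r * l powr (r - 1)) * (3 powr s * W / (l / 2) powr s) = 6 powr s * W * r * l powr (r - s - 1)"
        proof -
          have "(6::real) powr s = 3 powr s * 2 powr s" using powr_mult[of 3 2 s] by simp
          moreover have "(l / 2) powr s = l powr s / 2 powr s" using l by (simp add: powr_divide)
          moreover have "l powr (r - s - 1) = l powr (r - 1) / l powr s" using l by (simp add: powr_diff)
          ultimately show ?thesis by simp
        qed
        then show ?thesis using s W by (subst mult.assoc[symmetric], subst ennreal_mult[symmetric]) auto
      qed
      also have "\<dots> = (\<integral>\<^sup>+ x. (?B x l) \<partial>lborel)"
        using l by (subst nn_integral_cmult[symmetric]) (auto simp: mult_ac indicator_def intro!: nn_integral_cong)
      finally show ?thesis .
    qed simp
  qed
  also have "\<dots> = (\<integral>\<^sup>+ x. \<integral>\<^sup>+ l. (?B x l) \<partial>lborel \<partial>lborel)"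
    by (rule lborel_pair.Fubini'[symmetric]) measurable
  also have "\<dots> = (\<integral>\<^sup>+ x. ennreal (6 powr s * W * (r / (r - s)) * 2 powr (r - s)) * (epowr (F x) r * ennreal (w x)) \<partial>lborel)"
  proof (rule nn_integral_cong)
    fix x
    define k where "k = 6 powr s * W * (r / (r - s))"
    have k: "0 \<le> k" using s W by (simp add: k_def)
    have "(\<integral>\<^sup>+ l. (?B x l) \<partial>lborel)
      = (\<integral>\<^sup>+ l. ennreal k * (ennreal ((r - s) * l powr (r - s - 1)) * indicator {l. ennreal l < 2 * F x} l * indicator {0<..} l) * (epowr (F x) s * ennreal (w x)) \<partial>lborel)"
    proof (rule nn_integral_cong)
      fix l :: real
      have 1: "6 powr s * W * r * l powr (r - s - 1) = k * ((r - s) * l powr (r - s - 1))"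
        using s by (simp add: k_def)
      have 2: "0 < l \<Longrightarrow> ennreal (l / 2) < F x \<longleftrightarrow> ennreal l < 2 * F x"
      proof (cases "F x")
        case (real y)
        then have "2 * F x = ennreal (2 * y)" by (simp add: ennreal_mult)
        then show "0 < l \<Longrightarrow> ?thesis"
          unfolding \<open>2 * F x = ennreal (2 * y)\<close> using real by (auto simp: ennreal_less_iff)
      qed (auto simp: ennreal_mult_top)
      have 3: "indicator {l. ennreal (l / 2) < F x} l * indicator {0<..} l = (indicator {l. ennreal l < 2 * F x} l * indicator {0<..} l :: ennreal)"
        using 2 by (auto simp: indicator_def)
      have "ennreal (6 powr s * W * r * l powr (r - s - 1)) = ennreal k * ennreal ((r - s) * l powr (r - s - 1))"
        unfolding 1 using k s by (intro ennreal_mult) auto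
      then show "(?B x l) =
        ennreal k * (ennreal ((r - s) * l powr (r - s - 1)) * indicator {l. ennreal l < 2 * F x} l * indicator {0<..} l) * (epowr (F x) s * ennreal (w x))"
        using 3 by (simp only: mult.assoc)
    qed
    also have "\<dots> = ennreal k * epowr (2 * F x) (r - s) * (epowr (F x) s * ennreal (w x))"
      using s by (subst epowr_layer_cake) (auto simp: nn_integral_multc nn_integral_cmult)
    also have "epowr (2 * F x) (r - s) = ennreal (2 powr (r - s)) * epowr (F x) (r - s)"
      using s epowr_ennreal[of 2 "r - s"] by (simp add: epowr_mult)
    also have "ennreal k * (ennreal (2 powr (r - s)) * epowr (F x) (r - s)) * (epowr (F x) s * ennreal (w x)) =
        ennreal k * ennreal (2 powr (r - s)) * (epowr (F x) (r - s) * epowr (F x) s * ennreal (w x))"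
      by (simp add: mult_ac)
    also have "epowr (F x) (r - s) * epowr (F x) s = epowr (F x) r"
      using s by (subst epowr_add[symmetric]) auto
    also have "ennreal k * ennreal (2 powr (r - s)) = ennreal (k * 2 powr (r - s))"
      using k by (simp add: ennreal_mult)
    finally show "(\<integral>\<^sup>+ l. (?B x l) \<partial>lborel) =
       ennreal (6 powr s * W * (r / (r - s)) * 2 powr (r - s)) * (epowr (F x) r * ennreal (w x))"
      by (simp add: k_def)
  qed
  also have "\<dots> = ennreal (6 powr s * W * (r / (r - s)) * 2 powr (r - s)) * (powint r w F)"
    by (rule nn_integral_cmult) measurable
  also have "\<dots> \<le> ennreal (6 powr r * W * (r / (r - s))) * (powint r w F)"
  proof (intro mult_right_mono ennreal_leI)
    have "6 powr s * 2 powr (r - s) \<le> 6 powr s * (6::real) powr (r - s)"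
      using s by (intro mult_left_mono powr_mono2) auto
    also have "\<dots> = 6 powr r" by (simp add: powr_add[symmetric])
    finally have "6 powr s * 2 powr (r - s) * (W * (r / (r - s))) \<le> 6 powr r * (W * (r / (r - s)))"
      using W s by (intro mult_right_mono) auto
    then show "6 powr s * W * (r / (r - s)) * 2 powr (r - s) \<le> 6 powr r * W * (r / (r - s))"
      by (simp only: mult_ac)
  qed simp
  finally show ?thesis .
qed

lemma iter_HL_strong_type:
  fixes w :: "real ^ 'n::finite \<Rightarrow> real"
  assumes ap: "slice_Ap s w W" and [measurable]: "w \<in> borel_measurable borel" "F \<in> borel_measurable borel"
    and w: "\<And>x. 0 < w x" and s: "1 < s" "s < r" and W: "0 \<le> W"
  shows "(powint r w (iter_HL is F)) \<le>
    ennreal ((6 powr r * W * (r / (r - s))) ^ length is) * (powint r w F)"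
proof (induction "is")
  case (Cons i "is")
  let ?c = "6 powr r * W * (r / (r - s))"
  have c: "0 \<le> ?c" using s W by auto
  have "(\<integral>\<^sup>+ x. epowr (iter_HL (i # is) F x) r * ennreal (w x) \<partial>lborel) \<le>
     ennreal ?c * (powint r w (iter_HL is F))"
    unfolding iter_HL.simps by (rule HLc_strong_type[OF ap _ _ w s W]) auto
  also have "\<dots> \<le> ennreal ?c * (ennreal (?c ^ length is) * (powint r w F))"
    by (intro mult_left_mono Cons.IH) auto
  also have "\<dots> = ennreal (?c ^ length (i # is)) * (powint r w F)"
    unfolding list.size(4) add_Suc_right add_0_right power_Suc by (rule ennreal_mult_real_assoc) (use c in auto)
  finally show ?case .
qed simp

text \<open>
  The strong maximal function for extended nonnegative functions and Borel measure, indexed by the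
  corners of the rectangles.
\<close>

definition rect_max :: "(real ^ 'n::finite \<Rightarrow> ennreal) \<Rightarrow> real ^ 'n \<Rightarrow> ennreal" where
  "rect_max F x = (SUP (a, b)\<in>{(a, b). x \<in> box a b}. (\<integral>\<^sup>+ y\<in>box a b. F y \<partial>lborel) / emeasure lborel (box a b))"

abbreviation local_max :: "(real ^ 'n::finite \<Rightarrow> real) \<Rightarrow> (real ^ 'n) set \<Rightarrow> real ^ 'n \<Rightarrow> ennreal" where
  "local_max v S \<equiv> rect_max (\<lambda>y. ennreal (v y) * indicator S y)"

lemma rect_max_le_iter_HL:
  fixes F :: "real ^ 'n::finite \<Rightarrow> ennreal"
  assumes "F \<in> borel_measurable borel" "set is = UNIV"
  shows "rect_max F x \<le> 2 ^ length is * iter_HL is F x"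
  unfolding rect_max_def using box_average_le_iter_HL[OF assms(1) _ assms(2)]
  by (auto intro!: SUP_least)

lemma ex_coord_list: "\<exists>is :: 'n::finite list. set is = UNIV \<and> length is = CARD('n)"
  using finite_distinct_list[OF finite_class.finite_UNIV] by (metis distinct_card)

text \<open>
  Only the outermost coordinate maximal function is estimated by its weak type; the other \<open>n - 1\<close> ones
  act boundedly on \<open>L\<^sup>r(w)\<close>.
\<close>

lemma rect_max_weak_type:
  fixes w :: "real ^ 'n::finite \<Rightarrow> real"
  assumes ap: "slice_Ap s w W" "slice_Ap r w V" and [measurable]: "w \<in> borel_measurable borel" "F \<in> borel_measurable borel"
    and w: "\<And>x. 0 < w x" and s: "1 < s" "s < r" and W: "0 \<le> W" "0 \<le> V" and l: "0 < l"
  shows "(mass w {x. ennreal l < rect_max F x}) \<le>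
    ennreal ((3 * 2 ^ CARD('n)) powr r * V * (6 powr r * W * (r / (r - s))) ^ (CARD('n) - 1) / l powr r)
      * (powint r w F)"
proof -
  let ?c = "6 powr r * W * (r / (r - s))"
  have c: "0 \<le> ?c" using s W by auto
  obtain "is" :: "'n list" where "is": "set is = UNIV" "length is = CARD('n)" using ex_coord_list by auto
  then obtain i js where ij: "is = i # js" by (cases "is") auto
  let ?N = "2 ^ CARD('n) :: real"
  have N: "2 ^ CARD('n) = ennreal ?N" by (simp add: ennreal_power[symmetric])
  have "(mass w {x. ennreal l < rect_max F x}) \<le>
     (mass w {x. ennreal (l / ?N) < HLc i (iter_HL js F) x})"
  proof (intro nn_integral_mono mult_left_mono)
    fix x
    have "ennreal (l / ?N) < HLc i (iter_HL js F) x" if "ennreal l < rect_max F x"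
    proof (rule ccontr)
      assume "\<not> ennreal (l / ?N) < HLc i (iter_HL js F) x"
      then have "ennreal ?N * HLc i (iter_HL js F) x \<le> ennreal ?N * ennreal (l / ?N)" by (intro mult_left_mono) auto
      also have "\<dots> = ennreal l" using l by (simp add: ennreal_mult[symmetric])
      finally have "2 ^ CARD('n) * iter_HL is F x \<le> ennreal l" by (simp add: ij N)
      moreover have "rect_max F x \<le> 2 ^ CARD('n) * iter_HL is F x"
        using rect_max_le_iter_HL[OF _ "is"(1), of F x] "is"(2) by simp
      ultimately have "rect_max F x \<le> ennreal l" by (rule order_trans[rotated])
      with that show False by simp
    qed
    then show "indicator {x. ennreal l < rect_max F x} x \<le> (indicator {x. ennreal (l / ?N) < HLc i (iter_HL js F) x} x :: ennreal)"
      by (auto simp: indicator_def)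
  qed simp
  also have "\<dots> \<le> ennreal (3 powr r * V / (l / ?N) powr r) * (powint r w (iter_HL js F))"
    using s l by (intro HLc_weak_type[OF ap(2) _ _ w _ _ W(2)]) auto
  also have "\<dots> \<le> ennreal (3 powr r * V / (l / ?N) powr r) * (ennreal (?c ^ length js) * (powint r w F))"
    by (intro mult_left_mono iter_HL_strong_type[OF ap(1) _ _ w s W(1)]) auto
  also have "\<dots> = ennreal (3 powr r * V / (l / ?N) powr r * ?c ^ length js) * (powint r w F)"
    by (rule ennreal_mult_real_assoc) (use W c in auto)
  also have "3 powr r * V / (l / ?N) powr r * ?c ^ length js = (3 * ?N) powr r * V * ?c ^ (CARD('n) - 1) / l powr r"
  proof -
    have "length js = CARD('n) - 1" using "is" ij by simp
    moreover have "(l / ?N) powr r = l powr r / ?N powr r" using l by (simp add: powr_divide)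
    moreover have "(3 * ?N) powr r = 3 powr r * ?N powr r" by (simp add: powr_mult)
    ultimately show ?thesis by simp
  qed
  finally show ?thesis .
qed

lemma rect_max_strong_type:
  fixes w :: "real ^ 'n::finite \<Rightarrow> real"
  assumes ap: "slice_Ap s w W" and [measurable]: "w \<in> borel_measurable borel" "F \<in> borel_measurable borel"
    and w: "\<And>x. 0 < w x" and s: "1 < s" "s < r" and W: "0 \<le> W"
  shows "(powint r w (rect_max F)) \<le>
    ennreal ((2 powr r * (6 powr r * W * (r / (r - s)))) ^ CARD('n)) * (powint r w F)"
proof -
  let ?c = "6 powr r * W * (r / (r - s))"
  have c: "0 \<le> ?c" using s W by auto
  obtain "is" :: "'n list" where "is": "set is = UNIV" "length is = CARD('n)" using ex_coord_list by auto
  have N: "epowr (2 ^ CARD('n)) r = ennreal ((2 powr r) ^ CARD('n))"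
  proof -
    have "epowr (2 ^ CARD('n)) r = epowr (ennreal (2 ^ CARD('n))) r" by (simp add: ennreal_power[symmetric])
    also have "\<dots> = ennreal ((2 ^ CARD('n)) powr r)" by (subst epowr_ennreal) auto
    also have "(2 ^ CARD('n)) powr r = (2 powr r) ^ CARD('n)"
      by (simp add: powr_realpow[symmetric] powr_powr mult.commute)
    finally show ?thesis .
  qed
  have "(powint r w (rect_max F)) \<le>
     (\<integral>\<^sup>+ x. epowr (2 ^ CARD('n)) r * (epowr (iter_HL is F x) r * ennreal (w x)) \<partial>lborel)"
  proof (rule nn_integral_mono)
    fix x
    have "epowr (rect_max F x) r \<le> epowr (2 ^ CARD('n) * iter_HL is F x) r"
      using rect_max_le_iter_HL[of F "is" x] "is" s by (intro epowr_mono) auto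
    also have "\<dots> = epowr (2 ^ CARD('n)) r * epowr (iter_HL is F x) r" using s by (intro epowr_mult) auto
    finally show "epowr (rect_max F x) r * ennreal (w x) \<le> epowr (2 ^ CARD('n)) r * (epowr (iter_HL is F x) r * ennreal (w x))"
      by (simp add: mult.assoc[symmetric] mult_right_mono)
  qed
  also have "\<dots> = ennreal ((2 powr r) ^ CARD('n)) * (powint r w (iter_HL is F))"
    unfolding N by (rule nn_integral_cmult) measurable
  also have "\<dots> \<le> ennreal ((2 powr r) ^ CARD('n)) * (ennreal (?c ^ CARD('n)) * (powint r w F))"
    using iter_HL_strong_type[OF ap assms(2,3) w s W, of "is"] by (intro mult_left_mono) (simp_all add: "is"(2))
  also have "\<dots> = ennreal ((2 powr r * ?c) ^ CARD('n)) * (powint r w F)"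
    unfolding power_mult_distrib[of "2 powr r" ?c] by (rule ennreal_mult_real_assoc) (use c in auto)
  finally show ?thesis .
qed

section \<open>Almost every slice of a rectangular weight is a weight on the line\<close>

text \<open>
  The \<open>A\<^sub>s\<close> condition with the averages cleared of their denominators.
\<close>

definition rect_Ap :: "real \<Rightarrow> (real ^ 'n::finite \<Rightarrow> real) \<Rightarrow> real \<Rightarrow> bool" where
  "rect_Ap s w W \<longleftrightarrow> (\<forall>a b. (\<forall>i. a $ i < b $ i) \<longrightarrow>
     (mass w (box a b)) * epowr (mass (dual s w) (box a b)) (s - 1)
       \<le> ennreal W * epowr (emeasure lborel (box a b)) s)"

lemma nn_integral_box_pos:
  fixes v :: "real ^ 'n::finite \<Rightarrow> real"
  assumes [measurable]: "v \<in> borel_measurable borel" and v: "\<And>x. 0 < v x" and ab: "\<And>i. a $ i < b $ i"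
  shows "0 < (mass v (box a b))"
proof (rule ccontr)
  assume "\<not> ?thesis"
  then have "(mass v (box a b)) = 0" by simp
  then have "AE x in lborel. ennreal (v x) * indicator (box a b) x = 0"
    by (subst (asm) nn_integral_0_iff_AE) auto
  then have "AE x in lborel. x \<notin> box a b"
  proof eventually_elim
    case (elim x)
    then show ?case using v[of x] by (auto simp: indicator_def ennreal_eq_0_iff split: if_splits)
  qed
  then have "box a b \<in> null_sets lborel" by (subst (asm) AE_iff_null_sets[symmetric]) auto
  then have "emeasure lborel (box a b) = 0" by (rule null_setsD1)
  with emeasure_box_pos(1)[OF ab] show False by simp
qed

lemma rect_Ap_finite:
  fixes w :: "real ^ 'n::finite \<Rightarrow> real"
  assumes ap: "rect_Ap s w W" and [measurable]: "w \<in> borel_measurable borel"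
    and w: "\<And>x. 0 < w x" and s: "1 < s" and ab: "\<And>i. a $ i < b $ i"
  shows "(mass w (box a b)) < top" "(mass (dual s w) (box a b)) < top"
proof -
  let ?V = "mass w (box a b)" and ?D = "mass (dual s w) (box a b)"
  have "?V * epowr ?D (s - 1) \<le> ennreal W * epowr (emeasure lborel (box a b)) s"
    using ap ab by (auto simp: rect_Ap_def)
  also have "\<dots> < top" using emeasure_box_pos(2)[OF ab] by (simp add: ennreal_mult_less_top)
  finally have fin: "?V * epowr ?D (s - 1) < top" .
  have "0 < ?V" by (rule nn_integral_box_pos) (use w ab in auto)
  moreover have "0 < ?D" by (rule nn_integral_box_pos) (use w ab in \<open>auto intro!: dual_pos\<close>)
  then have "epowr ?D (s - 1) \<noteq> 0" using s by (subst epowr_eq_0_iff) auto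
  ultimately show "?V < top" "?D < top" using fin by (auto simp: ennreal_mult_less_top)
qed

definition slice_integral :: "real \<Rightarrow> real \<Rightarrow> 'n \<Rightarrow> (real ^ 'n::finite \<Rightarrow> real) \<Rightarrow> real ^ 'n \<Rightarrow> ennreal" where
  "slice_integral p q i v x = (\<integral>\<^sup>+ t\<in>{p<..<q}. ennreal (v (set_coord i t x)) \<partial>lborel)"

lemma slice_integral_measurable [measurable]:
  assumes [measurable]: "v \<in> borel_measurable borel"
  shows "slice_integral p q i v \<in> borel_measurable borel"
  unfolding slice_integral_def[abs_def] by measurable

text \<open>
  A slice integral does not depend on the \<open>i\<close>-th coordinate, so its integral over a box is a multiple of
  an integral over the box with the \<open>i\<close>-th side replaced by \<open>(p, q)\<close>.
\<close>

lemma box_slice_integral: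
  fixes v :: "real ^ 'n::finite \<Rightarrow> real"
  assumes [measurable]: "v \<in> borel_measurable borel" and cd: "c $ i < d $ i"
  shows "(\<integral>\<^sup>+ x\<in>box c d. slice_integral p q i v x \<partial>lborel) =
     ennreal (d $ i - c $ i) * (mass v (box (set_coord i p c) (set_coord i q d)))"
proof -
  have const: "slice_integral p q i v (set_coord i t x) = slice_integral p q i v x" for t x
    by (simp add: slice_integral_def)
  have "(\<integral>\<^sup>+ x\<in>box c d. slice_integral p q i v x \<partial>lborel) =
    (\<integral>\<^sup>+ x\<in>box (set_coord i 0 c) (set_coord i 1 d). (\<integral>\<^sup>+ t\<in>{c $ i<..<d $ i}. slice_integral p q i v x \<partial>lborel) \<partial>lborel)"
    by (subst set_integral_coord[of _ _ _ i]) (auto simp: const)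
  also have "\<dots> = (\<integral>\<^sup>+ x. ennreal (d $ i - c $ i) * (slice_integral p q i v x * indicator (box (set_coord i 0 c) (set_coord i 1 d)) x) \<partial>lborel)"
    using cd by (intro nn_integral_cong) (auto simp: nn_integral_cmult mult_ac)
  also have "\<dots> = ennreal (d $ i - c $ i) * (\<integral>\<^sup>+ x\<in>box (set_coord i 0 c) (set_coord i 1 d). slice_integral p q i v x \<partial>lborel)"
    by (rule nn_integral_cmult) measurable
  also have "(\<integral>\<^sup>+ x\<in>box (set_coord i 0 c) (set_coord i 1 d). slice_integral p q i v x \<partial>lborel) =
     (mass v (box (set_coord i p c) (set_coord i q d)))"
    by (subst (2) set_integral_coord[of _ _ _ i]) (auto simp: slice_integral_def set_coord_nth)
  finally show ?thesis .
qed

lemma nn_integral_cbox_eq_box: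
  fixes g :: "real ^ 'n::finite \<Rightarrow> ennreal"
  shows "(\<integral>\<^sup>+ x\<in>cbox a b. g x \<partial>lborel) = (\<integral>\<^sup>+ x\<in>box a b. g x \<partial>lborel)"
proof (rule nn_integral_cong_AE)
  have "cbox a b - box a b \<in> null_sets lebesgue"
    using negligible_frontier_interval by (simp add: negligible_iff_null_sets)
  then have "AE x in lebesgue. x \<notin> cbox a b - box a b" by (rule AE_not_in)
  then have "AE x in lborel. x \<notin> cbox a b - box a b" by (simp add: AE_completion_iff)
  then show "AE x in lborel. g x * indicator (cbox a b) x = g x * indicator (box a b) x"
    by eventually_elim (use box_subset_cbox in \<open>auto simp: indicator_def\<close>)
qed

lemma ex_lt_corners: "\<exists>a' b' :: real ^ 'n::finite. (\<forall>i. a' $ i < b' $ i) \<and> cbox a b \<subseteq> box a' b'"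
proof (intro exI conjI allI)
  let ?a = "\<chi> i. min (a $ i) (b $ i) - 1" and ?b = "\<chi> i. max (a $ i) (b $ i) + 1"
  show "?a $ i < ?b $ i" for i by (simp add: min_def max_def)
  show "cbox a b \<subseteq> box ?a ?b" by (auto simp: mem_box_cart min_def max_def add_strict_increasing2 intro: le_less_trans less_le_trans)
     (smt (verit))+
qed

text \<open>
  Lebesgue differentiation along the cubes with lower corner \<open>x\<close>, restated for extended nonnegative
  functions that are integrable over boxes.
\<close>

lemma AE_cube_averages:
  fixes g :: "real ^ 'n::finite \<Rightarrow> ennreal"
  assumes [measurable]: "g \<in> borel_measurable borel"
    and fin: "\<And>a b. (\<And>i. a $ i < b $ i) \<Longrightarrow> (\<integral>\<^sup>+ x\<in>box a b. g x \<partial>lborel) < top"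
  shows "AE x in lborel. g x < top \<and>
     (\<lambda>k. enn2real (\<integral>\<^sup>+ y\<in>box x (x + (1 / Suc k) *\<^sub>R One). g y \<partial>lborel) / (1 / Suc k) ^ CARD('n)) \<longlonglongrightarrow> enn2real (g x)"
proof -
  define g' where "g' x = enn2real (g x)" for x
  have [measurable]: "g' \<in> borel_measurable borel" unfolding g'_def[abs_def] by measurable
  have fin': "(\<integral>\<^sup>+ x\<in>cbox a b. g x \<partial>lborel) < top" for a b
  proof -
    obtain a' b' :: "real ^ 'n" where ab: "\<And>i. a' $ i < b' $ i" "cbox a b \<subseteq> box a' b'"
      using ex_lt_corners[of a b] by auto
    have "(\<integral>\<^sup>+ x\<in>cbox a b. g x \<partial>lborel) \<le> (\<integral>\<^sup>+ x\<in>box a' b'. g x \<partial>lborel)"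
      using ab(2) by (intro nn_integral_mono) (auto simp: indicator_def)
    also have "\<dots> < top" using ab by (intro fin) auto
    finally show ?thesis .
  qed
  have AEfin: "AE x in lborel. g x < top"
  proof -
    have "AE x in lborel. g x * indicator (cbox (\<chi> i. - real k) (\<chi> i. real k)) x \<noteq> top" for k :: nat
      using fin'[of "\<chi> i. - real k" "\<chi> i. real k"] nn_integral_PInf_AE[of "\<lambda>x. g x * indicator (cbox (\<chi> i. - real k) (\<chi> i. real k)) x" lborel]
      by (simp add: less_top)
    then have "AE x in lborel. \<forall>k::nat. g x * indicator (cbox (\<chi> i. - real k) (\<chi> i. real k)) x \<noteq> top"
      by (simp add: AE_all_countable)
    then show ?thesis
    proof eventually_elim
      case (elim x)
      obtain k :: nat where k: "norm x \<le> real k" using real_arch_simple by auto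
      have "x \<in> cbox (\<chi> i. - real k) (\<chi> i. real k)"
        using k component_le_norm_cart[of x] by (auto simp: mem_box_cart abs_le_iff) (smt (verit))+
      then show ?case using elim[rule_format, of k] by (simp add: less_top)
    qed
  qed
  have gg': "AE x in lborel. g x = ennreal (g' x)" using AEfin by eventually_elim (simp add: g'_def)
  have int: "(g' has_integral enn2real (\<integral>\<^sup>+ x\<in>cbox a b. g x \<partial>lborel)) (cbox a b)" for a b
  proof -
    have "((\<lambda>x. g' x * indicator (cbox a b) x) has_integral enn2real (\<integral>\<^sup>+ x\<in>cbox a b. g x \<partial>lborel)) UNIV"
    proof (rule nn_integral_has_integral)
      have "(\<integral>\<^sup>+ x. ennreal (g' x * indicator (cbox a b) x) \<partial>lborel) = (\<integral>\<^sup>+ x\<in>cbox a b. g x \<partial>lborel)"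
        by (rule nn_integral_cong_AE) (use gg' in eventually_elim, auto simp: indicator_def)
      then show "(\<integral>\<^sup>+ x. ennreal (g' x * indicator (cbox a b) x) \<partial>lborel) = ennreal (enn2real (\<integral>\<^sup>+ x\<in>cbox a b. g x \<partial>lborel))"
        using fin'[of a b] by simp
    qed (auto simp: g'_def)
    moreover have "(\<lambda>x. g' x * indicator (cbox a b) x) = (\<lambda>x. if x \<in> cbox a b then g' x else 0)"
      by (auto simp: indicator_def)
    ultimately show ?thesis using has_integral_restrict_UNIV[of "cbox a b" g'] by simp
  qed
  then have "g' integrable_on cbox a b" for a b by blast
  then obtain N where N: "negligible N" "\<And>x e. \<lbrakk>x \<notin> N; 0 < e\<rbrakk> \<Longrightarrow>
        \<exists>d>0. \<forall>h. 0 < h \<and> h < d \<longrightarrow> norm (integral (cbox x (x + h *\<^sub>R One)) g' /\<^sub>R h ^ DIM(real ^ 'n) - g' x) < e"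
    using integrable_ccontinuous_explicit by blast
  have "AE x in lebesgue. x \<notin> N" using N(1) by (intro AE_not_in) (simp add: negligible_iff_null_sets)
  then have "AE x in lborel. x \<notin> N" by (simp add: AE_completion_iff)
  then show ?thesis using AEfin
  proof eventually_elim
    case (elim x)
    have "(\<lambda>k. enn2real (\<integral>\<^sup>+ y\<in>box x (x + (1 / Suc k) *\<^sub>R One). g y \<partial>lborel) / (1 / Suc k) ^ CARD('n)) \<longlonglongrightarrow> g' x"
    proof (rule LIMSEQ_I)
      fix e :: real assume "0 < e"
      from N(2)[OF elim(1) this] obtain d where d: "d > 0"
        "\<And>h. 0 < h \<Longrightarrow> h < d \<Longrightarrow> norm (integral (cbox x (x + h *\<^sub>R One)) g' /\<^sub>R h ^ DIM(real ^ 'n) - g' x) < e" by auto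
      obtain k0 :: nat where k0: "1 / Suc k0 < d" using d(1) nat_approx_posE by blast
      show "\<exists>no. \<forall>n\<ge>no. norm (enn2real (\<integral>\<^sup>+ y\<in>box x (x + (1 / Suc n) *\<^sub>R One). g y \<partial>lborel) / (1 / Suc n) ^ CARD('n) - g' x) < e"
      proof (intro exI allI impI)
        fix n assume "n \<ge> k0"
        then have "1 / real (Suc n) \<le> 1 / real (Suc k0)" by (simp add: frac_le)
        then have h: "0 < 1 / real (Suc n)" "1 / real (Suc n) < d" using k0 by auto
        show "norm (enn2real (\<integral>\<^sup>+ y\<in>box x (x + (1 / Suc n) *\<^sub>R One). g y \<partial>lborel) / (1 / Suc n) ^ CARD('n) - g' x) < e"
          using d(2)[OF h] integral_unique[OF int[of x "x + (1 / Suc n) *\<^sub>R One"]]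
          by (simp add: nn_integral_cbox_eq_box divide_inverse mult.commute del: of_nat_Suc)
      qed
    qed
    then show ?case using elim by (simp add: g'_def)
  qed
qed

lemma One_cart_nth: "(One :: real ^ 'n::finite) $ i = 1"
proof -
  have "(One :: real ^ 'n) \<bullet> axis i 1 = (\<Sum>b\<in>(Basis :: (real ^ 'n) set). if b = axis i 1 then 1 else 0)"
    unfolding inner_sum_left by (rule sum.cong) (auto simp: inner_Basis axis_in_Basis_iff)
  also have "\<dots> = 1" by (simp add: axis_in_Basis_iff)
  finally show ?thesis by (simp only: cart_eq_inner_axis)
qed

lemma sum_Basis_nth [simp]: "(\<Sum>b\<in>(Basis :: (real ^ 'n::finite) set). b $ i) = 1"
  using One_cart_nth[where i=i] by simp

text \<open>
  The integrals of \<open>w\<close> and of its dual over the interval \<open>(p, q)\<close> on the line through \<open>x\<close> are functions of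
  \<open>x\<close>. Their averages over a small cube are averages over a thin box with one side \<open>(p, q)\<close>, where the
  rectangular condition applies. Letting the cube shrink to \<open>x\<close> gives the condition on the line for
  one interval, and the rational intervals are countably many.
\<close>

lemma AE_slice_Ap:
  fixes w :: "real ^ 'n::finite \<Rightarrow> real"
  assumes ap: "rect_Ap s w W" and [measurable]: "w \<in> borel_measurable borel"
    and w: "\<And>x. 0 < w x" and s: "1 < s" and W: "0 \<le> W"
  shows "AE x in lborel. ival_Ap s (\<lambda>t. w (set_coord i t x)) W"
proof -
  have dual: "dual s (\<lambda>t. w (set_coord i t x)) t = dual s w (set_coord i t x)" for x t by (simp add: dual_def)
  have "AE x in lborel. slice_integral p q i w x * epowr (slice_integral p q i (dual s w) x) (s - 1) \<le> ennreal (W * (q - p) powr s)"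
    if pq: "p < q" for p q
  proof -
    define h where "h k = 1 / real (Suc k)" for k
    have h: "0 < h k" for k by (simp add: h_def)
    define I where "I v x k = (\<integral>\<^sup>+ y\<in>box x (x + h k *\<^sub>R One). slice_integral p q i v y \<partial>lborel)" for v x k
    have fin: "(\<integral>\<^sup>+ x\<in>box a b. slice_integral p q i v x \<partial>lborel) < top"
      if [measurable]: "v \<in> borel_measurable borel" and ab: "\<And>i. a $ i < b $ i"
        and v: "\<And>a b. (\<And>i. a $ i < b $ i) \<Longrightarrow> (mass v (box a b)) < top" for a b v
      using ab pq by (subst box_slice_integral) (auto simp: ennreal_mult_less_top set_coord_nth intro!: v)
    note A = AE_cube_averages[of "slice_integral p q i w", folded h_def, folded I_def]
    note B = AE_cube_averages[of "slice_integral p q i (dual s w)", folded h_def, folded I_def]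
    have A: "AE x in lborel. slice_integral p q i w x < top \<and>
     (\<lambda>k. enn2real (I w x k) / h k ^ CARD('n)) \<longlonglongrightarrow> enn2real (slice_integral p q i w x)"
      by (rule A) (auto intro!: fin rect_Ap_finite[OF ap _ w s])
    have B: "AE x in lborel. slice_integral p q i (dual s w) x < top \<and>
     (\<lambda>k. enn2real (I (dual s w) x k) / h k ^ CARD('n)) \<longlonglongrightarrow> enn2real (slice_integral p q i (dual s w) x)"
      by (rule B) (auto intro!: fin rect_Ap_finite[OF ap _ w s])
    have bound: "enn2real (I w x k) / h k ^ CARD('n) * (enn2real (I (dual s w) x k) / h k ^ CARD('n)) powr (s - 1) \<le> W * (q - p) powr s" for x k
    proof -
      let ?a = "set_coord i p x" and ?b = "set_coord i q (x + h k *\<^sub>R One)"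
      have ab: "?a $ j < ?b $ j" for j using pq h by (simp add: set_coord_nth One_cart_nth)
      obtain V where V: "(mass w (box ?a ?b)) = ennreal V" "0 \<le> V"
        using rect_Ap_finite(1)[OF ap _ w s ab] by (cases "mass w (box ?a ?b)") auto
      obtain D where D: "(mass (dual s w) (box ?a ?b)) = ennreal D" "0 \<le> D"
        using rect_Ap_finite(2)[OF ap _ w s ab] by (cases "mass (dual s w) (box ?a ?b)") auto
      let ?m = "h k ^ (CARD('n) - 1)"
      have em: "emeasure lborel (box ?a ?b) = ennreal (?m * (q - p))"
        using ab h pq less_imp_le[OF ab]
        by (subst emeasure_box_cart) (auto simp: prod.remove[of UNIV i] set_coord_nth One_cart_nth prod_ennreal ennreal_mult[symmetric] mult.commute ennreal_power card_Diff_singleton)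
      have "ennreal V * epowr (ennreal D) (s - 1) \<le> ennreal W * epowr (ennreal (?m * (q - p))) s"
        using ap[unfolded rect_Ap_def, rule_format, of ?a ?b, OF ab] unfolding V(1) D(1) em .
      then have 1: "V * D powr (s - 1) \<le> W * (?m * (q - p)) powr s"
      proof -
        have "0 \<le> ?m * (q - p)" using h[of k] pq by (intro mult_nonneg_nonneg) auto
        then have "ennreal W * epowr (ennreal (?m * (q - p))) s = ennreal (W * (?m * (q - p)) powr s)"
          using W by (simp only: epowr_ennreal ennreal_mult' powr_ge_zero)
        moreover have "ennreal V * epowr (ennreal D) (s - 1) = ennreal (V * D powr (s - 1))"
          using V(2) D(2) by (simp add: epowr_ennreal ennreal_mult)
        ultimately show ?thesis using \<open>ennreal V * _ \<le> _\<close> W by (simp only: ennreal_le_iff mult_nonneg_nonneg powr_ge_zero)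
      qed
      have card: "h k ^ CARD('n) = h k * ?m" by (simp add: power_eq_if)
      have m: "0 < ?m" using h by simp
      have Iw: "enn2real (I w x k) = h k * V"
        unfolding I_def using h V by (subst box_slice_integral[of _ _ i]) (auto simp: One_cart_nth enn2real_mult less_imp_le)
      have Id: "enn2real (I (dual s w) x k) = h k * D"
        unfolding I_def using h D by (subst box_slice_integral[of _ _ i]) (auto simp: One_cart_nth enn2real_mult less_imp_le)
      have "enn2real (I w x k) / h k ^ CARD('n) * (enn2real (I (dual s w) x k) / h k ^ CARD('n)) powr (s - 1) =
         V / ?m * (D / ?m) powr (s - 1)"
        unfolding Iw Id card using h[of k] by simp
      also have "\<dots> = V * D powr (s - 1) / ?m powr s"
        using D m by (simp add: powr_divide powr_diff)
      also have "\<dots> \<le> W * (?m * (q - p)) powr s / ?m powr s"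
        using 1 by (rule divide_right_mono) simp
      also have "\<dots> = W * (q - p) powr s"
        using m pq h[of k] by (subst powr_mult) auto
      finally show ?thesis .
    qed
    from A B show ?thesis
    proof eventually_elim
      case (elim x)
      have nn: "0 \<le> enn2real (I (dual s w) x k) / h k ^ CARD('n)" for k
        using h[of k] by (intro divide_nonneg_nonneg zero_le_power) auto
      have "(\<lambda>k. enn2real (I w x k) / h k ^ CARD('n) * (enn2real (I (dual s w) x k) / h k ^ CARD('n)) powr (s - 1))
         \<longlonglongrightarrow> enn2real (slice_integral p q i w x) * enn2real (slice_integral p q i (dual s w) x) powr (s - 1)"
        using elim s by (intro tendsto_mult tendsto_powr2) (auto intro!: always_eventually nn)
      then have "enn2real (slice_integral p q i w x) * enn2real (slice_integral p q i (dual s w) x) powr (s - 1) \<le> W * (q - p) powr s"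
        by (rule LIMSEQ_le_const2) (use bound in auto)
      moreover obtain V where "slice_integral p q i w x = ennreal V" "0 \<le> V"
        using elim by (cases "slice_integral p q i w x") auto
      moreover obtain D where "slice_integral p q i (dual s w) x = ennreal D" "0 \<le> D"
        using elim by (cases "slice_integral p q i (dual s w) x") auto
      ultimately show ?case
        by (simp add: epowr_ennreal ennreal_mult[symmetric] ennreal_leI)
    qed
  qed
  then have "AE x in lborel. slice_integral (fst I) (snd I) i w x * epowr (slice_integral (fst I) (snd I) i (dual s w) x) (s - 1) \<le> ennreal (W * (snd I - fst I) powr s)"
    if "I \<in> rat_ivals" for I
    using that by (auto simp: rat_ivals_def)
  then have "AE x in lborel. \<forall>I\<in>rat_ivals. slice_integral (fst I) (snd I) i w x * epowr (slice_integral (fst I) (snd I) i (dual s w) x) (s - 1) \<le> ennreal (W * (snd I - fst I) powr s)"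
    by (simp add: AE_ball_countable[OF countable_rat_ivals])
  then show ?thesis
    unfolding ival_Ap_def slice_integral_def dual by eventually_elim auto
qed

section \<open>Dyadic bisection of a rectangle\<close>

lemma AE_coord_neq: "AE x in lborel. (x :: real ^ 'n::finite) $ i \<noteq> m"
proof -
  have "{x :: real ^ 'n. x $ i = m} \<in> null_sets lebesgue"
    using negligible_standard_hyperplane[of "axis i 1 :: real ^ 'n" m]
    by (simp add: negligible_iff_null_sets axis_in_Basis_iff cart_eq_inner_axis)
  then have "AE x in lebesgue. x \<notin> {x :: real ^ 'n. x $ i = m}" by (rule AE_not_in)
  then show ?thesis by (simp add: AE_completion_iff)
qed

definition mid :: "'n \<Rightarrow> real ^ 'n::finite \<Rightarrow> real ^ 'n \<Rightarrow> real" where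
  "mid i a b = (a $ i + b $ i) / 2"

definition lower_half :: "'n \<Rightarrow> real ^ 'n::finite \<Rightarrow> real ^ 'n \<Rightarrow> real ^ 'n" where
  "lower_half i a b = set_coord i (mid i a b) b"

definition upper_half :: "'n \<Rightarrow> real ^ 'n::finite \<Rightarrow> real ^ 'n \<Rightarrow> real ^ 'n" where
  "upper_half i a b = set_coord i (mid i a b) a"

text \<open>
  Rectangles are halved in one coordinate at a time. This keeps all pieces rectangles, and the mean over a
  half is at most twice the mean over the whole, in every dimension.
\<close>

definition bisection :: "'n \<Rightarrow> real ^ 'n::finite \<Rightarrow> real ^ 'n \<Rightarrow> real ^ 'n \<Rightarrow> real ^ 'n \<Rightarrow> bool" where
  "bisection i a b a' b' \<longleftrightarrow> a' = a \<and> b' = lower_half i a b \<or> a' = upper_half i a b \<and> b' = b"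

lemma bisection_halves: "bisection i a b a (lower_half i a b)" "bisection i a b (upper_half i a b) b"
  by (auto simp: bisection_def)

lemma bisection_less:
  assumes "\<And>j. a $ j < b $ j" "bisection i a b a' b'"
  shows "a' $ j < b' $ j"
  using assms(1)[of i] assms(1)[of j] assms(2) by (auto simp: bisection_def lower_half_def upper_half_def mid_def set_coord_nth)

lemma bisection_subset:
  assumes "\<And>j. a $ j < b $ j" "bisection i a b a' b'"
  shows "box a' b' \<subseteq> box a b"
proof
  fix x assume "x \<in> box a' b'"
  then have x: "a' $ j < x $ j \<and> x $ j < b' $ j" for j by (simp add: mem_box_cart)
  have "a $ j < x $ j \<and> x $ j < b $ j" for j
    using x[of j] assms(1)[of i] assms(2)
    by (cases "j = i") (auto simp: bisection_def lower_half_def upper_half_def mid_def set_coord_nth)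
  then show "x \<in> box a b" by (simp add: mem_box_cart)
qed

lemma bisection_emeasure:
  fixes a b :: "real ^ 'n::finite"
  assumes ab: "\<And>j. a $ j < b $ j" and bi: "bisection i a b a' b'"
  shows "emeasure lborel (box a b) = 2 * emeasure lborel (box a' b')"
proof -
  have "emeasure lborel (box a' b') = ennreal (b' $ i - a' $ i) * (\<Prod>j\<in>UNIV-{i}. ennreal (b' $ j - a' $ j))"
    using bisection_less[OF ab bi] by (subst emeasure_box_cart) (auto simp: less_imp_le prod.remove[of UNIV i])
  also have "(\<Prod>j\<in>UNIV-{i}. ennreal (b' $ j - a' $ j)) = (\<Prod>j\<in>UNIV-{i}. ennreal (b $ j - a $ j))"
    using bi by (intro prod.cong) (auto simp: bisection_def lower_half_def upper_half_def set_coord_nth)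
  finally have "2 * emeasure lborel (box a' b') = (2 * ennreal (b' $ i - a' $ i)) * (\<Prod>j\<in>UNIV-{i}. ennreal (b $ j - a $ j))"
    by (simp add: mult.assoc)
  also have "2 * ennreal (b' $ i - a' $ i) = ennreal (2 * (b' $ i - a' $ i))"
    using bisection_less[OF ab bi, of i] by (subst ennreal_mult) auto
  also have "2 * (b' $ i - a' $ i) = b $ i - a $ i"
    using bi by (auto simp: bisection_def lower_half_def upper_half_def set_coord_nth mid_def field_simps)
  also have "ennreal (b $ i - a $ i) * (\<Prod>j\<in>UNIV-{i}. ennreal (b $ j - a $ j)) = emeasure lborel (box a b)"
    using ab by (subst emeasure_box_cart) (auto simp: less_imp_le prod.remove[of UNIV i])
  finally show ?thesis by simp
qed

lemma nn_integral_bisect: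
  fixes F :: "real ^ 'n::finite \<Rightarrow> ennreal"
  assumes [measurable]: "F \<in> borel_measurable borel" and ab: "\<And>j. a $ j < b $ j"
  shows "(\<integral>\<^sup>+ x\<in>box a b. F x \<partial>lborel) = (\<integral>\<^sup>+ x\<in>box a (lower_half i a b). F x \<partial>lborel) + (\<integral>\<^sup>+ x\<in>box (upper_half i a b) b. F x \<partial>lborel)"
proof -
  have "(\<integral>\<^sup>+ x\<in>box a b. F x \<partial>lborel) =
     (\<integral>\<^sup>+ x. F x * indicator (box a (lower_half i a b)) x + F x * indicator (box (upper_half i a b) b) x \<partial>lborel)"
  proof (rule nn_integral_cong_AE)
    have "AE x in lborel. x $ i \<noteq> mid i a b" by (rule AE_coord_neq)
    then show "AE x in lborel. F x * indicator (box a b) x = F x * indicator (box a (lower_half i a b)) x + F x * indicator (box (upper_half i a b) b) x"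
    proof eventually_elim
      case (elim x)
      have lo: "x \<in> box a (lower_half i a b) \<longleftrightarrow> x \<in> box a b \<and> x $ i < mid i a b"
      proof
        assume x: "x \<in> box a (lower_half i a b)"
        then have "x $ i < lower_half i a b $ i" by (simp add: mem_box_cart)
        then have "x $ i < mid i a b" by (simp add: lower_half_def set_coord_nth)
        then show "x \<in> box a b \<and> x $ i < mid i a b"
          using subsetD[OF bisection_subset[OF ab bisection_halves(1)] x] by blast
      qed (auto simp: mem_box_cart lower_half_def set_coord_nth)
      have hi: "x \<in> box (upper_half i a b) b \<longleftrightarrow> x \<in> box a b \<and> mid i a b < x $ i"
      proof
        assume x: "x \<in> box (upper_half i a b) b"
        then have "upper_half i a b $ i < x $ i" by (simp add: mem_box_cart)
        then have "mid i a b < x $ i" by (simp add: upper_half_def set_coord_nth)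
        then show "x \<in> box a b \<and> mid i a b < x $ i"
          using subsetD[OF bisection_subset[OF ab bisection_halves(2)] x] by blast
      qed (auto simp: mem_box_cart upper_half_def set_coord_nth)
      show ?case using elim by (auto simp: indicator_def lo hi)
    qed
  qed
  also have "\<dots> = (\<integral>\<^sup>+ x\<in>box a (lower_half i a b). F x \<partial>lborel) + (\<integral>\<^sup>+ x\<in>box (upper_half i a b) b. F x \<partial>lborel)"
    by (rule nn_integral_add) measurable
  finally show ?thesis .
qed

definition mean :: "(real ^ 'n::finite \<Rightarrow> real) \<Rightarrow> real ^ 'n \<Rightarrow> real ^ 'n \<Rightarrow> ennreal" where
  "mean v a b = (mass v (box a b)) / emeasure lborel (box a b)"

lemma mean_times:
  assumes "\<And>j. a $ j < b $ j"
  shows "mean v a b * emeasure lborel (box a b) = (mass v (box a b))"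
  using emeasure_box_pos[OF assms] unfolding mean_def
  by (simp add: ennreal_divide_times ennreal_divide_self less_top)

lemma mean_less_top:
  assumes "(mass v (box a b)) < top" and ab: "\<And>j. a $ j < b $ j"
  shows "mean v a b < top"
  using assms(1) emeasure_box_pos(1)[OF ab] unfolding mean_times[OF ab, symmetric]
  by (auto simp: ennreal_mult_less_top)

lemma mean_bisection:
  assumes ab: "\<And>j. a $ j < b $ j" and bi: "bisection i a b a' b'"
  shows "mean v a' b' \<le> 2 * mean v a b"
proof -
  let ?e = "emeasure lborel (box a' b')"
  have e: "0 < ?e" "?e < top" using emeasure_box_pos[OF bisection_less[OF ab bi]] by auto
  have "mean v a' b' * ?e \<le> mean v a b * emeasure lborel (box a b)"
    unfolding mean_times[OF ab] mean_times[OF bisection_less[OF ab bi]]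
    using bisection_subset[OF ab bi] by (intro nn_integral_mono) (auto simp: indicator_def)
  also have "\<dots> = (2 * mean v a b) * ?e" unfolding bisection_emeasure[OF ab bi] by (simp add: mult_ac)
  finally have "mean v a' b' * ?e / ?e \<le> (2 * mean v a b) * ?e / ?e" by (rule divide_right_mono_ennreal)
  then show ?thesis using e by (simp add: ennreal_mult_divide_eq less_top)
qed

text \<open>
  The largest of the means over the cells that contain \<open>x\<close> in the first \<open>N\<close> generations. Generation \<open>k\<close> is
  obtained by halving in the coordinate \<open>c k\<close>; the recursion goes into the half that contains \<open>x\<close> and
  shifts \<open>c\<close>. Finitely many generations keep the function bounded, which the absorption argument in
  the reverse Hoelder inequality needs.
\<close>

fun dyadic_max :: "(real ^ 'n::finite \<Rightarrow> real) \<Rightarrow> nat \<Rightarrow> (nat \<Rightarrow> 'n) \<Rightarrow> real ^ 'n \<Rightarrow> real ^ 'n \<Rightarrow> real ^ 'n \<Rightarrow> ennreal" where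
  "dyadic_max v 0 c a b x = mean v a b"
| "dyadic_max v (Suc N) c a b x = max (mean v a b)
     (if x $ c 0 < mid (c 0) a b then dyadic_max v N (\<lambda>k. c (Suc k)) a (lower_half (c 0) a b) x
      else dyadic_max v N (\<lambda>k. c (Suc k)) (upper_half (c 0) a b) b x)"

lemma dyadic_max_measurable [measurable]: "dyadic_max v N c a b \<in> borel_measurable borel"
proof (induction N arbitrary: c a b)
  case 0
  have "dyadic_max v 0 c a b = (\<lambda>x. mean v a b)" by (rule ext) simp
  then show ?case by simp
next
  case (Suc N)
  note [measurable] = Suc.IH
  have "dyadic_max v (Suc N) c a b = (\<lambda>x. max (mean v a b)
     (if x $ c 0 < mid (c 0) a b then dyadic_max v N (\<lambda>k. c (Suc k)) a (lower_half (c 0) a b) x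
      else dyadic_max v N (\<lambda>k. c (Suc k)) (upper_half (c 0) a b) b x))"
    by (rule ext) (rule dyadic_max.simps(2))
  then show ?case by simp
qed

lemma mean_le_dyadic_max: "mean v a b \<le> dyadic_max v N c a b x"
  by (cases N) auto

lemma dyadic_max_Suc:
  assumes "\<And>j. a $ j < b $ j" "bisection (c 0) a b a' b'" "x \<in> box a' b'"
  shows "dyadic_max v (Suc N) c a b x = max (mean v a b) (dyadic_max v N (\<lambda>k. c (Suc k)) a' b' x)"
proof -
  have x: "a' $ c 0 < x $ c 0 \<and> x $ c 0 < b' $ c 0" using assms(3) by (simp add: mem_box_cart)
  from assms(2) consider "a' = a" "b' = lower_half (c 0) a b" | "a' = upper_half (c 0) a b" "b' = b"
    by (auto simp: bisection_def)
  then show ?thesis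
    using x by cases (simp_all add: lower_half_def upper_half_def set_coord_nth)
qed

lemma dyadic_max_mono: "dyadic_max v N c a b x \<le> dyadic_max v (Suc N) c a b x"
proof (induction N arbitrary: c a b)
  case (Suc N)
  have "dyadic_max v (Suc N) c a b x \<le> max (mean v a b)
     (if x $ c 0 < mid (c 0) a b then dyadic_max v (Suc N) (\<lambda>k. c (Suc k)) a (lower_half (c 0) a b) x
      else dyadic_max v (Suc N) (\<lambda>k. c (Suc k)) (upper_half (c 0) a b) b x)"
    unfolding dyadic_max.simps(2)[of v N c]
    by (rule max.mono) (auto simp del: dyadic_max.simps intro: Suc.IH)
  also have "\<dots> = dyadic_max v (Suc (Suc N)) c a b x" by (rule dyadic_max.simps(2)[symmetric])
  finally show ?case .
qed simp

lemma dyadic_max_bounded: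
  assumes fin: "\<And>a b. (\<And>j. a $ j < b $ j) \<Longrightarrow> (mass v (box a b)) < top"
  shows "(\<And>j. a $ j < b $ j) \<Longrightarrow> \<exists>B<top. \<forall>x. dyadic_max v N c a b x \<le> B"
proof (induction N arbitrary: c a b)
  case 0
  have "mean v a b < top"
    using mean_less_top[OF fin[OF 0] 0] .
  then show ?case by auto
next
  case (Suc N)
  have "mean v a b < top"
    using mean_less_top[OF fin[OF Suc.prems] Suc.prems] .
  moreover obtain B1 where "B1 < top" "\<And>x. dyadic_max v N (\<lambda>k. c (Suc k)) a (lower_half (c 0) a b) x \<le> B1"
    using Suc.IH[OF bisection_less[OF Suc.prems bisection_halves(1)]] by blast
  moreover obtain B2 where "B2 < top" "\<And>x. dyadic_max v N (\<lambda>k. c (Suc k)) (upper_half (c 0) a b) b x \<le> B2"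
    using Suc.IH[OF bisection_less[OF Suc.prems bisection_halves(2)]] by blast
  ultimately show ?case
    by (intro exI[of _ "max (mean v a b) (max B1 B2)"] conjI allI)
       (simp, unfold dyadic_max.simps(2), rule max.mono, auto intro: max.coboundedI1 max.coboundedI2)
qed

lemma mean_le_rect_max:
  assumes "x \<in> box a b" "box a b \<subseteq> R"
  shows "mean v a b \<le> local_max v R x"
proof -
  have "mean v a b = (\<integral>\<^sup>+ y\<in>box a b. ennreal (v y) * indicator R y \<partial>lborel) / emeasure lborel (box a b)"
    unfolding mean_def using assms(2)
    by (intro arg_cong2[where f="(/)"] nn_integral_cong) (auto simp: indicator_def)
  also have "\<dots> \<le> local_max v R x"
    unfolding rect_max_def using assms(1) by (intro SUP_upper2[of "(a, b)"]) auto
  finally show ?thesis .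
qed

lemma nn_integral_dyadic_max_le:
  assumes "\<And>j. a $ j < b $ j" "box a b \<subseteq> R"
  shows "AE x in lborel. x \<in> box a b \<longrightarrow> dyadic_max v N c a b x \<le> local_max v R x"
  using assms
proof (induction N arbitrary: c a b)
  case 0
  then show ?case by (auto intro!: mean_le_rect_max)
next
  case (Suc N)
  note lo = bisection_halves(1)[of "c 0" a b] and hi = bisection_halves(2)[of "c 0" a b]
  have "AE x in lborel. x $ c 0 \<noteq> mid (c 0) a b" by (rule AE_coord_neq)
  moreover have "AE x in lborel. x \<in> box a (lower_half (c 0) a b) \<longrightarrow>
     dyadic_max v N (\<lambda>k. c (Suc k)) a (lower_half (c 0) a b) x \<le> local_max v R x"
    by (rule Suc.IH) (use bisection_less[OF Suc.prems(1) lo] bisection_subset[OF Suc.prems(1) lo] Suc.prems(2) in auto)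
  moreover have "AE x in lborel. x \<in> box (upper_half (c 0) a b) b \<longrightarrow>
     dyadic_max v N (\<lambda>k. c (Suc k)) (upper_half (c 0) a b) b x \<le> local_max v R x"
    by (rule Suc.IH) (use bisection_less[OF Suc.prems(1) hi] bisection_subset[OF Suc.prems(1) hi] Suc.prems(2) in auto)
  ultimately show ?case
  proof eventually_elim
    case (elim x)
    show ?case
    proof
      assume x: "x \<in> box a b"
      show "dyadic_max v (Suc N) c a b x \<le> local_max v R x"
      proof (cases "x $ c 0 < mid (c 0) a b")
        case True
        then have "x \<in> box a (lower_half (c 0) a b)" using x by (auto simp: mem_box_cart lower_half_def set_coord_nth)
        then show ?thesis using True elim(2) mean_le_rect_max[OF x Suc.prems(2)] by simp
      next
        case False
        then have "x \<in> box (upper_half (c 0) a b) b" using x elim(1) by (auto simp: mem_box_cart upper_half_def set_coord_nth)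
        then show ?thesis using False elim(3) mean_le_rect_max[OF x Suc.prems(2)] by simp
      qed
    qed
  qed
qed

text \<open>
  A Calderon-Zygmund stopping argument as an induction on the number of generations. The induction
  descends as long as the mean is at most \<open>l\<close>; when a half first has a larger mean, that mean is at most
  \<open>2 * l\<close>, the whole half belongs to the level set, and \<open>stop\<close> applies to it. The functions \<open>h\<close> may
  depend on the cell: the two uses are the weight itself and the dyadic maximal function.
\<close>

lemma stopping_bound:
  fixes h :: "nat \<Rightarrow> (nat \<Rightarrow> 'n) \<Rightarrow> real ^ 'n \<Rightarrow> real ^ 'n \<Rightarrow> real ^ 'n::finite \<Rightarrow> ennreal"
  assumes meas [measurable]: "\<And>N c a b. h N c a b \<in> borel_measurable borel"
    and stop: "\<And>N c a b. (\<And>j. a $ j < b $ j) \<Longrightarrow> mean v a b \<le> 2 * ennreal l \<Longrightarrow>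
       (\<integral>\<^sup>+ x\<in>box a b. h N c a b x \<partial>lborel) \<le> D * emeasure lborel (box a b)"
    and rec: "\<And>N c a b a' b' x. (\<And>j. a $ j < b $ j) \<Longrightarrow> mean v a b \<le> ennreal l \<Longrightarrow> bisection (c 0) a b a' b' \<Longrightarrow> x \<in> box a' b' \<Longrightarrow>
       ennreal l < dyadic_max v N (\<lambda>k. c (Suc k)) a' b' x \<Longrightarrow> h (Suc N) c a b x = h N (\<lambda>k. c (Suc k)) a' b' x"
  shows "(\<And>j. a $ j < b $ j) \<Longrightarrow> mean v a b \<le> ennreal l \<Longrightarrow>
    (\<integral>\<^sup>+ x\<in>box a b. h N c a b x * indicator {x. ennreal l < dyadic_max v N c a b x} x \<partial>lborel) \<le>
      D * (\<integral>\<^sup>+ x\<in>box a b. indicator {x. ennreal l < dyadic_max v N c a b x} x \<partial>lborel)"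
proof (induction N arbitrary: c a b)
  case 0
  then show ?case by (simp add: not_less[symmetric])
next
  case (Suc N)
  let ?c = "\<lambda>k. c (Suc k)"
  have half: "(\<integral>\<^sup>+ x\<in>box a' b'. h (Suc N) c a b x * indicator {x. ennreal l < dyadic_max v (Suc N) c a b x} x \<partial>lborel) \<le>
      D * (\<integral>\<^sup>+ x\<in>box a' b'. indicator {x. ennreal l < dyadic_max v (Suc N) c a b x} x \<partial>lborel)"
    if bi: "bisection (c 0) a b a' b'" for a' b'
  proof -
    note ab' = bisection_less[OF Suc.prems(1) bi]
    have lev: "ennreal l < dyadic_max v (Suc N) c a b x \<longleftrightarrow> ennreal l < dyadic_max v N ?c a' b' x" if "x \<in> box a' b'" for x
      using dyadic_max_Suc[where c=c, OF Suc.prems(1) bi that, of v N] Suc.prems(2)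
      by (simp add: less_max_iff_disj not_less[symmetric])
    have 1: "(\<integral>\<^sup>+ x\<in>box a' b'. h (Suc N) c a b x * indicator {x. ennreal l < dyadic_max v (Suc N) c a b x} x \<partial>lborel) =
      (\<integral>\<^sup>+ x\<in>box a' b'. h N ?c a' b' x * indicator {x. ennreal l < dyadic_max v N ?c a' b' x} x \<partial>lborel)"
      using lev rec[where c=c, OF Suc.prems bi] by (intro nn_integral_cong) (auto simp: indicator_def simp del: dyadic_max.simps)
    have 2: "(\<integral>\<^sup>+ x\<in>box a' b'. indicator {x. ennreal l < dyadic_max v (Suc N) c a b x} x \<partial>lborel) =
      (\<integral>\<^sup>+ x\<in>box a' b'. indicator {x. ennreal l < dyadic_max v N ?c a' b' x} x \<partial>lborel)"
      using lev by (intro nn_integral_cong) (auto simp: indicator_def simp del: dyadic_max.simps)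
    show ?thesis
    proof (cases "mean v a' b' \<le> ennreal l")
      case True
      show ?thesis unfolding 1 2 by (rule Suc.IH[OF ab' True])
    next
      case False
      then have big: "ennreal l < dyadic_max v N ?c a' b' x" for x
        using mean_le_dyadic_max[of v a' b' N ?c x] by (auto simp: not_le intro: less_le_trans)
      have "mean v a' b' \<le> 2 * ennreal l"
        using mean_bisection[OF Suc.prems(1) bi, of v] Suc.prems(2) by (meson order_trans mult_left_mono zero_le)
      from stop[OF ab' this, of N ?c] show ?thesis unfolding 1 2 using big by simp
    qed
  qed
  have "(\<integral>\<^sup>+ x\<in>box a b. h (Suc N) c a b x * indicator {x. ennreal l < dyadic_max v (Suc N) c a b x} x \<partial>lborel) =
    (\<integral>\<^sup>+ x\<in>box a (lower_half (c 0) a b). h (Suc N) c a b x * indicator {x. ennreal l < dyadic_max v (Suc N) c a b x} x \<partial>lborel) +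
    (\<integral>\<^sup>+ x\<in>box (upper_half (c 0) a b) b. h (Suc N) c a b x * indicator {x. ennreal l < dyadic_max v (Suc N) c a b x} x \<partial>lborel)"
    by (rule nn_integral_bisect) (use Suc.prems in measurable)
  also have "\<dots> \<le> D * (\<integral>\<^sup>+ x\<in>box a (lower_half (c 0) a b). indicator {x. ennreal l < dyadic_max v (Suc N) c a b x} x \<partial>lborel) +
    D * (\<integral>\<^sup>+ x\<in>box (upper_half (c 0) a b) b. indicator {x. ennreal l < dyadic_max v (Suc N) c a b x} x \<partial>lborel)"
    by (intro add_mono half bisection_halves)
  also have "\<dots> = D * (\<integral>\<^sup>+ x\<in>box a b. indicator {x. ennreal l < dyadic_max v (Suc N) c a b x} x \<partial>lborel)"
    unfolding distrib_left[symmetric]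
    by (intro arg_cong2[where f="(*)"] refl nn_integral_bisect[symmetric]) (use Suc.prems in measurable)
  finally show ?case .
qed

text \<open>
  In the layer-cake formula for \<open>d powr e\<close> the levels below \<open>\<mu>\<close> give the first summand. At the levels above
  \<open>\<mu>\<close> the hypothesis replaces \<open>H\<close> by \<open>C * l\<close> on the level set, and the integral in \<open>l\<close> rebuilds
  \<open>d powr (1 + e)\<close> with the small factor \<open>e\<close>.
\<close>

lemma layer_bound:
  fixes d H :: "real ^ 'n::finite \<Rightarrow> ennreal"
  assumes [measurable]: "d \<in> borel_measurable borel" "H \<in> borel_measurable borel" "R \<in> sets borel"
    and \<mu>: "0 < \<mu>" and e: "0 < e" and C: "0 \<le> C"
    and lev: "\<And>l. \<mu> \<le> l \<Longrightarrow> (\<integral>\<^sup>+ x\<in>R. H x * indicator {x. ennreal l < d x} x \<partial>lborel) \<le>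
        ennreal (C * l) * (\<integral>\<^sup>+ x\<in>R. indicator {x. ennreal l < d x} x \<partial>lborel)"
  shows "(\<integral>\<^sup>+ x\<in>R. H x * epowr (d x) e \<partial>lborel) \<le>
     ennreal (\<mu> powr e) * (\<integral>\<^sup>+ x\<in>R. H x \<partial>lborel) + ennreal (C * e) * (\<integral>\<^sup>+ x\<in>R. epowr (d x) (1 + e) \<partial>lborel)"
proof -
  let ?U = "\<lambda>x l. ennreal (C * e) * (ennreal (l powr e) * indicator {l. ennreal l < d x} l * indicator {\<mu>..} l) * indicator R x"
  let ?T = "\<lambda>x l. ennreal (e * l powr (e - 1)) * indicator {l. ennreal l < d x} l * indicator {\<mu>..} l * (H x * indicator R x)"
  have layer: "epowr X e \<le> ennreal (\<mu> powr e) + (\<integral>\<^sup>+ l. ennreal (e * l powr (e - 1)) * indicator {l. ennreal l < X} l * indicator {\<mu>..} l \<partial>lborel)" for X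
  proof -
    have "epowr X e \<le> (\<integral>\<^sup>+ l. ennreal (e * l powr (e - 1)) * indicator {..<\<mu>} l * indicator {0<..} l +
        ennreal (e * l powr (e - 1)) * indicator {l. ennreal l < X} l * indicator {\<mu>..} l \<partial>lborel)"
      unfolding epowr_layer_cake[OF e] by (intro nn_integral_mono) (auto simp: indicator_def)
    also have "\<dots> = (\<integral>\<^sup>+ l. ennreal (e * l powr (e - 1)) * indicator {..<\<mu>} l * indicator {0<..} l \<partial>lborel) +
        (\<integral>\<^sup>+ l. ennreal (e * l powr (e - 1)) * indicator {l. ennreal l < X} l * indicator {\<mu>..} l \<partial>lborel)"
      by (rule nn_integral_add) measurable
    finally show ?thesis using epowr_layer_cake_real[OF e, of \<mu>] \<mu> by simp
  qed
  have "(\<integral>\<^sup>+ x\<in>R. H x * epowr (d x) e \<partial>lborel) \<le> (\<integral>\<^sup>+ x. ennreal (\<mu> powr e) * (H x * indicator R x) +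
      (\<integral>\<^sup>+ l. (?T x l) \<partial>lborel) \<partial>lborel)"
  proof (rule nn_integral_mono)
    fix x
    have "H x * epowr (d x) e * indicator R x = epowr (d x) e * (H x * indicator R x)" by (simp add: mult_ac)
    also have "\<dots> \<le> (ennreal (\<mu> powr e) + (\<integral>\<^sup>+ l. ennreal (e * l powr (e - 1)) * indicator {l. ennreal l < d x} l * indicator {\<mu>..} l \<partial>lborel)) * (H x * indicator R x)"
      by (intro mult_right_mono layer) simp
    also have "\<dots> = ennreal (\<mu> powr e) * (H x * indicator R x) +
      (\<integral>\<^sup>+ l. (?T x l) \<partial>lborel)"
      unfolding distrib_right by (subst nn_integral_multc) auto
    finally show "H x * epowr (d x) e * indicator R x \<le> ennreal (\<mu> powr e) * (H x * indicator R x) +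
      (\<integral>\<^sup>+ l. (?T x l) \<partial>lborel)" .
  qed
  also have "\<dots> = ennreal (\<mu> powr e) * (\<integral>\<^sup>+ x\<in>R. H x \<partial>lborel) +
     (\<integral>\<^sup>+ x. \<integral>\<^sup>+ l. (?T x l) \<partial>lborel \<partial>lborel)"
    by (subst nn_integral_add) (auto simp: nn_integral_cmult)
  also have "(\<integral>\<^sup>+ x. \<integral>\<^sup>+ l. (?T x l) \<partial>lborel \<partial>lborel) =
     (\<integral>\<^sup>+ l. \<integral>\<^sup>+ x. (?T x l) \<partial>lborel \<partial>lborel)"
    by (rule lborel_pair.Fubini') measurable
  also have "\<dots> \<le> (\<integral>\<^sup>+ l. \<integral>\<^sup>+ x. (?U x l) \<partial>lborel \<partial>lborel)"
  proof (rule nn_integral_mono)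
    fix l :: real
    show "(\<integral>\<^sup>+ x. (?T x l) \<partial>lborel) \<le>
       (\<integral>\<^sup>+ x. (?U x l) \<partial>lborel)"
    proof (cases "\<mu> \<le> l")
      case True
      have "(\<integral>\<^sup>+ x. (?T x l) \<partial>lborel) =
         ennreal (e * l powr (e - 1)) * (\<integral>\<^sup>+ x\<in>R. H x * indicator {x. ennreal l < d x} x \<partial>lborel)"
        using True by (subst nn_integral_cmult[symmetric]) (auto simp: indicator_def mult_ac intro!: nn_integral_cong)
      also have "\<dots> \<le> ennreal (e * l powr (e - 1)) * (ennreal (C * l) * (\<integral>\<^sup>+ x\<in>R. indicator {x. ennreal l < d x} x \<partial>lborel))"
        by (intro mult_left_mono lev True) simp
      also have "\<dots> = ennreal (e * l powr (e - 1) * (C * l)) * (\<integral>\<^sup>+ x\<in>R. indicator {x. ennreal l < d x} x \<partial>lborel)"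
        using e C True \<mu> by (intro ennreal_mult_real_assoc) auto
      also have "e * l powr (e - 1) * (C * l) = (C * e) * l powr e"
        using True \<mu> by (simp add: powr_diff)
      also have "ennreal ((C * e) * l powr e) = ennreal (C * e) * ennreal (l powr e)"
        using C e by (intro ennreal_mult) auto
      also have "ennreal (C * e) * ennreal (l powr e) * (\<integral>\<^sup>+ x\<in>R. indicator {x. ennreal l < d x} x \<partial>lborel) =
         (\<integral>\<^sup>+ x. (?U x l) \<partial>lborel)"
        using True by (subst nn_integral_cmult[symmetric]) (auto simp: indicator_def mult_ac intro!: nn_integral_cong)
      finally show ?thesis .
    qed simp
  qed
  also have "\<dots> = (\<integral>\<^sup>+ x. \<integral>\<^sup>+ l. (?U x l) \<partial>lborel \<partial>lborel)"
    by (rule lborel_pair.Fubini'[symmetric]) measurable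
  also have "\<dots> \<le> (\<integral>\<^sup>+ x. ennreal (C * e) * (epowr (d x) (1 + e) * indicator R x) \<partial>lborel)"
  proof (rule nn_integral_mono)
    fix x
    have "(\<integral>\<^sup>+ l. ennreal (l powr e) * indicator {l. ennreal l < d x} l * indicator {\<mu>..} l \<partial>lborel) \<le> epowr (d x) (1 + e)"
    proof -
      have "1 * l powr e \<le> (1 + e) * l powr e" for l :: real using e by (intro mult_right_mono) auto
      then show ?thesis
        using \<mu> e by (subst epowr_layer_cake) (auto intro!: nn_integral_mono mult_mono ennreal_leI simp: indicator_def)
    qed
    then have "ennreal (C * e) * (\<integral>\<^sup>+ l. ennreal (l powr e) * indicator {l. ennreal l < d x} l * indicator {\<mu>..} l \<partial>lborel) * indicator R x \<le>
       ennreal (C * e) * epowr (d x) (1 + e) * indicator R x"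
      by (intro mult_right_mono mult_left_mono) auto
    also have "ennreal (C * e) * (\<integral>\<^sup>+ l. ennreal (l powr e) * indicator {l. ennreal l < d x} l * indicator {\<mu>..} l \<partial>lborel) * indicator R x =
       (\<integral>\<^sup>+ l. (?U x l) \<partial>lborel)"
      by (subst nn_integral_multc, simp, subst nn_integral_cmult, simp, rule refl)
    finally show "(\<integral>\<^sup>+ l. (?U x l) \<partial>lborel) \<le>
       ennreal (C * e) * (epowr (d x) (1 + e) * indicator R x)"
      by (simp only: mult.assoc)
  qed
  also have "\<dots> = ennreal (C * e) * (\<integral>\<^sup>+ x\<in>R. epowr (d x) (1 + e) \<partial>lborel)"
    by (rule nn_integral_cmult) measurable
  finally show ?thesis by (simp add: add_left_mono)
qed

section \<open>The reverse Hoelder inequality\<close>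

fun cell :: "nat \<Rightarrow> (nat \<Rightarrow> 'n) \<Rightarrow> real ^ 'n::finite \<Rightarrow> real ^ 'n \<Rightarrow> real ^ 'n \<Rightarrow> (real ^ 'n) \<times> (real ^ 'n)" where
  "cell 0 c a b x = (a, b)"
| "cell (Suc N) c a b x = (if x $ c 0 < mid (c 0) a b then cell N (\<lambda>k. c (Suc k)) a (lower_half (c 0) a b) x
      else cell N (\<lambda>k. c (Suc k)) (upper_half (c 0) a b) b x)"

definition in_cell_of :: "(real ^ 'n::finite) set \<Rightarrow> nat \<Rightarrow> (nat \<Rightarrow> 'n) \<Rightarrow> real ^ 'n \<Rightarrow> real ^ 'n \<Rightarrow> (real ^ 'n) set" where
  "in_cell_of U N c a b = {x. box (fst (cell N c a b x)) (snd (cell N c a b x)) \<subseteq> U}"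

lemma in_cell_of_Suc:
  assumes "bisection (c 0) a b a' b'" "x \<in> box a' b'"
  shows "x \<in> in_cell_of U (Suc N) c a b \<longleftrightarrow> x \<in> in_cell_of U N (\<lambda>k. c (Suc k)) a' b'"
proof -
  have x: "a' $ c 0 < x $ c 0 \<and> x $ c 0 < b' $ c 0" using assms(2) by (simp add: mem_box_cart)
  from assms(1) consider "a' = a" "b' = lower_half (c 0) a b" | "a' = upper_half (c 0) a b" "b' = b"
    by (auto simp: bisection_def)
  then show ?thesis
    using x by cases (simp_all add: in_cell_of_def lower_half_def upper_half_def set_coord_nth)
qed

lemma in_cell_of_sets [measurable]: "in_cell_of U N c a b \<in> sets borel"
proof (induction N arbitrary: c a b)
  case 0
  have "in_cell_of U 0 c a b = (if box a b \<subseteq> U then UNIV else {})" by (auto simp: in_cell_of_def)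
  then show ?case by simp
next
  case (Suc N)
  note [measurable] = Suc.IH
  have "in_cell_of U (Suc N) c a b =
     ({x. x $ c 0 < mid (c 0) a b} \<inter> in_cell_of U N (\<lambda>k. c (Suc k)) a (lower_half (c 0) a b)) \<union>
     ({x. \<not> x $ c 0 < mid (c 0) a b} \<inter> in_cell_of U N (\<lambda>k. c (Suc k)) (upper_half (c 0) a b) b)"
    by (auto simp: in_cell_of_def)
  also have "\<dots> \<in> sets borel" by (intro sets.Un sets.Int Suc.IH) measurable
  finally show ?case .
qed

lemma cell_Suc_subset:
  assumes "\<And>j. a $ j < b $ j"
  shows "box (fst (cell (Suc N) c a b x)) (snd (cell (Suc N) c a b x)) \<subseteq> box (fst (cell N c a b x)) (snd (cell N c a b x))"
  using assms
proof (induction N arbitrary: c a b)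
  case 0
  then show ?case
    using bisection_subset[OF 0 bisection_halves(1)[of "c 0"]] bisection_subset[OF 0 bisection_halves(2)[of "c 0"]] by simp
next
  case (Suc N)
  note lo = bisection_less[OF Suc.prems bisection_halves(1)[of "c 0"]]
    and hi = bisection_less[OF Suc.prems bisection_halves(2)[of "c 0"]]
  show ?case
  proof (cases "x $ c 0 < mid (c 0) a b")
    case True
    then show ?thesis using Suc.IH[OF lo, of "\<lambda>k. c (Suc k)"] by (subst (1 2 3 4) cell.simps(2)) (simp del: cell.simps)
  next
    case False
    then show ?thesis using Suc.IH[OF hi, of "\<lambda>k. c (Suc k)"] by (subst (1 2 3 4) cell.simps(2)) (simp del: cell.simps)
  qed
qed

lemma in_cell_of_mono:
  assumes "\<And>j. a $ j < b $ j"
  shows "in_cell_of U N c a b \<subseteq> in_cell_of U (Suc N) c a b"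
  using cell_Suc_subset[OF assms] unfolding in_cell_of_def by blast

lemma mem_cell:
  "x \<in> cbox a b \<Longrightarrow> x \<in> cbox (fst (cell N c a b x)) (snd (cell N c a b x))"
proof (induction N arbitrary: c a b)
  case (Suc N)
  show ?case
  proof (cases "x $ c 0 < mid (c 0) a b")
    case True
    then have "x \<in> cbox a (lower_half (c 0) a b)"
      using Suc.prems by (auto simp: mem_box_cart lower_half_def set_coord_nth)
    from Suc.IH[OF this] True show ?thesis by simp
  next
    case False
    then have "x \<in> cbox (upper_half (c 0) a b) b"
      using Suc.prems by (auto simp: mem_box_cart upper_half_def set_coord_nth)
    from Suc.IH[OF this] False show ?thesis by simp
  qed
qed simp

lemma card_shift:
  "card {k. k < Suc N \<and> P k} = (if P 0 then 1 else 0) + card {k. k < N \<and> P (Suc k)}"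
proof -
  have "{k. k < Suc N \<and> P k} = (if P 0 then {0} else {}) \<union> Suc ` {k. k < N \<and> P (Suc k)}"
    by (auto simp: less_Suc_eq_0_disj image_iff split: if_splits)
  also have "card \<dots> = card (if P 0 then {0::nat} else {}) + card (Suc ` {k. k < N \<and> P (Suc k)})"
    by (intro card_Un_disjoint) auto
  finally show ?thesis by (simp add: card_image)
qed

lemma cell_side:
  "snd (cell N c a b x) $ j - fst (cell N c a b x) $ j = (b $ j - a $ j) / 2 ^ card {k. k < N \<and> c k = j}"
proof (induction N arbitrary: c a b)
  case (Suc N)
  show ?case
  proof (cases "x $ c 0 < mid (c 0) a b")
    case True
    then have "snd (cell (Suc N) c a b x) $ j - fst (cell (Suc N) c a b x) $ j =
      (lower_half (c 0) a b $ j - a $ j) / 2 ^ card {k. k < N \<and> c (Suc k) = j}"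
      using Suc.IH[of "\<lambda>k. c (Suc k)" a "lower_half (c 0) a b"] by simp
    then show ?thesis by (auto simp: card_shift lower_half_def set_coord_nth mid_def field_simps)
  next
    case False
    then have "snd (cell (Suc N) c a b x) $ j - fst (cell (Suc N) c a b x) $ j =
      (b $ j - upper_half (c 0) a b $ j) / 2 ^ card {k. k < N \<and> c (Suc k) = j}"
      using Suc.IH[of "\<lambda>k. c (Suc k)" "upper_half (c 0) a b" b] by simp
    then show ?thesis by (auto simp: card_shift upper_half_def set_coord_nth mid_def field_simps)
  qed
qed simp

lemma eventually_small_side:
  fixes d e :: real
  assumes inf: "infinite {k. c k = j}" and e: "0 < e" and d: "0 \<le> d"
  shows "eventually (\<lambda>N. d / 2 ^ card {k. k < N \<and> c k = j} < e) sequentially"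
proof -
  obtain M :: nat where M: "d / e < 2 ^ M" using real_arch_pow[of 2 "d / e"] by auto
  obtain T where T: "T \<subseteq> {k. c k = j}" "finite T" "card T = M"
    using infinite_arbitrarily_large[OF inf] by blast
  have "d / 2 ^ card {k. k < N \<and> c k = j} < e" if N: "Suc (Max (insert 0 T)) \<le> N" for N
  proof -
    have "T \<subseteq> {k. k < N \<and> c k = j}"
    proof
      fix k assume k: "k \<in> T"
      then have "k \<le> Max (insert 0 T)" using T(2) by simp
      then show "k \<in> {k. k < N \<and> c k = j}" using k T(1) N by auto
    qed
    then have "M \<le> card {k. k < N \<and> c k = j}" using T(3) by (auto intro: card_mono)
    then have "(2::real) ^ M \<le> 2 ^ card {k. k < N \<and> c k = j}" by (intro power_increasing) auto
    then have "d / e < 2 ^ card {k. k < N \<and> c k = j}" using M by linarith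
    then show ?thesis using e by (simp add: field_simps)
  qed
  then show ?thesis unfolding eventually_sequentially by blast
qed

text \<open>
  If every coordinate is halved infinitely often, the cells around a point shrink to it.
\<close>

lemma in_cell_of_eventually:
  fixes x :: "real ^ 'n::finite"
  assumes c: "\<And>j. infinite {k. c k = j}" and U: "open U" and x: "x \<in> U" "x \<in> box a b"
  shows "\<exists>N. x \<in> in_cell_of U N c a b"
proof -
  obtain e where e: "0 < e" "ball x e \<subseteq> U" using U x(1) openE by blast
  let ?e = "e / (2 * CARD('n))"
  have ab: "0 \<le> b $ j - a $ j" for j
    using x(2) by (auto simp: mem_box_cart) (smt (verit))
  have "eventually (\<lambda>N. \<forall>j. (b $ j - a $ j) / 2 ^ card {k. k < N \<and> c k = j} < ?e) sequentially"
    by (intro eventually_all_finite eventually_small_side c ab) (use e in auto)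
  then obtain N where N: "\<And>j. (b $ j - a $ j) / 2 ^ card {k. k < N \<and> c k = j} < ?e"
    by (auto simp: eventually_sequentially)
  let ?A = "fst (cell N c a b x)" and ?B = "snd (cell N c a b x)"
  have xc: "x \<in> cbox ?A ?B" using x(2) box_subset_cbox by (intro mem_cell) blast
  have "y \<in> ball x e" if y: "y \<in> box ?A ?B" for y
  proof -
    have "\<bar>(x - y) $ j\<bar> \<le> ?e" for j
    proof -
      have "?A $ j \<le> x $ j \<and> x $ j \<le> ?B $ j" using xc by (simp add: mem_box_cart)
      moreover have "?A $ j < y $ j \<and> y $ j < ?B $ j" using y by (simp add: mem_box_cart)
      ultimately have "\<bar>(x - y) $ j\<bar> \<le> ?B $ j - ?A $ j" by auto
      also have "\<dots> \<le> ?e" unfolding cell_side using N[of j] by simp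
      finally show ?thesis .
    qed
    then have "norm (x - y) \<le> (\<Sum>j\<in>(UNIV::'n set). ?e)"
      by (intro order_trans[OF norm_le_l1_cart] sum_mono)
    also have "\<dots> < e" using e by simp
    finally show ?thesis by (simp add: dist_norm)
  qed
  then show ?thesis using e(2) unfolding in_cell_of_def by blast
qed

text \<open>
  The cells of generation \<open>N\<close> that meet \<open>E\<close> have mean at most \<open>\<alpha>\<close>, and those inside \<open>U\<close> are disjoint
  subsets of \<open>U\<close>.
\<close>

lemma cells_integral_le:
  fixes v :: "real ^ 'n::finite \<Rightarrow> real"
  assumes [measurable]: "v \<in> borel_measurable borel" "E \<in> sets borel" "U \<in> sets borel"
  shows "(\<And>j. a $ j < b $ j) \<Longrightarrow> (\<And>x. x \<in> E \<Longrightarrow> x \<in> box a b \<Longrightarrow> dyadic_max v N c a b x \<le> \<alpha>) \<Longrightarrow>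
    (\<integral>\<^sup>+ x\<in>box a b. ennreal (v x) * indicator E x * indicator (in_cell_of U N c a b) x \<partial>lborel) \<le> \<alpha> * (\<integral>\<^sup>+ x\<in>box a b. indicator U x \<partial>lborel)"
proof (induction N arbitrary: c a b)
  case 0
  show ?case
  proof (cases "box a b \<subseteq> U \<and> E \<inter> box a b \<noteq> {}")
    case True
    then obtain x where "x \<in> E" "x \<in> box a b" by auto
    from 0(2)[OF this] have "mean v a b \<le> \<alpha>" by simp
    have "(\<integral>\<^sup>+ x\<in>box a b. ennreal (v x) * indicator E x * indicator (in_cell_of U 0 c a b) x \<partial>lborel) \<le>
      (mass v (box a b))"
      by (intro nn_integral_mono) (auto simp: indicator_def)
    also have "\<dots> = mean v a b * emeasure lborel (box a b)" by (rule mean_times[symmetric]) (rule 0)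
    also have "\<dots> \<le> \<alpha> * emeasure lborel (box a b)" by (intro mult_right_mono \<open>mean v a b \<le> \<alpha>\<close>) simp
    also have "emeasure lborel (box a b) = (\<integral>\<^sup>+ x. indicator (box a b) x \<partial>lborel)" by simp
    also have "\<dots> = (\<integral>\<^sup>+ x\<in>box a b. indicator U x \<partial>lborel)"
      using True by (intro nn_integral_cong) (auto simp: indicator_def)
    finally show ?thesis .
  next
    case False
    then have "(\<integral>\<^sup>+ x\<in>box a b. ennreal (v x) * indicator E x * indicator (in_cell_of U 0 c a b) x \<partial>lborel) = (\<integral>\<^sup>+ x. 0 \<partial>(lborel::(real ^ 'n) measure))"
      by (intro nn_integral_cong) (auto simp: indicator_def in_cell_of_def)
    then show ?thesis by simp
  qed
next
  case (Suc N)
  have half: "(\<integral>\<^sup>+ x\<in>box a' b'. ennreal (v x) * indicator E x * indicator (in_cell_of U (Suc N) c a b) x \<partial>lborel) \<le> \<alpha> * (\<integral>\<^sup>+ x\<in>box a' b'. indicator U x \<partial>lborel)"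
    if bi: "bisection (c 0) a b a' b'" for a' b'
  proof -
    have "(\<integral>\<^sup>+ x\<in>box a' b'. ennreal (v x) * indicator E x * indicator (in_cell_of U (Suc N) c a b) x \<partial>lborel) =
       (\<integral>\<^sup>+ x\<in>box a' b'. ennreal (v x) * indicator E x * indicator (in_cell_of U N (\<lambda>k. c (Suc k)) a' b') x \<partial>lborel)"
      using in_cell_of_Suc[where c=c, OF bi] by (intro nn_integral_cong) (auto simp: indicator_def)
    also have "\<dots> \<le> \<alpha> * (\<integral>\<^sup>+ x\<in>box a' b'. indicator U x \<partial>lborel)"
    proof (rule Suc.IH[OF bisection_less[OF Suc.prems(1) bi]])
      fix x assume x: "x \<in> E" "x \<in> box a' b'"
      then have "dyadic_max v (Suc N) c a b x \<le> \<alpha>"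
        using bisection_subset[OF Suc.prems(1) bi] by (intro Suc.prems(2)) auto
      then show "dyadic_max v N (\<lambda>k. c (Suc k)) a' b' x \<le> \<alpha>"
        unfolding dyadic_max_Suc[where c=c, OF Suc.prems(1) bi x(2)] by simp
    qed
    finally show ?thesis .
  qed
  have "(\<integral>\<^sup>+ x\<in>box a b. ennreal (v x) * indicator E x * indicator (in_cell_of U (Suc N) c a b) x \<partial>lborel) =
     (\<integral>\<^sup>+ x\<in>box a (lower_half (c 0) a b). ennreal (v x) * indicator E x * indicator (in_cell_of U (Suc N) c a b) x \<partial>lborel) +
     (\<integral>\<^sup>+ x\<in>box (upper_half (c 0) a b) b. ennreal (v x) * indicator E x * indicator (in_cell_of U (Suc N) c a b) x \<partial>lborel)"
    by (rule nn_integral_bisect) (use Suc.prems in measurable)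
  also have "\<dots> \<le> \<alpha> * (\<integral>\<^sup>+ x\<in>box a (lower_half (c 0) a b). indicator U x \<partial>lborel) + \<alpha> * (\<integral>\<^sup>+ x\<in>box (upper_half (c 0) a b) b. indicator U x \<partial>lborel)"
    by (intro add_mono half bisection_halves)
  also have "\<dots> = \<alpha> * (\<integral>\<^sup>+ x\<in>box a b. indicator U x \<partial>lborel)"
    unfolding distrib_left[symmetric]
    by (intro arg_cong2[where f="(*)"] refl nn_integral_bisect[symmetric]) (use Suc.prems in measurable)
  finally show ?case .
qed

text \<open>
  If \<open>v\<close> exceeded \<open>\<beta>\<close> while all dyadic means stay below \<open>\<alpha> < \<beta>\<close> on a set \<open>E\<close> of positive measure, then
  covering \<open>E\<close> by the cells inside a slightly larger open set \<open>U\<close> would give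
  \<open>\<beta> * \<bar>E\<bar> \<le> \<alpha> * \<bar>U\<bar>\<close>, which is impossible when \<open>U\<close> is close to \<open>E\<close>.
\<close>

lemma AE_le_SUP_dyadic_max:
  fixes v :: "real ^ 'n::finite \<Rightarrow> real"
  assumes [measurable]: "v \<in> borel_measurable borel" and c: "\<And>j. infinite {k. c k = j}"
    and ab: "\<And>j. a $ j < b $ j"
  shows "AE x in lborel. x \<in> box a b \<longrightarrow> ennreal (v x) \<le> (SUP N. dyadic_max v N c a b x)"
proof -
  define E where "E \<alpha> \<beta> = {x \<in> box a b. (\<forall>N. dyadic_max v N c a b x \<le> ennreal \<alpha>) \<and> \<beta> < v x}" for \<alpha> \<beta>
  have E [measurable]: "E \<alpha> \<beta> \<in> sets borel" for \<alpha> \<beta>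
  proof -
    have "E \<alpha> \<beta> = {x \<in> space borel. x \<in> box a b \<and> (\<forall>N. dyadic_max v N c a b x \<le> ennreal \<alpha>) \<and> \<beta> < v x}"
      by (auto simp: E_def)
    also have "\<dots> \<in> sets borel" by measurable
    finally show ?thesis .
  qed
  have null: "E \<alpha> \<beta> \<in> null_sets lborel" if \<alpha>: "0 \<le> \<alpha>" "\<alpha> < \<beta>" for \<alpha> \<beta>
  proof -
    have "emeasure lborel (E \<alpha> \<beta>) \<le> emeasure lborel (box a b)" by (intro emeasure_mono) (auto simp: E_def)
    then have "emeasure lborel (E \<alpha> \<beta>) < top" using emeasure_box_pos(2)[OF ab] by (rule le_less_trans)
    then obtain m where m: "emeasure lborel (E \<alpha> \<beta>) = ennreal m" "0 \<le> m" by (cases "emeasure lborel (E \<alpha> \<beta>)") auto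
    have "\<beta> * m \<le> \<alpha> * (m + \<eta>)" if \<eta>: "0 < \<eta>" for \<eta>
    proof -
      obtain U where U: "open U" "E \<alpha> \<beta> \<subseteq> U" "emeasure lborel (U - E \<alpha> \<beta>) \<le> ennreal \<eta>"
        using outer_regular_lborel_le[OF E \<eta>] by blast
      have [measurable]: "U \<in> sets borel" using U(1) by simp
      have "ennreal \<beta> * ennreal m = (\<integral>\<^sup>+ x. ennreal \<beta> * indicator (E \<alpha> \<beta>) x \<partial>lborel)"
        by (simp add: nn_integral_cmult m)
      also have "\<dots> \<le> (\<integral>\<^sup>+ x. (SUP N. ennreal (v x) * indicator (E \<alpha> \<beta>) x * indicator (in_cell_of U N c a b) x * indicator (box a b) x) \<partial>lborel)"
      proof (rule nn_integral_mono)
        fix x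
        show "ennreal \<beta> * indicator (E \<alpha> \<beta>) x \<le> (SUP N. ennreal (v x) * indicator (E \<alpha> \<beta>) x * indicator (in_cell_of U N c a b) x * indicator (box a b) x)"
        proof (cases "x \<in> E \<alpha> \<beta>")
          case True
          then have x: "x \<in> box a b" "x \<in> U" "\<beta> \<le> v x" using U(2) by (auto simp: E_def)
          obtain N where "x \<in> in_cell_of U N c a b" using in_cell_of_eventually[OF c U(1) x(2,1)] by blast
          then show ?thesis using True x by (intro SUP_upper2[of N]) (auto intro: ennreal_leI)
        qed simp
      qed
      also have "\<dots> = (SUP N. \<integral>\<^sup>+ x\<in>box a b. ennreal (v x) * indicator (E \<alpha> \<beta>) x * indicator (in_cell_of U N c a b) x \<partial>lborel)"
      proof (rule nn_integral_monotone_convergence_SUP)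
        have "incseq (\<lambda>N. in_cell_of U N c a b)" by (rule incseq_SucI) (rule in_cell_of_mono[OF ab])
        then show "incseq (\<lambda>N x. ennreal (v x) * indicator (E \<alpha> \<beta>) x * indicator (in_cell_of U N c a b) x * indicator (box a b) x)"
          by (intro incseq_SucI le_funI mult_right_mono mult_left_mono) (auto simp: incseq_Suc_iff indicator_def)
      qed measurable
      also have "\<dots> \<le> ennreal \<alpha> * (\<integral>\<^sup>+ x\<in>box a b. indicator U x \<partial>lborel)"
        by (intro SUP_least cells_integral_le ab) (auto simp: E_def)
      also have "\<dots> \<le> ennreal \<alpha> * (ennreal m + ennreal \<eta>)"
      proof (rule mult_left_mono)
        have "(\<integral>\<^sup>+ x\<in>box a b. indicator U x \<partial>lborel) \<le> (\<integral>\<^sup>+ x. indicator U x \<partial>lborel)"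
          by (intro nn_integral_mono) (auto simp: indicator_def)
        also have "\<dots> = emeasure lborel (E \<alpha> \<beta> \<union> (U - E \<alpha> \<beta>))" using U(2) by (simp add: Un_absorb1)
        also have "\<dots> \<le> emeasure lborel (E \<alpha> \<beta>) + emeasure lborel (U - E \<alpha> \<beta>)" by (intro emeasure_subadditive) auto
        also have "\<dots> \<le> ennreal m + ennreal \<eta>" using U(3) m by (simp add: add_left_mono)
        finally show "(\<integral>\<^sup>+ x\<in>box a b. indicator U x \<partial>lborel) \<le> ennreal m + ennreal \<eta>" .
      qed simp
      finally show ?thesis using \<alpha> m \<eta> by (simp add: ennreal_mult[symmetric] ennreal_plus[symmetric] del: ennreal_plus)
    qed
    note bound = this
    have "m = 0"
    proof (rule ccontr)
      assume "m \<noteq> 0"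
      \<comment> \<open>Any \<open>\<eta>\<close> with \<open>\<alpha> * \<eta> < (\<beta> - \<alpha>) * m\<close> would do; the \<open>+ 1\<close> covers the case \<open>\<alpha> = 0\<close>.\<close>
      define \<eta> where "\<eta> = (\<beta> - \<alpha>) * m / (2 * (\<alpha> + 1))"
      have \<eta>: "0 < \<eta>" using \<alpha> m \<open>m \<noteq> 0\<close> by (simp add: \<eta>_def)
      have "\<alpha> * \<eta> \<le> (\<alpha> + 1) * \<eta>" using \<eta> by (intro mult_right_mono) auto
      also have "\<dots> = (\<beta> - \<alpha>) * m / 2" proof -
        have "\<alpha> + 1 \<noteq> 0" using \<alpha> by simp
        then show ?thesis unfolding \<eta>_def by (simp add: divide_simps)
      qed
      also have "\<dots> < (\<beta> - \<alpha>) * m" using \<alpha> m \<open>m \<noteq> 0\<close> by simp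
      finally show False using bound[OF \<eta>] by (simp add: algebra_simps)
    qed
    then show ?thesis using m by (intro null_setsI) auto
  qed
  have "AE x in lborel. \<forall>I\<in>rat_ivals. 0 \<le> fst I \<longrightarrow> x \<notin> E (fst I) (snd I)"
    unfolding AE_ball_countable[OF countable_rat_ivals]
    using null by (auto simp: rat_ivals_def intro!: AE_not_in)
  then show ?thesis
  proof eventually_elim
    case (elim x)
    show ?case
    proof (intro impI, rule ccontr)
      assume x: "x \<in> box a b" and "\<not> ennreal (v x) \<le> (SUP N. dyadic_max v N c a b x)"
      then have less: "(SUP N. dyadic_max v N c a b x) < ennreal (v x)" by simp
      then obtain s where s: "(SUP N. dyadic_max v N c a b x) = ennreal s" "0 \<le> s"
        by (cases "SUP N. dyadic_max v N c a b x") auto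
      then have "s < v x" using less by (simp add: ennreal_less_iff)
      then obtain \<alpha> where \<alpha>: "\<alpha> \<in> \<rat>" "s < \<alpha>" "\<alpha> < v x" using Rats_dense_in_real by blast
      then obtain \<beta> where \<beta>: "\<beta> \<in> \<rat>" "\<alpha> < \<beta>" "\<beta> < v x" using Rats_dense_in_real by blast
      have "dyadic_max v N c a b x \<le> ennreal \<alpha>" for N
      proof -
        have "dyadic_max v N c a b x \<le> ennreal s" unfolding s(1)[symmetric] by (rule SUP_upper) simp
        also have "\<dots> \<le> ennreal \<alpha>" using \<alpha> by (intro ennreal_leI) simp
        finally show ?thesis .
      qed
      then have "x \<in> E \<alpha> \<beta>" using x \<beta> by (auto simp: E_def)
      moreover have "(\<alpha>, \<beta>) \<in> rat_ivals" using \<alpha> \<beta> by (simp add: rat_ivals_def)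
      ultimately show False using elim s \<alpha> by force
    qed
  qed
qed

lemma ex_fair_sequence: "\<exists>c :: nat \<Rightarrow> 'n::finite. \<forall>j. infinite {k. c k = j}"
proof (intro exI allI)
  fix j :: 'n
  let ?c = "\<lambda>k. from_nat (fst (prod_decode k)) :: 'n"
  have "range (\<lambda>t. prod_encode (to_nat j, t)) \<subseteq> {k. ?c k = j}" by auto
  moreover have "infinite (range (\<lambda>t. prod_encode (to_nat j, t)))"
    by (intro range_inj_infinite) (auto simp: inj_on_def)
  ultimately show "infinite {k. ?c k = j}" using infinite_super by blast
qed

text \<open>
  Let \<open>d\<close> be the dyadic maximal function of \<open>v\<close> with finitely many generations, \<open>\<mu>\<close> the mean of \<open>v\<close> over the
  box, and \<open>S\<close> its integral. The \<open>A\<^sub>\<infinity>\<close> condition bounds the integral of \<open>d\<close> over any cell by \<open>K\<close> times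
  that of \<open>v\<close>. Hence \<open>stopping_bound\<close> and \<open>layer_bound\<close> with \<open>H = d\<close> estimate the integral \<open>X\<close> of
  \<open>d powr (1 + e)\<close> by \<open>\<mu> powr e * K * S + 2 * K * e * X\<close>, and the last term is absorbed. A second
  application with \<open>H = v\<close> gives the integral of \<open>v * d powr e\<close> at most
  \<open>\<mu> powr e * S + 2 * e * X\<close>; the factor \<open>e\<close> in front of \<open>X\<close> cancels the \<open>K\<close>, so the final constant
  is absolute. Since \<open>v\<close> is almost everywhere below the supremum of the functions \<open>d\<close>, the claim follows
  by monotone convergence in the number of generations.
\<close>

lemma reverse_Holder:
  fixes v :: "real ^ 'n::finite \<Rightarrow> real"
  assumes v [measurable]: "v \<in> borel_measurable borel" and pos: "\<And>x. 0 < v x"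
    and fin: "\<And>a b. (\<And>j. a $ j < b $ j) \<Longrightarrow> (mass v (box a b)) < top"
    and K: "0 \<le> K" and Ainf: "\<And>a b. (\<And>j. a $ j < b $ j) \<Longrightarrow>
      (\<integral>\<^sup>+ x\<in>box a b. local_max v (box a b) x \<partial>lborel) \<le> ennreal K * (mass v (box a b))"
    and e: "0 < e" "4 * K * e \<le> 1" and ab: "\<And>j. a $ j < b $ j"
  shows "(\<integral>\<^sup>+ x\<in>box a b. ennreal (v x powr (1 + e)) \<partial>lborel) \<le> 2 * epowr (mean v a b) e * (mass v (box a b))"
proof -
  obtain c :: "nat \<Rightarrow> 'n" where c: "\<And>j. infinite {k. c k = j}" using ex_fair_sequence by blast
  have meanpos: "0 < mean v a b"
  proof -
    have "0 < (mass v (box a b))" by (rule nn_integral_box_pos) (use pos ab in auto)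
    then show ?thesis unfolding mean_times[OF ab, symmetric] by (auto simp: zero_less_iff_neq_zero)
  qed
  obtain \<mu> where \<mu>: "mean v a b = ennreal \<mu>" "0 < \<mu>"
    using meanpos mean_less_top[OF fin[OF ab] ab] by (cases "mean v a b") auto
  obtain S where S: "(mass v (box a b)) = ennreal S" "0 \<le> S"
    using fin[OF ab] by (cases "mass v (box a b)") auto
  have step: "(\<integral>\<^sup>+ x\<in>box a b. ennreal (v x) * epowr (dyadic_max v N c a b x) e \<partial>lborel) \<le> 2 * ennreal (\<mu> powr e) * ennreal S" for N
  proof -
    define d where "d = dyadic_max v N c a b"
    have [measurable]: "d \<in> borel_measurable borel" unfolding d_def by simp
    define X where "X = (\<integral>\<^sup>+ x\<in>box a b. epowr (d x) (1 + e) \<partial>lborel)"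
    have box_mean: "(mass v (box a b)) \<le> ennreal (2 * l) * emeasure lborel (box a b)"
      if "\<And>j. a $ j < b $ j" "mean v a b \<le> 2 * ennreal l" "0 \<le> l" for a b l
    proof -
      have "ennreal (2 * l) = 2 * ennreal l" using that(3) by (simp add: ennreal_mult)
      then show ?thesis unfolding mean_times[OF that(1), symmetric] using that(2) by (simp add: mult_right_mono)
    qed
    have int_dm: "(\<integral>\<^sup>+ x\<in>box a b. dyadic_max v N c a b x \<partial>lborel) \<le> ennreal K * (mass v (box a b))"
      if "\<And>j. a $ j < b $ j" for a b N c
    proof -
      have ae: "AE x in lborel. x \<in> box a b \<longrightarrow> dyadic_max v N c a b x \<le> local_max v (box a b) x"
        by (rule nn_integral_dyadic_max_le) (use that in auto)
      have "(\<integral>\<^sup>+ x\<in>box a b. dyadic_max v N c a b x \<partial>lborel) \<le> (\<integral>\<^sup>+ x\<in>box a b. local_max v (box a b) x \<partial>lborel)"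
        by (rule nn_integral_mono_AE, use ae in eventually_elim) (auto simp: indicator_def)
      then show ?thesis using Ainf[OF that] by (rule order_trans)
    qed
    have "X \<le> ennreal (\<mu> powr e) * (\<integral>\<^sup>+ x\<in>box a b. d x \<partial>lborel) + ennreal (2 * K * e) * X"
    proof -
      have "(\<integral>\<^sup>+ x\<in>box a b. d x * epowr (d x) e \<partial>lborel) \<le> ennreal (\<mu> powr e) * (\<integral>\<^sup>+ x\<in>box a b. d x \<partial>lborel) +
         ennreal (2 * K * e) * (\<integral>\<^sup>+ x\<in>box a b. epowr (d x) (1 + e) \<partial>lborel)"
      proof (rule layer_bound)
        fix l assume l: "\<mu> \<le> l"
        show "(\<integral>\<^sup>+ x\<in>box a b. d x * indicator {x. ennreal l < d x} x \<partial>lborel) \<le> ennreal (2 * K * l) * (\<integral>\<^sup>+ x\<in>box a b. indicator {x. ennreal l < d x} x \<partial>lborel)"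
          unfolding d_def
        proof (rule stopping_bound[where h="dyadic_max v"])
          fix N c and a b :: "real ^ 'n" assume ab: "\<And>j. a $ j < b $ j" and m: "mean v a b \<le> 2 * ennreal l"
          have "(\<integral>\<^sup>+ x\<in>box a b. dyadic_max v N c a b x \<partial>lborel) \<le> ennreal K * (ennreal (2 * l) * emeasure lborel (box a b))"
            by (intro order_trans[OF int_dm[OF ab]] mult_left_mono box_mean m ab) (use l \<mu> in auto)
          also have "\<dots> = ennreal (K * (2 * l)) * emeasure lborel (box a b)"
            using K l \<mu> by (intro ennreal_mult_real_assoc) auto
          finally show "(\<integral>\<^sup>+ x\<in>box a b. dyadic_max v N c a b x \<partial>lborel) \<le> ennreal (2 * K * l) * emeasure lborel (box a b)"
            by (simp add: mult_ac)
        next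
          fix N c and a b a' b' x :: "real ^ 'n"
          assume ab: "\<And>j. a $ j < b $ j" and m: "mean v a b \<le> ennreal l" and bi: "bisection (c 0) a b a' b'" and x: "x \<in> box a' b'"
            and big: "ennreal l < dyadic_max v N (\<lambda>k. c (Suc k)) a' b' x"
          show "dyadic_max v (Suc N) c a b x = dyadic_max v N (\<lambda>k. c (Suc k)) a' b' x"
            unfolding dyadic_max_Suc[where c=c, OF ab bi x] using m big by (intro max_absorb2) (auto intro: order_trans less_imp_le)
        qed (use ab \<mu> l in \<open>auto intro: ennreal_leI\<close>)
      qed (use \<mu> e K in auto)
      moreover have "d x * epowr (d x) e = epowr (d x) (1 + e)" for x
        using e by (subst epowr_add) auto
      ultimately show ?thesis by (simp add: X_def)
    qed
    also have "\<dots> \<le> ennreal (\<mu> powr e) * (ennreal K * ennreal S) + ennreal (2 * K * e) * X"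
      using int_dm[OF ab] by (intro add_right_mono mult_left_mono) (auto simp: d_def S)
    finally have X1: "X \<le> ennreal (\<mu> powr e) * (ennreal K * ennreal S) + ennreal (2 * K * e) * X" .
    \<comment> \<open>The absorption below subtracts a multiple of \<open>X\<close>.\<close>
    have "X < top"
    proof -
      obtain B where B: "B < top" "\<And>x. d x \<le> B" unfolding d_def using dyadic_max_bounded[of v, OF fin ab] by blast
      have "X \<le> (\<integral>\<^sup>+ x. epowr B (1 + e) * indicator (box a b) x \<partial>lborel)"
        unfolding X_def using B(2) e by (intro nn_integral_mono mult_right_mono epowr_mono) auto
      also have "\<dots> < top" using B(1) emeasure_box_pos(2)[OF ab] by (simp add: nn_integral_cmult ennreal_mult_less_top)
      finally show ?thesis .
    qed
    then obtain y where y: "X = ennreal y" "0 \<le> y" by (cases X) auto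
    have y1: "y \<le> \<mu> powr e * (K * S) + 2 * K * e * y"
      using X1 K e S(2) y by (simp add: ennreal_mult[symmetric] ennreal_plus[symmetric] del: ennreal_plus)
    have "2 * K * e * y \<le> 1 / 2 * y" using e y by (intro mult_right_mono) auto
    then have y2: "y \<le> 2 * (\<mu> powr e * (K * S))" using y1 by linarith
    have "(\<integral>\<^sup>+ x\<in>box a b. ennreal (v x) * epowr (d x) e \<partial>lborel) \<le> ennreal (\<mu> powr e) * (mass v (box a b)) + ennreal (2 * e) * X"
      unfolding X_def
    proof (rule layer_bound)
      fix l assume l: "\<mu> \<le> l"
      show "(\<integral>\<^sup>+ x\<in>box a b. ennreal (v x) * indicator {x. ennreal l < d x} x \<partial>lborel) \<le> ennreal (2 * l) * (\<integral>\<^sup>+ x\<in>box a b. indicator {x. ennreal l < d x} x \<partial>lborel)"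
        unfolding d_def
        by (rule stopping_bound[where h="\<lambda>N c a b x. ennreal (v x)"]) (use ab \<mu> l in \<open>auto intro: ennreal_leI intro!: box_mean\<close>)
    qed (use \<mu> e in auto)
    also have "\<dots> = ennreal (\<mu> powr e * S + 2 * e * y)"
      using S y e by (simp add: ennreal_mult[symmetric] ennreal_plus[symmetric] del: ennreal_plus)
    also have "\<dots> \<le> ennreal (2 * (\<mu> powr e * S))"
    proof (rule ennreal_leI)
      have "2 * e * y \<le> 2 * e * (2 * (\<mu> powr e * (K * S)))" using e y2 by (intro mult_left_mono) auto
      also have "\<dots> = (4 * K * e) * (\<mu> powr e * S)" by simp
      also have "\<dots> \<le> 1 * (\<mu> powr e * S)" using e S by (intro mult_right_mono) auto
      finally show "\<mu> powr e * S + 2 * e * y \<le> 2 * (\<mu> powr e * S)" by linarith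
    qed
    also have "\<dots> = 2 * ennreal (\<mu> powr e) * ennreal S" using S by (simp add: ennreal_mult mult.assoc)
    finally show ?thesis by (simp add: d_def)
  qed
  have "(\<integral>\<^sup>+ x\<in>box a b. ennreal (v x powr (1 + e)) \<partial>lborel) \<le>
     (\<integral>\<^sup>+ x. (SUP N. ennreal (v x) * epowr (dyadic_max v N c a b x) e * indicator (box a b) x) \<partial>lborel)"
  proof (rule nn_integral_mono_AE)
    show "AE x in lborel. ennreal (v x powr (1 + e)) * indicator (box a b) x \<le> (SUP N. ennreal (v x) * epowr (dyadic_max v N c a b x) e * indicator (box a b) x)"
      using AE_le_SUP_dyadic_max[OF v c ab]
    proof eventually_elim
      case (elim x)
      show ?case
      proof (cases "x \<in> box a b")
        case True
        have "ennreal (v x powr (1 + e)) = ennreal (v x) * epowr (ennreal (v x)) e"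
          using pos[of x] e by (simp add: epowr_ennreal powr_add ennreal_mult)
        also have "\<dots> \<le> ennreal (v x) * epowr (SUP N. dyadic_max v N c a b x) e"
          using elim True e by (intro mult_left_mono epowr_mono) auto
        also have "\<dots> = (SUP N. ennreal (v x) * epowr (dyadic_max v N c a b x) e)"
          by (simp add: epowr_SUP[OF e(1)] SUP_mult_left_ennreal)
        finally show ?thesis using True by simp
      qed simp
    qed
  qed
  also have "\<dots> = (SUP N. \<integral>\<^sup>+ x\<in>box a b. ennreal (v x) * epowr (dyadic_max v N c a b x) e \<partial>lborel)"
    by (rule nn_integral_monotone_convergence_SUP)
       (use e in \<open>auto intro!: incseq_SucI le_funI mult_right_mono mult_left_mono epowr_mono dyadic_max_mono simp del: dyadic_max.simps\<close>)
  also have "\<dots> \<le> 2 * ennreal (\<mu> powr e) * ennreal S" by (intro SUP_least step)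
  finally show ?thesis using \<mu> by (simp add: S epowr_ennreal)
qed

section \<open>The weak type inequality at an exponent below p\<close>

lemma rect_max_measurable [measurable]:
  "rect_max (F :: real ^ 'n::finite \<Rightarrow> ennreal) \<in> borel_measurable borel"
proof (rule borel_measurableI_greater)
  fix y
  have "{x \<in> space borel. y < rect_max F x} =
     (\<Union>(a, b)\<in>{(a, b). y < (\<integral>\<^sup>+ y\<in>box a b. F y \<partial>lborel) / emeasure lborel (box a b)}. box a b)"
    by (auto simp: rect_max_def less_SUP_iff)
  also have "open \<dots>" by (auto intro!: open_UN open_box)
  finally show "{x \<in> space borel. y < rect_max F x} \<in> sets borel" by (rule borel_open)
qed

text \<open>
  The unweighted case: the constant weight satisfies the condition with \<open>s = 3/2\<close> and \<open>W = 1\<close>, and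
  \<open>576 = 2\<^sup>2 * 6\<^sup>2 * 2 / (2 - 3/2)\<close>.
\<close>

lemma rect_max_strong_type_L2:
  fixes F :: "real ^ 'n::finite \<Rightarrow> ennreal"
  assumes [measurable]: "F \<in> borel_measurable borel"
  shows "(\<integral>\<^sup>+ x. epowr (rect_max F x) 2 \<partial>lborel) \<le> ennreal (576 ^ CARD('n)) * (\<integral>\<^sup>+ x. epowr (F x) 2 \<partial>lborel)"
proof -
  have "slice_Ap (3/2) (\<lambda>_ :: real ^ 'n. 1) 1"
  proof -
    have "ival_Ap (3/2) (\<lambda>t. 1) 1"
      unfolding ival_Ap_def
    proof clarify
      fix a b assume "(a, b) \<in> rat_ivals"
      then have ab: "a < b" by (simp add: rat_ivals_def)
      have "(b - a) * (b - a) powr (1/2) = (b - a) powr (3/2)"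
        using ab powr_add[of "b - a" 1 "1/2"] by simp
      then show "(\<integral>\<^sup>+ t\<in>{a<..<b}. ennreal 1 \<partial>lborel) * epowr (\<integral>\<^sup>+ t\<in>{a<..<b}. ennreal (dual (3/2) (\<lambda>t. 1) t) \<partial>lborel) (3/2 - 1) \<le> ennreal (1 * (b - a) powr (3/2))"
        using ab by (simp add: dual_def epowr_ennreal ennreal_mult[symmetric])
    qed
    then show ?thesis by (simp add: slice_Ap_def)
  qed
  from rect_max_strong_type[OF this _ assms, of 2] show ?thesis by simp
qed

text \<open>
  The convex function \<open>y powr (- \<alpha>)\<close> lies above its tangent at \<open>c\<close>.
\<close>

lemma powr_tangent:
  fixes \<alpha> c y :: real
  assumes "0 < \<alpha>" "0 < c" "0 < y"
  shows "(1 + \<alpha>) * c powr (- \<alpha>) \<le> y powr (- \<alpha>) + \<alpha> * c powr (- \<alpha> - 1) * y"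
proof -
  define z where "z = y / c"
  have z: "0 < z" "y = c * z" using assms by (auto simp: z_def)
  have "(z powr (- \<alpha>)) powr (1 / (1 + \<alpha>)) * z powr (\<alpha> / (1 + \<alpha>)) \<le> 1 / (1 + \<alpha>) * z powr (- \<alpha>) + \<alpha> / (1 + \<alpha>) * z"
    by (rule Youngs_inequality_0) (use assms z in \<open>auto simp: add_divide_distrib[symmetric]\<close>)
  also have "(z powr (- \<alpha>)) powr (1 / (1 + \<alpha>)) * z powr (\<alpha> / (1 + \<alpha>)) = 1"
    using z by (simp add: powr_powr powr_add[symmetric])
  also have "1 / (1 + \<alpha>) * z powr (- \<alpha>) + \<alpha> / (1 + \<alpha>) * z = (z powr (- \<alpha>) + \<alpha> * z) / (1 + \<alpha>)"
    by (simp add: add_divide_distrib)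
  finally have "1 + \<alpha> \<le> z powr (- \<alpha>) + \<alpha> * z" using assms by (simp add: le_divide_eq)
  then have "(1 + \<alpha>) * c powr (- \<alpha>) \<le> (z powr (- \<alpha>) + \<alpha> * z) * c powr (- \<alpha>)"
    by (rule mult_right_mono) simp
  also have "\<dots> = y powr (- \<alpha>) + \<alpha> * c powr (- \<alpha> - 1) * y"
  proof -
    have "c powr (- \<alpha> - 1) * c = c powr (- \<alpha>)" using assms by (simp add: powr_diff)
    moreover have "\<alpha> * c powr (- \<alpha> - 1) * y = \<alpha> * z * (c powr (- \<alpha> - 1) * c)" by (simp add: z(2))
    moreover have "y powr (- \<alpha>) = z powr (- \<alpha>) * c powr (- \<alpha>)" using z assms by (simp add: powr_mult)
    ultimately show ?thesis by (simp only: distrib_right)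
  qed
  finally show ?thesis .
qed

text \<open>
  The \<open>A\<^sub>p\<close> condition bounds the mean of the dual weight by \<open>A powr (1 / (p - 1))\<close> times the power
  \<open>- 1 / (p - 1)\<close> of the mean of \<open>w\<close>. By Jensen's inequality for \<open>y powr (- \<alpha>)\<close> with
  \<open>\<alpha> = 1 / (2 * (p - 1))\<close>, the latter is at most the square of the mean of \<open>w powr (- \<alpha>)\<close>, which is the
  square root of the dual weight.
\<close>

lemma dual_mean_le_sqrt_mean:
  fixes w :: "real ^ 'n::finite \<Rightarrow> real"
  assumes ap: "rect_Ap p w A" and [measurable]: "w \<in> borel_measurable borel" and w: "\<And>x. 0 < w x"
    and p: "1 < p" and A: "0 \<le> A" and ab: "\<And>j. a $ j < b $ j"
  shows "mean (dual p w) a b \<le> ennreal (A powr (1 / (p - 1))) * epowr (mean (\<lambda>x. dual p w x powr (1/2)) a b) 2"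
proof -
  let ?h = "\<lambda>x. dual p w x powr (1/2)"
  have \<sigma>: "0 < dual p w x" for x by (intro dual_pos w)
  define \<alpha> where "\<alpha> = 1 / (2 * (p - 1))"
  have \<alpha>: "0 < \<alpha>" "2 * \<alpha> = 1 / (p - 1)" using p by (auto simp: \<alpha>_def divide_simps)
  have h: "?h x = w x powr (- \<alpha>)" for x by (simp add: dual_def powr_powr \<alpha>_def mult.commute)
  obtain m where m: "emeasure lborel (box a b) = ennreal m" "0 < m"
    using emeasure_box_pos[OF ab] by (cases "emeasure lborel (box a b)") auto
  obtain V where V: "(mass w (box a b)) = ennreal V" "0 < V"
    using rect_Ap_finite(1)[OF ap _ w p ab] nn_integral_box_pos[of w, OF _ w ab]
    by (cases "mass w (box a b)") auto
  obtain T where T: "(mass (dual p w) (box a b)) = ennreal T" "0 < T"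
    using rect_Ap_finite(2)[OF ap _ w p ab] nn_integral_box_pos[of "dual p w", OF _ \<sigma> ab]
    by (cases "mass (dual p w) (box a b)") auto
  \<comment> \<open>The tangent is taken at the mean of \<open>w\<close>.\<close>
  define c where "c = V / m"
  have c: "0 < c" "V = c * m" using V m by (auto simp: c_def)
  have "ennreal V * epowr (ennreal T) (p - 1) \<le> ennreal A * epowr (ennreal m) p"
    using ap[unfolded rect_Ap_def, rule_format, of a b, OF ab] unfolding V(1) T(1) m(1) .
  then have VT: "V * T powr (p - 1) \<le> A * m powr p"
    using V T m A by (simp add: epowr_ennreal ennreal_mult[symmetric])
  show ?thesis
  proof (cases "mass ?h (box a b)")
    case (real H)
    have "ennreal ((1 + \<alpha>) * c powr (- \<alpha>)) * ennreal m = (\<integral>\<^sup>+ x\<in>box a b. ennreal ((1 + \<alpha>) * c powr (- \<alpha>)) \<partial>lborel)"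
      by (simp add: nn_integral_cmult m)
    also have "\<dots> \<le> (\<integral>\<^sup>+ x. ennreal (?h x) * indicator (box a b) x + ennreal (\<alpha> * c powr (- \<alpha> - 1)) * (ennreal (w x) * indicator (box a b) x) \<partial>lborel)"
    proof (rule nn_integral_mono)
      fix x
      have "ennreal ((1 + \<alpha>) * c powr (- \<alpha>)) \<le> ennreal (?h x) + ennreal (\<alpha> * c powr (- \<alpha> - 1)) * ennreal (w x)"
        using powr_tangent[OF \<alpha>(1) c(1) w[of x]] \<alpha>(1) w[of x]
        by (simp add: h ennreal_mult[symmetric] ennreal_plus[symmetric] ennreal_leI less_imp_le del: ennreal_plus)
      then show "ennreal ((1 + \<alpha>) * c powr (- \<alpha>)) * indicator (box a b) x \<le> ennreal (?h x) * indicator (box a b) x + ennreal (\<alpha> * c powr (- \<alpha> - 1)) * (ennreal (w x) * indicator (box a b) x)"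
        by (simp add: indicator_def)
    qed
    also have "\<dots> = ennreal H + ennreal (\<alpha> * c powr (- \<alpha> - 1)) * ennreal V"
      by (subst nn_integral_add) (auto simp: nn_integral_cmult real V)
    finally have "(1 + \<alpha>) * c powr (- \<alpha>) * m \<le> H + \<alpha> * c powr (- \<alpha> - 1) * V"
      using \<alpha> m V real by (simp add: ennreal_mult[symmetric] ennreal_plus[symmetric] del: ennreal_plus)
    moreover have "\<alpha> * c powr (- \<alpha> - 1) * V = \<alpha> * c powr (- \<alpha>) * m"
      using c by (simp add: powr_diff)
    ultimately have Hm: "c powr (- \<alpha>) * m \<le> H" by (simp add: distrib_right)
    then have "c powr (- \<alpha>) \<le> H / m" using m by (simp add: field_simps)
    then have "(c powr (- \<alpha>)) powr 2 \<le> (H / m) powr 2" by (intro powr_mono2) auto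
    then have Hm2: "c powr (- (1 / (p - 1))) \<le> (H / m) powr 2"
      by (simp add: powr_powr \<alpha>(2)[symmetric] mult.commute)
    have "T powr (p - 1) \<le> A * m powr p / V" using VT V by (simp add: field_simps)
    also have "\<dots> = A * (m powr (p - 1) * c powr (- 1))"
      using m c by (simp add: powr_diff powr_minus field_simps)
    finally have "(T powr (p - 1)) powr (1 / (p - 1)) \<le> (A * (m powr (p - 1) * c powr (- 1))) powr (1 / (p - 1))"
      using p by (intro powr_mono2) auto
    also have "(T powr (p - 1)) powr (1 / (p - 1)) = T" using p T by (simp add: powr_powr)
    also have "(A * (m powr (p - 1) * c powr (- 1))) powr (1 / (p - 1)) =
        A powr (1 / (p - 1)) * (m powr ((p - 1) * (1 / (p - 1))) * c powr (- 1 * (1 / (p - 1))))"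
      by (simp only: powr_mult powr_powr)
    also have "\<dots> = A powr (1 / (p - 1)) * (m * c powr (- (1 / (p - 1))))"
      using p m by simp
    also have "\<dots> \<le> A powr (1 / (p - 1)) * (m * (H / m) powr 2)"
      using Hm2 m by (intro mult_left_mono) auto
    finally have "T / m \<le> A powr (1 / (p - 1)) * (H / m) powr 2" using m by (simp add: field_simps)
    then show ?thesis
      using T m real by (simp add: mean_def real divide_ennreal epowr_ennreal ennreal_mult[symmetric] ennreal_leI)
  next
    case top
    have "A \<noteq> 0"
    proof
      assume "A = 0" then have "V * T powr (p - 1) \<le> 0" using VT by simp
      moreover have "0 < V * T powr (p - 1)" using V T by simp
      ultimately show False by simp
    qed
    then have "0 < A powr (1 / (p - 1))" using A by simp
    moreover have "mean ?h a b = top" using m by (simp add: mean_def top ennreal_top_divide)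
    ultimately show ?thesis by (simp add: ennreal_mult_top)
  qed
qed

lemma ennreal_inverse_antimono: "a \<le> b \<Longrightarrow> inverse b \<le> inverse (a :: ennreal)"
proof (cases a; cases b)
  fix x y assume "a \<le> b" "a = ennreal x" "b = ennreal y" "0 \<le> x" "0 \<le> y"
  then show ?thesis by (cases "x = 0") (auto simp: inverse_ennreal ennreal_leI)
qed (auto simp: top_unique)

text \<open>
  By \<open>dual_mean_le_sqrt_mean\<close>, the maximal function of the dual weight is at most \<open>A powr (1 / (p - 1))\<close> times
  the square of the maximal function of its square root, and the latter is bounded on unweighted
  \<open>L\<^sup>2\<close>. The constant is linear in \<open>A powr (1 / (p - 1))\<close>, uniformly in \<open>p\<close>.
\<close>

lemma Ainf_bound_of_Ap:
  fixes w :: "real ^ 'n::finite \<Rightarrow> real"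
  assumes ap: "rect_Ap p w A" and [measurable]: "w \<in> borel_measurable borel" and w: "\<And>x. 0 < w x"
    and p: "1 < p" and A: "0 \<le> A" and ab: "\<And>j. a $ j < b $ j"
  shows "(\<integral>\<^sup>+ x\<in>box a b. local_max (dual p w) (box a b) x \<partial>lborel) \<le>
     ennreal (576 ^ CARD('n) * A powr (1 / (p - 1))) * (mass (dual p w) (box a b))"
proof -
  let ?R = "box a b" and ?h = "\<lambda>x. dual p w x powr (1/2)"
  let ?V = "ennreal (A powr (1 / (p - 1)))"
  let ?G = "\<lambda>y. ennreal (?h y) * indicator ?R y"
  have [measurable]: "?h \<in> borel_measurable borel" by measurable
  have pt: "local_max (dual p w) ?R x \<le> ?V * epowr (rect_max ?G x) 2" if x: "x \<in> ?R" for x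
    unfolding rect_max_def[of "\<lambda>y. ennreal (dual p w y) * indicator ?R y"]
  proof (rule SUP_least, clarify)
    fix c d assume xc: "x \<in> box c d"
    \<comment> \<open>Only the part of the rectangle inside \<open>?R\<close> carries mass, and it is again a rectangle.\<close>
    obtain e f where ef: "box c d \<inter> ?R = box e f" unfolding box_Int_box by blast
    have xe: "x \<in> box e f" using x xc ef by blast
    have lt: "e $ j < f $ j" for j using xe by (auto simp: mem_box_cart intro: less_trans)
    have sub: "box e f \<subseteq> ?R" "box e f \<subseteq> box c d" using ef by auto
    have "(\<integral>\<^sup>+ y\<in>box c d. ennreal (dual p w y) * indicator ?R y \<partial>lborel) = (mass (dual p w) (box e f))"
      unfolding ef[symmetric] by (intro nn_integral_cong) (auto simp: indicator_def)
    then have "(\<integral>\<^sup>+ y\<in>box c d. ennreal (dual p w y) * indicator ?R y \<partial>lborel) / emeasure lborel (box c d) \<le> mean (dual p w) e f"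
      unfolding mean_def divide_ennreal_def using sub(2) by (simp add: mult_left_mono ennreal_inverse_antimono emeasure_mono)
    also have "\<dots> \<le> ?V * epowr (mean ?h e f) 2"
      by (rule dual_mean_le_sqrt_mean[OF ap _ w p A lt]) simp
    also have "\<dots> \<le> ?V * epowr (rect_max ?G x) 2"
      by (intro mult_left_mono epowr_mono mean_le_rect_max xe sub) auto
    finally show "(\<integral>\<^sup>+ y\<in>box c d. ennreal (dual p w y) * indicator ?R y \<partial>lborel) / emeasure lborel (box c d) \<le> ?V * epowr (rect_max ?G x) 2" .
  qed
  have "(\<integral>\<^sup>+ x\<in>?R. local_max (dual p w) ?R x \<partial>lborel) \<le> (\<integral>\<^sup>+ x. ?V * epowr (rect_max ?G x) 2 \<partial>lborel)"
    using pt by (intro nn_integral_mono) (auto simp: indicator_def)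
  also have "\<dots> = ?V * (\<integral>\<^sup>+ x. epowr (rect_max ?G x) 2 \<partial>lborel)"
    by (rule nn_integral_cmult) measurable
  also have "\<dots> \<le> ?V * (ennreal (576 ^ CARD('n)) * (\<integral>\<^sup>+ x. epowr (?G x) 2 \<partial>lborel))"
    by (intro mult_left_mono rect_max_strong_type_L2) auto
  also have "(\<integral>\<^sup>+ x. epowr (?G x) 2 \<partial>lborel) = (mass (dual p w) ?R)"
  proof (rule nn_integral_cong)
    fix x
    have "(?h x) powr 2 = dual p w x" using dual_pos[of w x p, OF w] by (simp add: powr_powr)
    then show "epowr (?G x) 2 = ennreal (dual p w x) * indicator ?R x" by (simp add: indicator_def epowr_ennreal)
  qed
  also have "?V * (ennreal (576 ^ CARD('n)) * (mass (dual p w) ?R)) =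
      ennreal (A powr (1 / (p - 1)) * 576 ^ CARD('n)) * (mass (dual p w) ?R)"
    by (rule ennreal_mult_real_assoc) auto
  finally show ?thesis by (simp add: mult.commute)
qed

text \<open>
  The exponent \<open>s\<close> is chosen such that the dual weight for \<open>s\<close> is the power \<open>1 + e\<close> of the dual weight for
  \<open>p\<close>. The reverse Hoelder inequality then turns the \<open>A\<^sub>p\<close> condition into the \<open>A\<^sub>s\<close> condition.
\<close>

lemma rect_Ap_open:
  fixes w :: "real ^ 'n::finite \<Rightarrow> real"
  assumes ap: "rect_Ap p w A" and [measurable]: "w \<in> borel_measurable borel" and w: "\<And>x. 0 < w x"
    and p: "1 < p" and A: "0 \<le> A"
    and K: "0 \<le> K" and Ainf: "\<And>a b. (\<And>j. a $ j < b $ j) \<Longrightarrow>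
      (\<integral>\<^sup>+ x\<in>box a b. local_max (dual p w) (box a b) x \<partial>lborel) \<le> ennreal K * (mass (dual p w) (box a b))"
    and e: "0 < e" "4 * K * e \<le> 1" and s: "s = 1 + (p - 1) / (1 + e)"
  shows "rect_Ap s w (2 powr p * A)"
  unfolding rect_Ap_def
proof (intro allI impI)
  fix a b :: "real ^ 'n" assume ab: "\<forall>i. a $ i < b $ i"
  then have ab': "\<And>i. a $ i < b $ i" by blast
  have \<sigma>: "0 < dual p w x" for x by (intro dual_pos w)
  have s1: "0 < s - 1" "s - 1 \<le> p - 1" using p e by (auto simp: s field_simps)
  have es: "(1 + e) * (s - 1) = p - 1" using e by (simp add: s)
  have "1 / (s - 1) = (1 / (p - 1)) * (1 + e)" using p e by (simp add: s)
  then have dual: "dual s w x = dual p w x powr (1 + e)" for x by (simp add: dual_def powr_powr)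
  obtain m where m: "emeasure lborel (box a b) = ennreal m" "0 < m"
    using emeasure_box_pos[OF ab'] by (cases "emeasure lborel (box a b)") auto
  obtain V where V: "(mass w (box a b)) = ennreal V" "0 \<le> V"
    using rect_Ap_finite(1)[OF ap _ w p ab'] by (cases "mass w (box a b)") auto
  obtain T where T: "(mass (dual p w) (box a b)) = ennreal T" "0 \<le> T"
    using rect_Ap_finite(2)[OF ap _ w p ab'] by (cases "mass (dual p w) (box a b)") auto
  have "ennreal V * epowr (ennreal T) (p - 1) \<le> ennreal A * epowr (ennreal m) p"
    using ap[unfolded rect_Ap_def, rule_format, of a b, OF ab'] unfolding V(1) T(1) m(1) .
  then have VT: "V * T powr (p - 1) \<le> A * m powr p"
    using V T m A by (simp add: epowr_ennreal ennreal_mult[symmetric])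
  have mean: "mean (dual p w) a b = ennreal (T / m)"
    using T m by (simp add: mean_def divide_ennreal)
  have "(mass (dual s w) (box a b)) \<le> 2 * epowr (mean (dual p w) a b) e * (mass (dual p w) (box a b))"
    unfolding dual by (rule reverse_Holder[where v="dual p w", OF _ \<sigma> _ K Ainf e ab'])
       (auto intro: rect_Ap_finite[OF ap _ w p])
  also have "\<dots> = ennreal (2 * (T / m) powr e * T)"
    using T m by (simp add: mean epowr_ennreal ennreal_mult)
  finally have "(mass w (box a b)) * epowr (mass (dual s w) (box a b)) (s - 1) \<le>
     ennreal V * epowr (ennreal (2 * (T / m) powr e * T)) (s - 1)"
    unfolding V using s1 by (intro mult_left_mono epowr_mono) auto
  also have "epowr (ennreal (2 * (T / m) powr e * T)) (s - 1) = ennreal ((2 * (T / m) powr e * T) powr (s - 1))"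
    using T by (intro epowr_ennreal) auto
  also have "ennreal V * ennreal ((2 * (T / m) powr e * T) powr (s - 1)) = ennreal (V * (2 * (T / m) powr e * T) powr (s - 1))"
    using V by (intro ennreal_mult[symmetric]) auto
  also have "\<dots> \<le> ennreal (2 powr p * A * m powr s)"
  proof (rule ennreal_leI)
    have "(T / m) powr e * T = (T / m) powr (1 + e) * m"
      using T m by (cases "T = 0") (auto simp: powr_add)
    then have "(2 * (T / m) powr e * T) powr (s - 1) = (2 * ((T / m) powr (1 + e) * m)) powr (s - 1)"
      by (simp add: mult.assoc)
    also have "\<dots> = 2 powr (s - 1) * ((T / m) powr (p - 1) * m powr (s - 1))"
      using m by (simp add: powr_mult powr_powr es)
    also have "\<dots> \<le> 2 powr p * ((T / m) powr (p - 1) * m powr (s - 1))"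
      using s1 by (intro mult_right_mono powr_mono) auto
    also have "(T / m) powr (p - 1) * m powr (s - 1) = T powr (p - 1) * m powr (s - p)"
      using T m by (simp add: powr_divide powr_diff)
    finally have "V * (2 * (T / m) powr e * T) powr (s - 1) \<le> V * (2 powr p * (T powr (p - 1) * m powr (s - p)))"
      using V by (intro mult_left_mono) auto
    also have "\<dots> = 2 powr p * (V * T powr (p - 1)) * m powr (s - p)" by simp
    also have "\<dots> \<le> 2 powr p * (A * m powr p) * m powr (s - p)"
      using VT by (intro mult_right_mono mult_left_mono) auto
    also have "\<dots> = 2 powr p * A * m powr s" using m by (simp add: powr_diff)
    finally show "V * (2 * (T / m) powr e * T) powr (s - 1) \<le> 2 powr p * A * m powr s" .
  qed
  also have "\<dots> = ennreal (2 powr p * A) * epowr (emeasure lborel (box a b)) s"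
    using m A by (simp add: epowr_ennreal ennreal_mult)
  finally show "(mass w (box a b)) * epowr (mass (dual s w) (box a b)) (s - 1) \<le>
     ennreal (2 powr p * A) * epowr (emeasure lborel (box a b)) s" .
qed

lemma slice_Ap_of_rect_Ap:
  fixes w :: "real ^ 'n::finite \<Rightarrow> real"
  assumes "rect_Ap s w W" "w \<in> borel_measurable borel" "\<And>x. 0 < w x" "1 < s" "0 \<le> W"
  shows "slice_Ap s w W"
  using AE_slice_Ap[OF assms] by (auto simp: slice_Ap_def)

text \<open>
  The condition improves to an exponent \<open>s\<close> with \<open>p - s = (p - 1) / (4 * K + 1)\<close>, the largest gain that
  \<open>rect_Ap_open\<close> allows, and \<open>r\<close> is taken halfway between \<open>s\<close> and \<open>p\<close>: the distance from \<open>r\<close> to \<open>s\<close>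
  governs the coordinate maximal functions on \<open>L\<^sup>r(w)\<close>, the distance to \<open>p\<close> the later interpolation.
\<close>

lemma rect_max_weak_type_below_p:
  fixes w :: "real ^ 'n::finite \<Rightarrow> real"
  assumes ap: "rect_Ap p w A" and [measurable]: "w \<in> borel_measurable borel" and w: "\<And>x. 0 < w x"
    and p: "1 < p" and A: "0 \<le> A"
    and K: "1 \<le> K" "K \<le> 576 ^ CARD('n) * A powr (1 / (p - 1))"
    and Ainf: "\<And>a b. (\<And>j. a $ j < b $ j) \<Longrightarrow>
      (\<integral>\<^sup>+ x\<in>box a b. local_max (dual p w) (box a b) x \<partial>lborel) \<le> ennreal K * (mass (dual p w) (box a b))"
  obtains r where "1 < r" "r < p" "(p - 1) / (10 * K) \<le> p - r"
    "\<And>F l. F \<in> borel_measurable borel \<Longrightarrow> 0 < l \<Longrightarrow>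
      (mass w {x. ennreal l < rect_max F x}) \<le>
      ennreal ((3 * 2 ^ CARD('n)) powr p * (2 powr p * A) *
         (12 powr p * A * (10 * (p / (p - 1)) * (576 ^ CARD('n) * A powr (1 / (p - 1))))) ^ (CARD('n) - 1) / l powr r)
      * (powint r w F)"
proof -
  define e where "e = 1 / (4 * K)"
  have e: "0 < e" "4 * K * e \<le> 1" using K by (auto simp: e_def)
  define s where "s = 1 + (p - 1) / (1 + e)"
  define r where "r = (p + s) / 2"
  have s: "1 < s" using p e by (simp add: s_def)
  have ps: "p - s = (p - 1) / (4 * K + 1)"
  proof -
    have "p - s = (p - 1) * (1 - 1 / (1 + e))" by (simp add: s_def algebra_simps)
    also have "1 - 1 / (1 + e) = 1 / (4 * K + 1)" using K by (simp add: e_def field_simps)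
    finally show ?thesis by simp
  qed
  have gap: "(p - 1) / (5 * K) \<le> p - s"
    unfolding ps using K p by (intro divide_left_mono) auto
  have gap0: "0 < (p - 1) / (5 * K)" using p K by simp
  have rs: "s < r" "r < p" using gap gap0 by (auto simp: r_def)
  have gap_r: "(p - 1) / (10 * K) \<le> p - r" "(p - 1) / (10 * K) \<le> r - s"
  proof -
    have "(p - 1) / (10 * K) = (p - 1) / (5 * K) / 2" by simp
    also have "\<dots> \<le> (p - s) / 2" by (rule divide_right_mono[OF gap]) simp
    finally have half: "(p - 1) / (10 * K) \<le> (p - s) / 2" .
    have "(p - s) / 2 = p - r" "(p - s) / 2 = r - s" by (auto simp: r_def field_simps)
    then show "(p - 1) / (10 * K) \<le> p - r" "(p - 1) / (10 * K) \<le> r - s"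
      using half by (simp_all only:)
  qed
  \<comment> \<open>The improvement that leads to \<open>r\<close> instead of \<open>s\<close>; it is smaller than \<open>e\<close>, hence also admissible.\<close>
  define e' where "e' = (p - 1) / (r - 1) - 1"
  have e': "0 < e'" using rs s p by (simp add: e'_def)
  have "e' \<le> e"
  proof -
    have "1 + e = (p - 1) / (s - 1)" using e p by (simp add: s_def)
    moreover have "(p - 1) / (r - 1) \<le> (p - 1) / (s - 1)" using rs s p by (intro divide_left_mono) auto
    ultimately show ?thesis by (simp add: e'_def)
  qed
  then have e'2: "4 * K * e' \<le> 1" using e K mult_left_mono[of e' e "4 * K"] by linarith
  have r_eq: "r = 1 + (p - 1) / (1 + e')" using p by (simp add: e'_def)
  define W where "W = 2 powr p * A"
  have W: "0 \<le> W" using A by (simp add: W_def)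
  have K0: "0 \<le> K" using K by simp
  have sl_s: "slice_Ap s w W"
    by (rule slice_Ap_of_rect_Ap[OF _ _ w s W])
       (unfold W_def, rule rect_Ap_open[OF ap _ w p A K0 Ainf e s_def], auto)
  have sl_r: "slice_Ap r w W"
    by (rule slice_Ap_of_rect_Ap[OF _ _ w _ W])
       (unfold W_def, rule rect_Ap_open[OF ap _ w p A K0 Ainf e' e'2 r_eq], use s rs in auto)
  let ?q = "576 ^ CARD('n) * A powr (1 / (p - 1))"
  have weak: "(mass w {x. ennreal l < rect_max F x}) \<le>
      ennreal ((3 * 2 ^ CARD('n)) powr p * (2 powr p * A) * (12 powr p * A * (10 * (p / (p - 1)) * ?q)) ^ (CARD('n) - 1) / l powr r)
      * (powint r w F)"
    if [measurable]: "F \<in> borel_measurable borel" and l: "0 < l" for F l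
  proof -
  have "(mass w {x. ennreal l < rect_max F x}) \<le>
    ennreal ((3 * 2 ^ CARD('n)) powr r * W * (6 powr r * W * (r / (r - s))) ^ (CARD('n) - 1) / l powr r)
      * (powint r w F)"
    by (rule rect_max_weak_type[OF sl_s sl_r _ _ w s rs(1) W W l]) auto
  also have "\<dots> \<le> ennreal ((3 * 2 ^ CARD('n)) powr p * W * (12 powr p * A * (10 * (p / (p - 1)) * ?q)) ^ (CARD('n) - 1) / l powr r)
      * (powint r w F)"
  proof -
    define c1 where "c1 = 6 powr r * W * (r / (r - s))"
    define c2 where "c2 = 12 powr p * A * (10 * (p / (p - 1)) * ?q)"
    have N: "(3 * 2 ^ CARD('n)) powr r \<le> (3 * 2 ^ CARD('n)) powr p"
    proof (rule powr_mono)
      have "(1::real) \<le> 2 ^ CARD('n)" by simp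
      then show "(1::real) \<le> 3 * 2 ^ CARD('n)" by linarith
    qed (use rs in auto)
    have "6 powr r * W \<le> 6 powr p * W" using rs W by (intro mult_right_mono powr_mono) auto
    also have "\<dots> = 12 powr p * A" using powr_mult[of 6 2 p] by (simp add: W_def)
    finally have 1: "6 powr r * W \<le> 12 powr p * A" .
    have "r / (r - s) \<le> p / ((p - 1) / (10 * K))"
      using gap_r rs s p K by (intro frac_le) auto
    also have "\<dots> = 10 * (p / (p - 1)) * K" using p K by simp
    also have "\<dots> \<le> 10 * (p / (p - 1)) * ?q" using K p by (intro mult_left_mono) auto
    finally have 2: "r / (r - s) \<le> 10 * (p / (p - 1)) * ?q" .
    have c12: "c1 \<le> c2"
      unfolding c1_def c2_def by (rule mult_mono[OF 1 2]) (use A rs s in auto)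
    have c1: "0 \<le> c1" unfolding c1_def using W rs s by auto
    show ?thesis
      unfolding c1_def[symmetric] c2_def[symmetric]
      by (intro mult_right_mono ennreal_leI divide_right_mono mult_mono power_mono N c12 c1) (use W c1 in auto)
  qed
  finally show ?thesis unfolding W_def .
  qed
  show thesis
    by (rule that[of r]) (use s rs gap_r weak in auto)
qed

section \<open>Interpolation of Lorentz norms\<close>

lemma powr_add_le:
  fixes x y \<theta> :: real
  assumes "0 \<le> x" "0 \<le> y" "0 < \<theta>" "\<theta> \<le> 1"
  shows "(x + y) powr \<theta> \<le> x powr \<theta> + y powr \<theta>"
proof (cases "x = 0 \<or> y = 0")
  case False
  then have xy: "0 < x" "0 < y" using assms by auto
  have "(x + y) powr \<theta> = (x + y) * (x + y) powr (\<theta> - 1)"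
    using xy by (simp add: powr_diff)
  also have "\<dots> = x * (x + y) powr (\<theta> - 1) + y * (x + y) powr (\<theta> - 1)"
    by (rule distrib_right)
  also have "\<dots> \<le> x * x powr (\<theta> - 1) + y * y powr (\<theta> - 1)"
    using xy assms by (intro add_mono mult_left_mono powr_mono2') auto
  also have "\<dots> = x powr \<theta> + y powr \<theta>" using xy by (simp add: powr_diff)
  finally show ?thesis .
qed (use assms in auto)

lemma epowr_add_le:
  assumes "0 < \<theta>" "\<theta> \<le> 1"
  shows "epowr (x + y) \<theta> \<le> epowr x \<theta> + epowr y \<theta>"
proof (cases x; cases y)
  fix a b assume "x = ennreal a" "0 \<le> a" "y = ennreal b" "0 \<le> b"
  then show ?thesis using powr_add_le[of a b \<theta>] assms
    by (simp add: epowr_ennreal ennreal_plus[symmetric] ennreal_leI del: ennreal_plus)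
qed auto

lemma epowr_suminf_le:
  assumes "0 < \<theta>" "\<theta> \<le> 1"
  shows "epowr (\<Sum>k. a k) \<theta> \<le> (\<Sum>k. epowr (a k) \<theta>)"
proof -
  have fin: "epowr (\<Sum>k<n. a k) \<theta> \<le> (\<Sum>k<n. epowr (a k) \<theta>)" for n
  proof (induction n)
    case (Suc n)
    then show ?case using epowr_add_le[OF assms, of "\<Sum>k<n. a k" "a n"] by (auto intro: order_trans add_right_mono)
  qed simp
  have "epowr (\<Sum>k. a k) \<theta> = (SUP n. epowr (\<Sum>k<n. a k) \<theta>)"
    by (simp add: suminf_eq_SUP epowr_SUP[OF assms(1)])
  also have "\<dots> \<le> (\<Sum>k. epowr (a k) \<theta>)"
    by (intro SUP_least order_trans[OF fin] sum_le_suminf) auto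
  finally show ?thesis .
qed

text \<open>
  \<open>average_powr_le\<close> for the counting measure and the weight \<open>\<rho> k powr (1 - \<theta>)\<close>, whose dual is \<open>\<rho>\<close>.
\<close>

lemma epowr_suminf_weighted_le:
  assumes "1 < \<theta>" and \<rho>: "\<And>k. 0 < \<rho> k" and S: "(\<Sum>k. ennreal (\<rho> k)) < top"
  shows "epowr (\<Sum>k. a k) \<theta> \<le> (\<Sum>k. epowr (a k) \<theta> * ennreal (\<rho> k powr (1 - \<theta>))) * epowr (\<Sum>k. ennreal (\<rho> k)) (\<theta> - 1)"
proof -
  have "dual \<theta> (\<lambda>k. \<rho> k powr (1 - \<theta>)) k = \<rho> k" for k
  proof -
    have "(1 - \<theta>) * - (1 / (\<theta> - 1)) = 1" using assms(1) by (simp add: field_simps)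
    then show ?thesis unfolding dual_def powr_powr using \<rho>[of k] by simp
  qed
  moreover have "\<rho> k \<noteq> 0" for k using \<rho>[of k] by simp
  ultimately show ?thesis
    using average_powr_le[of a "count_space UNIV" "\<lambda>k. \<rho> k powr (1 - \<theta>)" \<theta>] assms
    by (simp add: nn_integral_count_space_nat)
qed

lemma geometric_sum_le:
  assumes x: "0 < x"
  shows "(\<Sum>k. ennreal (2 powr - (real k * x))) \<le> ennreal (1 + 2 / x)"
proof -
  define z where "z = (2::real) powr - x"
  have z: "0 < z" "z < 1" using x by (auto simp: z_def powr_minus_divide)
  have eq: "2 powr - (real k * x) = z ^ k" for k
    by (simp add: z_def powr_realpow[symmetric] powr_powr mult.commute)
  have "(\<Sum>k. ennreal (2 powr - (real k * x))) = ennreal (\<Sum>k. z ^ k)"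
    unfolding eq using z by (intro suminf_ennreal2) auto
  also have "(\<Sum>k. z ^ k) = 1 / (1 - z)" using z by (intro suminf_geometric) auto
  finally have sum: "(\<Sum>k. ennreal (2 powr - (real k * x))) = ennreal (1 / (1 - z))" .
  have "1 / (1 - z) \<le> 1 + 2 / x"
  proof -
    \<comment> \<open>It remains to show \<open>2 powr x \<ge> 1 + x / 2\<close>.\<close>
    have "1 + x / 2 \<le> 1 + x * ln 2" using x ln2_ge_two_thirds by (simp add: mult_left_mono)
    also have "\<dots> \<le> exp (x * ln 2)" by (rule exp_ge_add_one_self)
    also have "\<dots> = 1 / z" by (simp add: z_def powr_def exp_minus field_simps)
    finally have "z * (1 + x / 2) \<le> 1" using z by (simp add: field_simps)
    then have "1 \<le> (1 + 2 / x) * (1 - z)" using x by (simp add: field_simps)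
    then show ?thesis using z by (simp add: field_simps)
  qed
  then show ?thesis unfolding sum by (rule ennreal_leI)
qed

abbreviation lorentz_int :: "real \<Rightarrow> real \<Rightarrow> (real \<Rightarrow> ennreal) \<Rightarrow> ennreal" where
  "lorentz_int q \<theta> D \<equiv> (\<integral>\<^sup>+ s\<in>{0<..}. ennreal (s powr q) * epowr (D s) \<theta> / ennreal s \<partial>lborel)"

lemma scale_invariant_integral:
  fixes D :: "real \<Rightarrow> ennreal"
  assumes [measurable]: "D \<in> borel_measurable borel" and L: "0 < L"
  shows "(lorentz_int q \<theta> (\<lambda>s. D (L * s))) =
    ennreal (L powr - q) * (lorentz_int q \<theta> D)"
proof -
  let ?g = "\<lambda>s. ennreal (s powr q) * epowr (D s) \<theta> / ennreal s * indicator {0<..} s"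
  have "(\<integral>\<^sup>+ s. ?g s \<partial>lborel) = ennreal L * (\<integral>\<^sup>+ s. ?g (0 + L * s) \<partial>lborel)"
    using L by (subst nn_integral_real_affine[of ?g L 0]) auto
  also have "(\<integral>\<^sup>+ s. ?g (0 + L * s) \<partial>lborel) = (\<integral>\<^sup>+ s. ennreal (L powr (q - 1)) * (ennreal (s powr q) * epowr (D (L * s)) \<theta> / ennreal s * indicator {0<..} s) \<partial>lborel)"
  proof (rule nn_integral_cong)
    fix s :: real
    show "?g (0 + L * s) = ennreal (L powr (q - 1)) * (ennreal (s powr q) * epowr (D (L * s)) \<theta> / ennreal s * indicator {0<..} s)"
    proof (cases "0 < s")
      case True
      have "ennreal ((L * s) powr q) / ennreal (L * s) = ennreal (L powr (q - 1)) * (ennreal (s powr q) / ennreal s)"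
        using True L by (simp add: divide_ennreal powr_mult powr_diff ennreal_mult[symmetric])
      moreover have "?g (0 + L * s) = ennreal ((L * s) powr q) / ennreal (L * s) * epowr (D (L * s)) \<theta>"
        using True L by (simp add: divide_ennreal_def mult_ac)
      moreover have "ennreal (s powr q) * epowr (D (L * s)) \<theta> / ennreal s * indicator {0<..} s = ennreal (s powr q) / ennreal s * epowr (D (L * s)) \<theta>"
        using True by (simp add: divide_ennreal_def mult_ac)
      ultimately show ?thesis by (simp only: mult.assoc)
    qed (use L in \<open>simp add: zero_less_mult_iff\<close>)
  qed
  also have "\<dots> = ennreal (L powr (q - 1)) * (lorentz_int q \<theta> (\<lambda>s. D (L * s)))"
    by (rule nn_integral_cmult) measurable
  also have "ennreal L * (ennreal (L powr (q - 1)) * (lorentz_int q \<theta> (\<lambda>s. D (L * s)))) =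
     ennreal (L * L powr (q - 1)) * (lorentz_int q \<theta> (\<lambda>s. D (L * s)))"
    using L by (intro ennreal_mult_real_assoc) auto
  also have "L * L powr (q - 1) = L powr q" using L by (simp add: powr_diff)
  finally have "ennreal (L powr - q) * (lorentz_int q \<theta> D) =
     ennreal (L powr - q * L powr q) * (lorentz_int q \<theta> (\<lambda>s. D (L * s)))"
    by (simp only: ennreal_mult_real_assoc powr_ge_zero)
  also have "L powr - q * L powr q = 1" using L by (simp add: powr_add[symmetric])
  finally show ?thesis by simp
qed

text \<open>
  The Lorentz functional in terms of the distribution function.
\<close>

definition lorentz_of :: "real \<Rightarrow> ennreal \<Rightarrow> (real \<Rightarrow> ennreal) \<Rightarrow> ennreal" where
  "lorentz_of p q D =
     (if q = top
      then (SUP s\<in>{0<..}. ennreal s * epowr (D s) (1 / p))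
      else (let r = enn2real q in
        epowr (ennreal p *
          (lorentz_int r (r / p) D)) (1 / r)))"

lemma lorentz_norm_eq: "lorentz_norm p q w g = lorentz_of p q (\<lambda>s. wmass w {x. ennreal s < g x})"
  by (simp add: lorentz_norm_def lorentz_of_def Let_def)

lemma dyadic_sum_integral_le:
  fixes D M :: "real \<Rightarrow> ennreal" and b :: "nat \<Rightarrow> real"
  assumes [measurable]: "D \<in> borel_measurable borel" and b: "\<And>k. 0 \<le> b k"
    and le: "\<And>s. 0 < s \<Longrightarrow> epowr (M s) \<theta> \<le> (\<Sum>k. ennreal (b k) * epowr (D (2 powr (real k - 1) * s)) \<theta>)"
  shows "(lorentz_int q \<theta> M) \<le>
    (\<Sum>k. ennreal (b k * 2 powr (- q * (real k - 1)))) * (lorentz_int q \<theta> D)"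
proof -
  let ?I = "\<integral>\<^sup>+ s\<in>{0<..}. ennreal (s powr q) * epowr (D s) \<theta> / ennreal s \<partial>lborel"
  let ?f = "\<lambda>k s. ennreal (b k) * (ennreal (s powr q) * epowr (D (2 powr (real k - 1) * s)) \<theta> / ennreal s * indicator {0<..} s)"
  have "(lorentz_int q \<theta> M) \<le> (\<integral>\<^sup>+ s. (\<Sum>k. ?f k s) \<partial>lborel)"
  proof (rule nn_integral_mono)
    fix s :: real
    show "ennreal (s powr q) * epowr (M s) \<theta> / ennreal s * indicator {0<..} s \<le> (\<Sum>k. ?f k s)"
    proof (cases "0 < s")
      case True
      have "ennreal (s powr q) * epowr (M s) \<theta> / ennreal s \<le> ennreal (s powr q) * (\<Sum>k. ennreal (b k) * epowr (D (2 powr (real k - 1) * s)) \<theta>) / ennreal s"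
        by (intro divide_right_mono_ennreal mult_left_mono le True) simp
      also have "\<dots> = (\<Sum>k. ?f k s)"
        using True by (simp add: divide_ennreal_def ennreal_suminf_cmult[symmetric] ennreal_suminf_multc[symmetric] mult_ac)
      finally show ?thesis using True by simp
    qed simp
  qed
  also have "\<dots> = (\<Sum>k. \<integral>\<^sup>+ s. ?f k s \<partial>lborel)" by (rule nn_integral_suminf) measurable
  also have "\<dots> = (\<Sum>k. ennreal (b k * 2 powr (- q * (real k - 1))) * ?I)"
  proof (rule suminf_cong)
    fix k
    have "(\<integral>\<^sup>+ s. ?f k s \<partial>lborel) = ennreal (b k) * (lorentz_int q \<theta> (\<lambda>s. D (2 powr (real k - 1) * s)))"
      by (rule nn_integral_cmult) measurable
    also have "\<dots> = ennreal (b k) * (ennreal ((2 powr (real k - 1)) powr - q) * ?I)"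
      by (subst scale_invariant_integral) auto
    also have "\<dots> = ennreal (b k * (2 powr (real k - 1)) powr - q) * ?I"
      using b by (intro ennreal_mult_real_assoc) auto
    also have "(2 powr (real k - 1)) powr - q = (2::real) powr (- q * (real k - 1))"
      by (simp add: powr_powr mult.commute)
    finally show "(\<integral>\<^sup>+ s. ?f k s \<partial>lborel) = ennreal (b k * 2 powr (- q * (real k - 1))) * ?I" .
  qed
  also have "\<dots> = (\<Sum>k. ennreal (b k * 2 powr (- q * (real k - 1)))) * ?I" by (rule ennreal_suminf_multc)
  finally show ?thesis .
qed

text \<open>
  For \<open>q = \<infinity>\<close> each term of the series is estimated with \<open>D s \<le> s powr (- p) * N powr p\<close>, where \<open>N\<close> is the
  norm; a geometric series with ratio \<open>2 powr (- (p - r))\<close> remains.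
\<close>

lemma lorentz_interpolation_top:
  fixes D M :: "real \<Rightarrow> ennreal"
  assumes r: "1 < r" "r < p" and B: "0 \<le> B"
    and le: "\<And>s. 0 < s \<Longrightarrow> M s \<le> ennreal B * (\<Sum>k. ennreal (2 powr (real k * r)) * D (2 powr (real k - 1) * s))"
  shows "lorentz_of p top M \<le> ennreal (2 * B powr (1 / p) * (5 * (p / (p - r))) powr (1 / p)) * lorentz_of p top D"
proof -
  have p: "1 < p" using r by simp
  define N where "N = lorentz_of p top D"
  have N: "N = (SUP s\<in>{0<..}. ennreal s * epowr (D s) (1 / p))" by (simp add: N_def lorentz_of_def)
  have Ds: "D s \<le> ennreal (s powr - p) * epowr N p" if s: "0 < s" for s
  proof -
    have "ennreal s * epowr (D s) (1 / p) \<le> N" unfolding N using s by (intro SUP_upper) auto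
    then have "epowr (ennreal s * epowr (D s) (1 / p)) p \<le> epowr N p" using p by (intro epowr_mono) auto
    then have "ennreal (s powr p) * D s \<le> epowr N p"
      using s p by (simp add: epowr_mult epowr_epowr epowr_ennreal)
    then have "ennreal (s powr - p) * (ennreal (s powr p) * D s) \<le> ennreal (s powr - p) * epowr N p"
      by (rule mult_left_mono) simp
    then show ?thesis using s by (simp add: ennreal_mult_real_assoc powr_add[symmetric])
  qed
  have main: "ennreal s * epowr (M s) (1 / p) \<le> ennreal (2 * B powr (1 / p) * (5 * (p / (p - r))) powr (1 / p)) * N"
    if s: "0 < s" for s
  proof -
    have "M s \<le> ennreal B * (\<Sum>k. ennreal (2 powr (real k * r)) * (ennreal ((2 powr (real k - 1) * s) powr - p) * epowr N p))"
      using s by (intro order_trans[OF le] mult_left_mono suminf_le Ds) auto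
    also have "(\<lambda>k. ennreal (2 powr (real k * r)) * (ennreal ((2 powr (real k - 1) * s) powr - p) * epowr N p)) =
       (\<lambda>k. ennreal (2 powr - (real k * (p - r))) * (ennreal (2 powr p * s powr - p) * epowr N p))"
    proof
      fix k :: nat
      have "2 powr (real k * r) * (2 powr (real k - 1) * s) powr - p = 2 powr - (real k * (p - r)) * (2 powr p * s powr - p)"
        by (simp add: powr_mult powr_powr powr_add[symmetric] algebra_simps)
      then show "ennreal (2 powr (real k * r)) * (ennreal ((2 powr (real k - 1) * s) powr - p) * epowr N p) =
         ennreal (2 powr - (real k * (p - r))) * (ennreal (2 powr p * s powr - p) * epowr N p)"
        by (simp only: ennreal_mult_real_assoc powr_ge_zero mult_nonneg_nonneg)
    qed
    also have "ennreal B * (\<Sum>k. ennreal (2 powr - (real k * (p - r))) * (ennreal (2 powr p * s powr - p) * epowr N p)) =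
       ennreal B * ((\<Sum>k. ennreal (2 powr - (real k * (p - r)))) * (ennreal (2 powr p * s powr - p) * epowr N p))"
      by simp
    also have "\<dots> \<le> ennreal B * (ennreal (1 + 2 / (p - r)) * (ennreal (2 powr p * s powr - p) * epowr N p))"
      using r by (intro mult_left_mono mult_right_mono geometric_sum_le) auto
    also have "\<dots> \<le> ennreal B * (ennreal (5 * (p / (p - r))) * (ennreal (2 powr p * s powr - p) * epowr N p))"
    proof (intro mult_left_mono mult_right_mono ennreal_leI)
      have "1 + 2 / (p - r) = (p - r + 2) / (p - r)" using r by (simp add: add_divide_distrib)
      also have "\<dots> \<le> 5 * p / (p - r)" using r by (intro divide_right_mono) auto
      finally show "1 + 2 / (p - r) \<le> 5 * (p / (p - r))" by simp
    qed auto
    also have "\<dots> = ennreal (B * (5 * (p / (p - r)) * (2 powr p * s powr - p))) * epowr N p"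
    proof -
      have "0 \<le> 5 * (p / (p - r))" "0 \<le> 2 powr p * s powr - p" using r by auto
      then show ?thesis using B by (simp only: ennreal_mult_real_assoc mult_nonneg_nonneg)
    qed
    finally have "ennreal s * epowr (M s) (1 / p) \<le> ennreal s * epowr (ennreal (B * (5 * (p / (p - r)) * (2 powr p * s powr - p))) * epowr N p) (1 / p)"
      using p by (intro mult_left_mono epowr_mono) auto
    also have "\<dots> = ennreal s * (ennreal ((B * (5 * (p / (p - r)) * (2 powr p * s powr - p))) powr (1 / p)) * N)"
      using p B r by (simp add: epowr_mult epowr_epowr epowr_ennreal)
    also have "\<dots> = ennreal (s * (B * (5 * (p / (p - r)) * (2 powr p * s powr - p))) powr (1 / p)) * N"
      using s by (intro ennreal_mult_real_assoc) auto
    also have "s * (B * (5 * (p / (p - r)) * (2 powr p * s powr - p))) powr (1 / p) = 2 * B powr (1 / p) * (5 * (p / (p - r))) powr (1 / p)"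
    proof -
      have "(B * (5 * (p / (p - r)) * (2 powr p * s powr - p))) powr (1 / p) =
         B powr (1 / p) * ((5 * (p / (p - r))) powr (1 / p) * (2 powr (p * (1 / p)) * s powr (- p * (1 / p))))"
        by (simp only: powr_mult powr_powr)
      moreover have "s * s powr (- p * (1 / p)) = 1" using s p by (simp add: powr_minus_divide)
      moreover have "2 powr (p * (1 / p)) = (2::real)" using p by simp
      ultimately show ?thesis by (simp add: mult_ac)
    qed
    finally show ?thesis .
  qed
  then show ?thesis
    unfolding N_def[symmetric] by (simp add: lorentz_of_def) (intro SUP_least, simp)
qed

lemma lorentz_of_mono_const:
  assumes q: "0 < q" and p: "0 < p" and c: "0 \<le> c" 
    and le: "(lorentz_int q (q / p) M) \<le>
      ennreal c * (lorentz_int q (q / p) D)"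
  shows "lorentz_of p (ennreal q) M \<le> ennreal (c powr (1 / q)) * lorentz_of p (ennreal q) D"
proof -
  let ?I = "lorentz_int q (q / p)"
  have "epowr (ennreal p * ?I M) (1 / q) \<le> epowr (ennreal p * (ennreal c * ?I D)) (1 / q)"
    using le q by (intro epowr_mono mult_left_mono) auto
  also have "\<dots> = ennreal (c powr (1 / q)) * epowr (ennreal p * ?I D) (1 / q)"
    using q c by (simp add: epowr_mult epowr_ennreal mult_ac)
  finally show ?thesis using q by (simp add: lorentz_of_def)
qed

text \<open>
  The power \<open>q / p\<close> of the series is distributed over its terms. For \<open>q \<le> p\<close> this is subadditivity, and
  the geometric series that remains has ratio \<open>2 powr (- q * (p - r) / p)\<close>, with sum at most
  \<open>1 + 2 * p / (q * (p - r))\<close>; after the root of order \<open>q\<close> this is the exponent \<open>1 / q\<close> in the claim.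
  For \<open>q > p\<close> the power mean inequality with the weights \<open>\<rho> k = 2 powr (- k * y)\<close>, \<open>y = (p - r) / 2\<close>,
  costs the power \<open>q / p - 1\<close> of their sum, and the remaining series is at most one more such sum. The
  total power \<open>q / p\<close> becomes \<open>1 / p\<close> after the root of order \<open>q\<close>.
\<close>

lemma lorentz_interpolation_finite:
  fixes D M :: "real \<Rightarrow> ennreal"
  assumes [measurable]: "D \<in> borel_measurable borel" and q: "0 < q" and r: "1 < r" "r < p" and B: "0 \<le> B"
    and le: "\<And>s. 0 < s \<Longrightarrow> M s \<le> ennreal B * (\<Sum>k. ennreal (2 powr (real k * r)) * D (2 powr (real k - 1) * s))"
  shows "lorentz_of p (ennreal q) M \<le> ennreal (2 * B powr (1 / p) * ((5 + 2 / q) * (p / (p - r))) powr (1 / min p q)) * lorentz_of p (ennreal q) D"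
proof -
  have p: "1 < p" using r by simp
  let ?I = "lorentz_int q (q / p)"
  let ?c = "(5 + 2 / q) * (p / (p - r))"
  have c0: "0 \<le> ?c" using q r by auto
  have pr1: "1 \<le> p / (p - r)" using r by (simp add: field_simps)
  show ?thesis
  proof (cases "q \<le> p")
    case True
    have \<theta>: "0 < q / p" "q / p \<le> 1" using True q p by auto
    define x where "x = q * (p - r) / p"
    have x: "0 < x" using q r p by (simp add: x_def)
    let ?b = "\<lambda>k::nat. B powr (q / p) * 2 powr (real k * r * (q / p))"
    have pt: "epowr (M s) (q / p) \<le> (\<Sum>k. ennreal (?b k) * epowr (D (2 powr (real k - 1) * s)) (q / p))" if "0 < s" for s
    proof -
      have "epowr (M s) (q / p) \<le> epowr (ennreal B * (\<Sum>k. ennreal (2 powr (real k * r)) * D (2 powr (real k - 1) * s))) (q / p)"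
        using \<theta> by (intro epowr_mono le that) auto
      also have "\<dots> \<le> ennreal (B powr (q / p)) * (\<Sum>k. epowr (ennreal (2 powr (real k * r)) * D (2 powr (real k - 1) * s)) (q / p))"
        using \<theta> B by (simp add: epowr_mult[OF \<theta>(1), of "ennreal B"] epowr_ennreal mult_left_mono epowr_suminf_le)
      also have "\<dots> = (\<Sum>k. ennreal (?b k) * epowr (D (2 powr (real k - 1) * s)) (q / p))"
        unfolding ennreal_suminf_cmult[symmetric] using \<theta> q p
        by (intro suminf_cong) (simp add: epowr_mult epowr_ennreal powr_powr ennreal_mult mult.assoc)
      finally show ?thesis .
    qed
    have "?I M \<le> (\<Sum>k. ennreal (?b k * 2 powr (- q * (real k - 1)))) * ?I D"
      by (rule dyadic_sum_integral_le[where b="?b"]) (fact, simp, rule pt)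
    also have "(\<lambda>k. ennreal (?b k * 2 powr (- q * (real k - 1)))) = (\<lambda>k. ennreal (B powr (q / p) * 2 powr q) * ennreal (2 powr - (real k * x)))"
    proof
      fix k :: nat
      have e: "real k * r * (q / p) + - q * (real k - 1) = q + - (real k * x)"
        using p by (simp add: x_def field_simps)
      have "2 powr (real k * r * (q / p)) * 2 powr (- q * (real k - 1)) = 2 powr q * (2::real) powr - (real k * x)"
        unfolding powr_add[symmetric] e ..
      then have "?b k * 2 powr (- q * (real k - 1)) = (B powr (q / p) * 2 powr q) * 2 powr - (real k * x)"
        by (simp only: mult.assoc)
      then show "ennreal (?b k * 2 powr (- q * (real k - 1))) = ennreal (B powr (q / p) * 2 powr q) * ennreal (2 powr - (real k * x))"
        by (simp only: ennreal_mult[of "B powr (q / p) * 2 powr q" "2 powr - (real k * x)"] mult_nonneg_nonneg powr_ge_zero)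
    qed
    also have "(\<Sum>k. ennreal (B powr (q / p) * 2 powr q) * ennreal (2 powr - (real k * x))) * ?I D \<le> ennreal (B powr (q / p) * 2 powr q) * ennreal (1 + 2 / x) * ?I D"
      unfolding ennreal_suminf_cmult using x by (intro mult_right_mono mult_left_mono geometric_sum_le) auto
    also have "\<dots> \<le> ennreal (B powr (q / p) * 2 powr q) * ennreal ?c * ?I D"
    proof (intro mult_right_mono mult_left_mono ennreal_leI)
      have "1 + 2 / x = 1 + 2 / q * (p / (p - r))" using p r q by (simp add: x_def)
      also have "\<dots> \<le> 5 * (p / (p - r)) + 2 / q * (p / (p - r))" using pr1 by (intro add_right_mono) linarith
      finally show "1 + 2 / x \<le> ?c" by (simp only: distrib_right)
    qed auto
    also have "\<dots> = ennreal (B powr (q / p) * 2 powr q * ?c) * ?I D"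
      by (subst ennreal_mult[OF _ c0, symmetric]) auto
    finally have "lorentz_of p (ennreal q) M \<le> ennreal ((B powr (q / p) * 2 powr q * ?c) powr (1 / q)) * lorentz_of p (ennreal q) D"
      by (rule lorentz_of_mono_const[rotated 3], intro q, use p in simp, intro mult_nonneg_nonneg c0 powr_ge_zero)
    also have "(B powr (q / p) * 2 powr q * ?c) powr (1 / q) = 2 * B powr (1 / p) * ?c powr (1 / q)"
    proof -
      have "(B powr (q / p) * 2 powr q * ?c) powr (1 / q) = B powr (q / p * (1 / q)) * 2 powr (q * (1 / q)) * ?c powr (1 / q)"
        by (simp only: powr_mult powr_powr)
      then show ?thesis using q p by simp
    qed
    finally show ?thesis unfolding min_absorb2[OF True] .
  next
    case False
    have \<theta>: "1 < q / p" using False p by simp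
    define y where "y = (p - r) / 2"
    have y: "0 < y" using r by (simp add: y_def)
    define S where "S = (\<Sum>k. ennreal (2 powr - (real k * y)))"
    have S: "S \<le> ennreal (1 + 2 / y)" unfolding S_def by (rule geometric_sum_le[OF y])
    then have "S < top" by (auto intro: le_less_trans)
    then obtain t where t: "S = ennreal t" "0 \<le> t" by (cases S) auto
    let ?b = "\<lambda>k::nat. B powr (q / p) * t powr (q / p - 1) * (2 powr (real k * r * (q / p)) * 2 powr (- (real k * y) * (1 - q / p)))"
    have pt: "epowr (M s) (q / p) \<le> (\<Sum>k. ennreal (?b k) * epowr (D (2 powr (real k - 1) * s)) (q / p))" if "0 < s" for s
    proof -
      have "epowr (M s) (q / p) \<le> epowr (ennreal B * (\<Sum>k. ennreal (2 powr (real k * r)) * D (2 powr (real k - 1) * s))) (q / p)"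
        using \<theta> by (intro epowr_mono le that) auto
      also have "\<dots> = ennreal (B powr (q / p)) * epowr (\<Sum>k. ennreal (2 powr (real k * r)) * D (2 powr (real k - 1) * s)) (q / p)"
        using \<theta> B by (subst epowr_mult) (auto simp: epowr_ennreal)
      also have "\<dots> \<le> ennreal (B powr (q / p)) * ((\<Sum>k. epowr (ennreal (2 powr (real k * r)) * D (2 powr (real k - 1) * s)) (q / p)
          * ennreal ((2 powr - (real k * y)) powr (1 - q / p))) * epowr S (q / p - 1))"
        unfolding S_def using \<theta> \<open>S < top\<close> by (intro mult_left_mono epowr_suminf_weighted_le) (auto simp: S_def)
      also have "\<dots> = ennreal (B powr (q / p)) * ((\<Sum>k. epowr (ennreal (2 powr (real k * r)) * D (2 powr (real k - 1) * s)) (q / p)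
          * ennreal ((2 powr - (real k * y)) powr (1 - q / p))) * ennreal (t powr (q / p - 1)))"
        using t by (simp add: epowr_ennreal)
      also have "\<dots> = (\<Sum>k. ennreal (?b k) * epowr (D (2 powr (real k - 1) * s)) (q / p))"
        unfolding ennreal_suminf_cmult[symmetric] ennreal_suminf_multc[symmetric] using \<theta> q p
        by (intro suminf_cong) (simp add: epowr_mult epowr_ennreal powr_powr ennreal_mult mult_ac)
      finally show ?thesis .
    qed
    have "?I M \<le> (\<Sum>k. ennreal (?b k * 2 powr (- q * (real k - 1)))) * ?I D"
      by (rule dyadic_sum_integral_le[where b="?b"]) (fact, simp, rule pt)
    also have "\<dots> \<le> (\<Sum>k. ennreal (B powr (q / p) * t powr (q / p - 1) * 2 powr q) * ennreal (2 powr - (real k * y))) * ?I D"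
    proof (intro mult_right_mono suminf_le)
      fix k :: nat
      have e: "real k * r * (q / p) + - (real k * y) * (1 - q / p) + - q * (real k - 1) = q + - (real k * y * (1 + q / p))"
        using p by (simp add: y_def field_simps)
      have "2 powr (real k * r * (q / p)) * 2 powr (- (real k * y) * (1 - q / p)) * 2 powr (- q * (real k - 1)) = 2 powr q * (2::real) powr - (real k * y * (1 + q / p))"
        unfolding powr_add[symmetric] e ..
      also have "\<dots> \<le> 2 powr q * 2 powr - (real k * y)"
      proof (intro mult_left_mono powr_mono)
        have "real k * y * 1 \<le> real k * y * (1 + q / p)" using y \<theta> by (intro mult_left_mono) auto
        then show "- (real k * y * (1 + q / p)) \<le> - (real k * y)" by simp
      qed auto
      finally have "B powr (q / p) * t powr (q / p - 1) * (2 powr (real k * r * (q / p)) * 2 powr (- (real k * y) * (1 - q / p)) * 2 powr (- q * (real k - 1))) \<le>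
          B powr (q / p) * t powr (q / p - 1) * (2 powr q * 2 powr - (real k * y))"
        by (rule mult_left_mono) simp
      then have "?b k * 2 powr (- q * (real k - 1)) \<le> (B powr (q / p) * t powr (q / p - 1) * 2 powr q) * 2 powr - (real k * y)"
        by (simp only: mult.assoc)
      then have "ennreal (?b k * 2 powr (- q * (real k - 1))) \<le> ennreal ((B powr (q / p) * t powr (q / p - 1) * 2 powr q) * 2 powr - (real k * y))"
        by (rule ennreal_leI)
      also have "\<dots> = ennreal (B powr (q / p) * t powr (q / p - 1) * 2 powr q) * ennreal (2 powr - (real k * y))"
        by (rule ennreal_mult) auto
      finally show "ennreal (?b k * 2 powr (- q * (real k - 1))) \<le> ennreal (B powr (q / p) * t powr (q / p - 1) * 2 powr q) * ennreal (2 powr - (real k * y))" .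
    qed auto
    also have "\<dots> = ennreal (B powr (q / p) * t powr (q / p - 1) * 2 powr q) * ennreal t * ?I D"
      unfolding ennreal_suminf_cmult S_def[symmetric] t(1) ..
    also have "\<dots> = ennreal (B powr (q / p) * t powr (q / p - 1) * 2 powr q * t) * ?I D"
      by (subst ennreal_mult[OF _ t(2), symmetric]) auto
    also have "B powr (q / p) * t powr (q / p - 1) * 2 powr q * t = B powr (q / p) * 2 powr q * t powr (q / p)"
      using t by (cases "t = 0") (auto simp: powr_diff)
    finally have "lorentz_of p (ennreal q) M \<le> ennreal ((B powr (q / p) * 2 powr q * t powr (q / p)) powr (1 / q)) * lorentz_of p (ennreal q) D"
      using q p by (intro lorentz_of_mono_const) auto
    also have "(B powr (q / p) * 2 powr q * t powr (q / p)) powr (1 / q) = 2 * B powr (1 / p) * t powr (1 / p)"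
    proof -
      have "(B powr (q / p) * 2 powr q * t powr (q / p)) powr (1 / q) = B powr (q / p * (1 / q)) * 2 powr (q * (1 / q)) * t powr (q / p * (1 / q))"
        by (simp only: powr_mult powr_powr)
      then show ?thesis using q p by simp
    qed
    also have "ennreal (2 * B powr (1 / p) * t powr (1 / p)) * lorentz_of p (ennreal q) D \<le> ennreal (2 * B powr (1 / p) * ?c powr (1 / p)) * lorentz_of p (ennreal q) D"
    proof (intro mult_right_mono ennreal_leI mult_left_mono powr_mono2)
      have "t \<le> 1 + 2 / y" using S unfolding t(1) by (subst (asm) ennreal_le_iff) (use y in auto)
      also have "\<dots> = 1 + 4 / (p - r)" by (simp add: y_def)
      also have "\<dots> = (p - r + 4) / (p - r)" using r by (simp add: add_divide_distrib)
      also have "\<dots> \<le> 5 * p / (p - r)" using r by (intro divide_right_mono) auto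
      also have "\<dots> = 5 * (p / (p - r))" by simp
      also have "\<dots> \<le> ?c" using q r by (intro mult_right_mono) auto
      finally show "t \<le> ?c" .
    qed (use p t in auto)
    finally show ?thesis using False by (simp add: min_absorb1)
  qed
qed

section \<open>The Lorentz bound for the strong maximal function\<close>

lemma rect_max_split:
  assumes [measurable]: "F \<in> borel_measurable borel"
  shows "rect_max F x \<le> rect_max (\<lambda>x. F x * indicator {x. ennreal m < F x} x) x + ennreal m"
  unfolding rect_max_def[of F]
proof (rule SUP_least, clarify)
  fix a b assume x: "x \<in> box a b"
  then have ab: "a $ j < b $ j" for j by (auto simp: mem_box_cart intro: less_trans)
  let ?h = "\<lambda>x. F x * indicator {x. ennreal m < F x} x" and ?e = "emeasure lborel (box a b)"
  have "(\<integral>\<^sup>+ y\<in>box a b. F y \<partial>lborel) \<le> (\<integral>\<^sup>+ y. ?h y * indicator (box a b) y + ennreal m * indicator (box a b) y \<partial>lborel)"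
    by (intro nn_integral_mono) (auto simp: indicator_def not_less)
  also have "\<dots> = (\<integral>\<^sup>+ y\<in>box a b. ?h y \<partial>lborel) + ennreal m * ?e"
    by (subst nn_integral_add) (auto simp: nn_integral_cmult)
  finally have "(\<integral>\<^sup>+ y\<in>box a b. F y \<partial>lborel) / ?e \<le> ((\<integral>\<^sup>+ y\<in>box a b. ?h y \<partial>lborel) + ennreal m * ?e) / ?e"
    by (rule divide_right_mono_ennreal)
  also have "\<dots> = (\<integral>\<^sup>+ y\<in>box a b. ?h y \<partial>lborel) / ?e + ennreal m"
    using emeasure_box_pos[OF ab] by (simp add: add_divide_distrib_ennreal ennreal_mult_divide_eq less_top)
  also have "\<dots> \<le> rect_max ?h x + ennreal m"
    unfolding rect_max_def using x by (intro add_right_mono SUP_upper2[of "(a, b)"]) auto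
  finally show "(\<integral>\<^sup>+ y\<in>box a b. F y \<partial>lborel) / ?e \<le> rect_max ?h x + ennreal m" .
qed

lemma term_le_suminf: "f k \<le> (\<Sum>k. f k)" for f :: "nat \<Rightarrow> ennreal"
  using sum_le_suminf[of f "{k}"] by simp

lemma epowr_le_dyadic_sum:
  assumes s: "0 < s" and r: "0 < r" and y: "0 \<le> y"
  shows "epowr (ennreal y * indicator {z. ennreal (s / 2) < ennreal z} y) r \<le>
    (\<Sum>k. ennreal ((2 powr real k * s) powr r) * indicator {z. ennreal (2 powr (real k - 1) * s) < ennreal z} y)"
    (is "_ \<le> (\<Sum>k. ?t k)")
proof (cases "s / 2 < y")
  case True
  obtain N :: nat where N: "y / s < 2 ^ N" using real_arch_pow[of 2 "y / s"] by auto
  \<comment> \<open>\<open>y\<close> lies in the dyadic block of index \<open>k\<close>, whose term alone suffices.\<close>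
  define k where "k = (LEAST k. y \<le> 2 powr real k * s)"
  have "y \<le> 2 powr real N * s" using N s by (simp add: powr_realpow field_simps)
  then have k: "y \<le> 2 powr real k * s" unfolding k_def by (rule LeastI)
  have low: "2 powr (real k - 1) * s < y"
  proof (cases k)
    case 0 then show ?thesis using True by (simp add: powr_minus_divide)
  next
    case (Suc j)
    then have "\<not> y \<le> 2 powr real j * s" unfolding k_def by (intro not_less_Least) simp
    then show ?thesis using Suc by simp
  qed
  have "epowr (ennreal y * indicator {z. ennreal (s / 2) < ennreal z} y) r \<le> ennreal (y powr r)"
    using y r epowr_mono[of "ennreal y * indicator {z. ennreal (s / 2) < ennreal z} y" "ennreal y" r]
    by (auto simp: epowr_ennreal indicator_def)
  also have "\<dots> \<le> ?t k"
    using k low y r s by (auto intro!: ennreal_leI powr_mono2 simp: ennreal_less_iff)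
  also have "\<dots> \<le> (\<Sum>k. ?t k)" by (rule term_le_suminf)
  finally show ?thesis .
next
  case False
  then have "indicator {z. ennreal (s / 2) < ennreal z} y = (0::ennreal)" using s by (simp add: ennreal_less_iff)
  then show ?thesis by simp
qed

text \<open>
  Values of \<open>g\<close> below \<open>s / 2\<close> do not reach the level \<open>s\<close>. The weak type is applied to the rest, which is cut
  into the dyadic blocks \<open>2 ^ (k - 1) * s < \<bar>g\<bar> \<le> 2 ^ k * s\<close>.
\<close>

lemma rect_max_distribution:
  fixes w g :: "real ^ 'n::finite \<Rightarrow> real"
  assumes [measurable]: "w \<in> borel_measurable borel" "g \<in> borel_measurable borel" and C: "0 \<le> C" and r: "0 < r" "r \<le> p"
    and weak: "\<And>F l. F \<in> borel_measurable borel \<Longrightarrow> 0 < l \<Longrightarrow>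
      (mass w {x. ennreal l < rect_max F x}) \<le> ennreal (C / l powr r) * (powint r w F)"
    and s: "0 < s"
  shows "(mass w {x. ennreal s < rect_max (\<lambda>x. ennreal \<bar>g x\<bar>) x}) \<le>
    ennreal (2 powr p * C) * (\<Sum>k. ennreal (2 powr (real k * r)) * (mass w {x. ennreal (2 powr (real k - 1) * s) < ennreal \<bar>g x\<bar>}))"
proof -
  let ?F = "\<lambda>x. ennreal \<bar>g x\<bar>"
  let ?t = "\<lambda>k x. ennreal ((2 powr real k * s) powr r) * (ennreal (w x) * indicator {x. ennreal (2 powr (real k - 1) * s) < ?F x} x)"
  let ?D = "\<lambda>t. (mass w {x. ennreal t < ?F x})"
  let ?G = "\<lambda>x. ?F x * indicator {x. ennreal (s / 2) < ?F x} x"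
  let ?S = "(\<Sum>k. ennreal (2 powr (real k * r)) * ?D (2 powr (real k - 1) * s))"
  have "ennreal (s / 2) < rect_max ?G x" if "ennreal s < rect_max ?F x" for x
  proof (rule ccontr)
    assume "\<not> ?thesis"
    then have "rect_max ?G x + ennreal (s / 2) \<le> ennreal (s / 2) + ennreal (s / 2)" by (intro add_right_mono) simp
    also have "\<dots> = ennreal s" using s by (simp add: ennreal_plus[symmetric] del: ennreal_plus)
    finally have "rect_max ?F x \<le> ennreal s" using rect_max_split[of ?F x "s / 2"] by simp
    then show False using that by simp
  qed
  then have "(mass w {x. ennreal s < rect_max ?F x}) \<le> (mass w {x. ennreal (s / 2) < rect_max ?G x})"
    by (intro nn_integral_mono mult_left_mono) (auto simp: indicator_def)
  also have "\<dots> \<le> ennreal (C / (s / 2) powr r) * (powint r w ?G)"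
    using s by (intro weak) auto
  also have "(powint r w ?G) \<le>
     (\<integral>\<^sup>+ x. (\<Sum>k. (?t k x)) \<partial>lborel)"
  proof (rule nn_integral_mono)
    fix x
    have "epowr (?G x) r \<le> (\<Sum>k. ennreal ((2 powr real k * s) powr r) * indicator {z. ennreal (2 powr (real k - 1) * s) < ennreal z} \<bar>g x\<bar>)"
      using epowr_le_dyadic_sum[OF s r(1), of "\<bar>g x\<bar>"] by (simp add: indicator_def)
    then have "epowr (?G x) r * ennreal (w x) \<le> (\<Sum>k. ennreal ((2 powr real k * s) powr r) * indicator {z. ennreal (2 powr (real k - 1) * s) < ennreal z} \<bar>g x\<bar>) * ennreal (w x)"
      by (rule mult_right_mono) simp
    also have "\<dots> = (\<Sum>k. (?t k x))"
      unfolding ennreal_suminf_multc[symmetric] by (intro suminf_cong) (simp add: indicator_def)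
    finally show "epowr (?G x) r * ennreal (w x) \<le> (\<Sum>k. (?t k x))" .
  qed
  also have "\<dots> = (\<Sum>k. \<integral>\<^sup>+ x. (?t k x) \<partial>lborel)"
    by (rule nn_integral_suminf) measurable
  also have "\<dots> = (\<Sum>k. ennreal ((2 powr real k * s) powr r) * ?D (2 powr (real k - 1) * s))"
    by (intro suminf_cong nn_integral_cmult) measurable
  also have "\<dots> = (\<Sum>k. ennreal (s powr r) * (ennreal (2 powr (real k * r)) * ?D (2 powr (real k - 1) * s)))"
    by (intro suminf_cong) (simp add: ennreal_mult_real_assoc powr_mult powr_powr mult.commute)
  also have "\<dots> = ennreal (s powr r) * ?S"
    by simp
  also have "ennreal (C / (s / 2) powr r) * (ennreal (s powr r) * ?S) =
     ennreal (C / (s / 2) powr r * s powr r) * ?S"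
    using C by (intro ennreal_mult_real_assoc) auto
  also have "\<dots> \<le> ennreal (2 powr p * C) * ?S"
  proof (intro mult_right_mono ennreal_leI)
    have "C / (s / 2) powr r * s powr r = 2 powr r * C" using s by (simp add: powr_divide)
    also have "\<dots> \<le> 2 powr p * C" using C r by (intro mult_right_mono powr_mono) auto
    finally show "C / (s / 2) powr r * s powr r \<le> 2 powr p * C" .
  qed simp
  finally show ?thesis by (simp add: mult_left_mono)
qed

lemma powr_power_eq: "0 \<le> x \<Longrightarrow> (x ^ k) powr a = (x powr a) ^ k" for x a :: real
  by (induction k) (auto simp: powr_mult)

text \<open>
  The root of order \<open>p\<close> of the weak-type constant carries the exponent \<open>1 / p\<close> of the outermost coordinate;
  each of the other \<open>n - 1\<close> coordinates contributes \<open>A powr (1 / p + 1 / (p * (p - 1)))\<close>, which is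
  \<open>A powr (1 / (p - 1))\<close>.
\<close>

lemma constant_bound:
  fixes p A K r \<mu> c \<kappa> :: real and n :: nat
  assumes p: "1 < p" and A: "0 < A" and K: "1 \<le> K" and r: "r < p" "(p - 1) / (10 * K) \<le> p - r"
    and \<mu>: "0 \<le> \<mu>" "\<mu> \<le> \<kappa>" and c: "1 \<le> c" and n: "1 \<le> n"
  shows "2 * (2 powr p * ((3 * 2 ^ n) powr p * (2 powr p * A) *
         (12 powr p * A * (10 * (p / (p - 1)) * (576 ^ n * A powr (1 / (p - 1))))) ^ (n - 1))) powr (1 / p)
      * (c * (p / (p - r))) powr \<mu>
    \<le> (24 * 2 ^ n * (120 * 576 ^ n) ^ (n - 1) * (10 * c) powr \<kappa>) * (p / (p - 1)) powr (real n - 1 + \<mu>)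
      * A powr (1 / p + (real n - 1) / (p - 1)) * K powr \<mu>"
proof -
  define p' where "p' = p / (p - 1)"
  have p': "1 \<le> p'" using p by (simp add: p'_def)
  define N where "N = (2::real) ^ n"
  define M where "M = (576::real) ^ n"
  have N: "0 < N" and M: "1 \<le> M" by (auto simp: N_def M_def)
  define V where "V = A powr (1 / (p - 1))"
  define T where "T = 12 powr p * A * (10 * p' * (M * V))"
  have T0: "0 \<le> T" using A p' M by (simp add: T_def V_def)
  have root: "(x powr p) powr (1 / p) = x" if "0 < x" for x :: real using that p by (simp add: powr_powr)
  have T: "T powr (1 / p) \<le> 120 * M * p' * A powr (1 / (p - 1))"
  proof -
    have "T powr (1 / p) = (12 powr p) powr (1 / p) * A powr (1 / p) * ((10 * p' * M) powr (1 / p) * V powr (1 / p))"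
      by (simp only: T_def powr_mult mult.assoc)
    also have "(12 powr p) powr (1 / p) = (12::real)" by (rule root) simp
    also have "V powr (1 / p) = A powr (1 / (p * (p - 1)))" by (simp add: V_def powr_powr mult.commute)
    also have "12 * A powr (1 / p) * ((10 * p' * M) powr (1 / p) * A powr (1 / (p * (p - 1)))) =
        12 * (10 * p' * M) powr (1 / p) * (A powr (1 / p) * A powr (1 / (p * (p - 1))))" by simp
    also have "A powr (1 / p) * A powr (1 / (p * (p - 1))) = A powr (1 / p + 1 / (p * (p - 1)))"
      by (rule powr_add[symmetric])
    also have "1 / p + 1 / (p * (p - 1)) = 1 / (p - 1)" using p by (simp add: divide_simps)
    also have "12 * (10 * p' * M) powr (1 / p) * A powr (1 / (p - 1)) \<le> 12 * (10 * p' * M) * A powr (1 / (p - 1))"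
    proof (intro mult_right_mono mult_left_mono)
      have "1 * 1 \<le> p' * M" using p' M by (intro mult_mono) auto
      then have "1 \<le> 10 * p' * M" by simp
      then have "(10 * p' * M) powr (1 / p) \<le> (10 * p' * M) powr 1" using p by (intro powr_mono) auto
      then show "(10 * p' * M) powr (1 / p) \<le> 10 * p' * M" using \<open>1 \<le> 10 * p' * M\<close> by simp
    qed auto
    finally show ?thesis by (simp add: mult_ac)
  qed
  have "(2 powr p * ((3 * N) powr p * (2 powr p * A) * T ^ (n - 1))) powr (1 / p) = 12 * N * A powr (1 / p) * (T powr (1 / p)) ^ (n - 1)"
  proof -
    have "(2 powr p * ((3 * N) powr p * (2 powr p * A) * T ^ (n - 1))) powr (1 / p) =
      (2 powr p) powr (1 / p) * (((3 * N) powr p) powr (1 / p) * ((2 powr p) powr (1 / p) * A powr (1 / p)) * (T ^ (n - 1)) powr (1 / p))"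
      by (simp only: powr_mult)
    also have "\<dots> = 2 * ((3 * N) * (2 * A powr (1 / p)) * (T powr (1 / p)) ^ (n - 1))"
      using N T0 by (simp only: root powr_power_eq mult_pos_pos zero_less_numeral)
    finally show ?thesis by simp
  qed
  also have "\<dots> \<le> 12 * N * A powr (1 / p) * (120 * M * p' * A powr (1 / (p - 1))) ^ (n - 1)"
    using N T by (intro mult_left_mono power_mono) auto
  also have "\<dots> = 12 * N * (120 * M) ^ (n - 1) * p' powr (real n - 1) * A powr (1 / p + (real n - 1) / (p - 1))"
  proof -
    have 1: "p' ^ (n - 1) = p' powr (real n - 1)" using p' n by (simp add: powr_realpow[symmetric] of_nat_diff)
    have 2: "(A powr (1 / (p - 1))) ^ (n - 1) = A powr ((real n - 1) / (p - 1))"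
      using A n by (simp add: powr_realpow[symmetric] powr_powr of_nat_diff)
    show ?thesis by (simp only: power_mult_distrib 1 2 powr_add mult_ac)
  qed
  finally have main: "(2 powr p * ((3 * N) powr p * (2 powr p * A) * T ^ (n - 1))) powr (1 / p) \<le>
     12 * N * (120 * M) ^ (n - 1) * p' powr (real n - 1) * A powr (1 / p + (real n - 1) / (p - 1))" .
  have gap: "(c * (p / (p - r))) powr \<mu> \<le> (10 * c) powr \<kappa> * p' powr \<mu> * K powr \<mu>"
  proof -
    have "p / (p - r) \<le> p / ((p - 1) / (10 * K))" using r p K by (intro divide_left_mono) auto
    also have "\<dots> = 10 * (p' * K)" using p K by (simp add: p'_def)
    finally have "c * (p / (p - r)) \<le> c * (10 * (p' * K))" using c by (intro mult_left_mono) auto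
    then have "(c * (p / (p - r))) powr \<mu> \<le> (10 * c * p' * K) powr \<mu>"
      using \<mu> c p r by (intro powr_mono2) (auto simp: mult_ac)
    also have "\<dots> = (10 * c) powr \<mu> * p' powr \<mu> * K powr \<mu>" by (simp only: powr_mult)
    also have "\<dots> \<le> (10 * c) powr \<kappa> * p' powr \<mu> * K powr \<mu>"
      using \<mu> c by (intro mult_right_mono powr_mono) auto
    finally show ?thesis .
  qed
  have "2 * (2 powr p * ((3 * N) powr p * (2 powr p * A) * T ^ (n - 1))) powr (1 / p) * (c * (p / (p - r))) powr \<mu> \<le>
    2 * (12 * N * (120 * M) ^ (n - 1) * p' powr (real n - 1) * A powr (1 / p + (real n - 1) / (p - 1))) * ((10 * c) powr \<kappa> * p' powr \<mu> * K powr \<mu>)"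
    by (intro mult_mono mult_left_mono main gap) (use N M in auto)
  also have "\<dots> = (24 * N * (120 * M) ^ (n - 1) * (10 * c) powr \<kappa>) * p' powr (real n - 1 + \<mu>) * A powr (1 / p + (real n - 1) / (p - 1)) * K powr \<mu>"
    by (simp add: powr_add)
  finally show ?thesis unfolding T_def V_def p'_def N_def M_def .
qed

lemma set_integral_lebesgue_eq_lborel:
  fixes f g :: "real ^ 'n::finite \<Rightarrow> ennreal"
  assumes "AE x in lebesgue. f x = g x"
  shows "(\<integral>\<^sup>+ x. f x \<partial>lebesgue) = (\<integral>\<^sup>+ x. g x \<partial>lborel)"
  using nn_integral_cong_AE[OF assms] by (simp add: nn_integral_completion)

lemma strong_maximal_eq_rect_max:
  fixes f :: "real ^ 'n::finite \<Rightarrow> real"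
  assumes "AE x in lebesgue. ennreal \<bar>f x\<bar> = g x"
  shows "strong_maximal f x = rect_max g x"
proof -
  have avg: "avg (box a b) (\<lambda>y. \<bar>f y\<bar>) = (\<integral>\<^sup>+ y\<in>box a b. g y \<partial>lborel) / emeasure lborel (box a b)" for a b
  proof -
    have "(\<integral>\<^sup>+ y\<in>box a b. ennreal \<bar>f y\<bar> \<partial>lebesgue) = (\<integral>\<^sup>+ y\<in>box a b. g y \<partial>lborel)"
      by (rule set_integral_lebesgue_eq_lborel) (use assms in eventually_elim, simp)
    then show ?thesis by (simp add: avg_def)
  qed
  have "{R \<in> rectangles. x \<in> R} = (\<lambda>(a, b). box a b) ` {(a, b). x \<in> box a b}"
    by (auto simp: rectangles_def)
  then show ?thesis
    unfolding strong_maximal_def rect_max_def by (simp add: image_image case_prod_beta avg)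
qed

lemma box_in_rectangles:
  fixes a b :: "real ^ 'n::finite"
  assumes "\<And>j. a $ j < b $ j"
  shows "box a b \<in> rectangles"
proof -
  have "box a b \<noteq> {}" using emeasure_box_pos(1)[OF assms] by auto
  then show ?thesis by (auto simp: rectangles_def)
qed

lemma rectangleE:
  fixes R :: "(real ^ 'n::finite) set"
  assumes "R \<in> rectangles"
  obtains a b where "R = box a b" "\<And>j. a $ j < b $ j"
proof -
  obtain a b where R: "R = box a b" "box a b \<noteq> {}" using assms by (auto simp: rectangles_def)
  then obtain x where "x \<in> box a b" by blast
  then have "a $ j < b $ j" for j by (auto simp: mem_box_cart intro: less_trans)
  with R(1) show thesis by (rule that)
qed

text \<open>
  The passage from the Lebesgue measurable weight and functions to Borel representatives, and from the
  constants of the problem to the hypotheses of \<open>rect_max_weak_type_below_p\<close> and of the interpolation.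
\<close>

lemma strong_maximal_norm_bound:
  fixes w v :: "real ^ 'n::finite \<Rightarrow> real" and q :: ennreal
  assumes v [measurable]: "v \<in> borel_measurable borel" and pos: "\<And>x. 0 < v x" and wv: "AE x in lebesgue. w x = v x"
    and p: "1 < p" and fin: "Ap_const p w < top" and q: "0 < q"
    and \<sigma>: "\<sigma> = (\<lambda>x. w x powr (1 - p / (p - 1)))"
    and A: "A = enn2real (Ap_const p w)" and K: "K = enn2real (Ainf_const \<sigma>)"
    and m: "m = enn2real (min (ennreal p) q)"
  shows "0 < A" "Ainf_const \<sigma> = ennreal K" "1 \<le> K"
    "\<exists>r. r < p \<and> (p - 1) / (10 * K) \<le> p - r \<and> strong_maximal_norm p q w \<le>
      ennreal (2 * (2 powr p * ((3 * 2 ^ CARD('n)) powr p * (2 powr p * A) *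
         (12 powr p * A * (10 * (p / (p - 1)) * (576 ^ CARD('n) * A powr (1 / (p - 1))))) ^ (CARD('n) - 1))) powr (1 / p)
      * ((5 + (if q = top then 0 else 2 / enn2real q)) * (p / (p - r))) powr (1 / m))"
proof -
  let ?d = "dual p v"
  have [measurable]: "?d \<in> borel_measurable borel" by measurable
  have dpos: "0 < ?d x" for x by (intro dual_pos pos)
  have p'eq: "1 - p / (p - 1) = - (1 / (p - 1))" using p by (simp add: field_simps)
  have \<sigma>d: "AE x in lebesgue. \<sigma> x = ?d x" using wv by eventually_elim (simp add: \<sigma> dual_def p'eq)
  have A': "Ap_const p w = ennreal A" "0 \<le> A" using fin by (auto simp: A)
  have avgw: "avg (box a b) w = mean v a b" for a b
  proof -
    have "(\<integral>\<^sup>+ y\<in>box a b. ennreal (w y) \<partial>lebesgue) = (mass v (box a b))"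
      by (rule set_integral_lebesgue_eq_lborel) (use wv in eventually_elim, simp)
    then show ?thesis by (simp add: avg_def mean_def)
  qed
  have avgd: "avg (box a b) (\<lambda>x. w x powr (- (1 / (p - 1)))) = mean ?d a b" for a b
  proof -
    have "(\<integral>\<^sup>+ y\<in>box a b. ennreal (w y powr (- (1 / (p - 1)))) \<partial>lebesgue) = (mass ?d (box a b))"
      by (rule set_integral_lebesgue_eq_lborel) (use wv in eventually_elim, simp add: dual_def)
    then show ?thesis by (simp add: avg_def mean_def)
  qed
  have ap: "rect_Ap p v A"
    unfolding rect_Ap_def
  proof (intro allI impI)
    fix a b :: "real ^ 'n" assume "\<forall>i. a $ i < b $ i"
    then have ab: "\<And>i. a $ i < b $ i" by blast
    obtain e where e: "emeasure lborel (box a b) = ennreal e" "0 < e"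
      using emeasure_box_pos[OF ab] by (cases "emeasure lborel (box a b)") auto
    have "mean v a b * epowr (mean ?d a b) (p - 1) \<le> ennreal A"
      unfolding A'(1)[symmetric] Ap_const_def avgw[symmetric] avgd[symmetric]
      by (rule SUP_upper) (rule box_in_rectangles[OF ab])
    then have "mean v a b * epowr (mean ?d a b) (p - 1) * epowr (ennreal e) p \<le> ennreal A * epowr (ennreal e) p"
      by (rule mult_right_mono) simp
    moreover have "epowr (ennreal e) p = ennreal e * epowr (ennreal e) (p - 1)"
      using p epowr_add[of 1 "p - 1" "ennreal e"] by simp
    ultimately show "(mass v (box a b)) * epowr (mass ?d (box a b)) (p - 1) \<le> ennreal A * epowr (emeasure lborel (box a b)) p"
      using p by (simp add: mean_times[OF ab, symmetric] e epowr_mult mult_ac)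
  qed
  define Q where "Q = 576 ^ CARD('n) * A powr (1 / (p - 1))"
  have SM: "(\<integral>\<^sup>+ x\<in>box a b. strong_maximal (\<lambda>y. \<sigma> y * indicator (box a b) y) x \<partial>lebesgue) =
      (\<integral>\<^sup>+ x\<in>box a b. local_max ?d (box a b) x \<partial>lborel)" for a b
  proof -
    have "strong_maximal (\<lambda>y. \<sigma> y * indicator (box a b) y) x = local_max ?d (box a b) x" for x
    proof (rule strong_maximal_eq_rect_max)
      show "AE x in lebesgue. ennreal \<bar>\<sigma> x * indicator (box a b) x\<bar> = ennreal (?d x) * indicator (box a b) x"
        using \<sigma>d by eventually_elim (use dpos in \<open>auto simp: indicator_def abs_of_pos\<close>)
    qed
    then show ?thesis by (simp add: nn_integral_completion)
  qed
  have WM: "wmass \<sigma> (box a b) = (mass ?d (box a b))" for a b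
    unfolding wmass_def by (rule set_integral_lebesgue_eq_lborel) (use \<sigma>d in eventually_elim, simp)
  have dfin: "0 < (mass ?d (box a b))" "(mass ?d (box a b)) < top"
    if "\<And>j. a $ j < b $ j" for a b :: "real ^ 'n"
    using nn_integral_box_pos[of ?d, OF _ dpos that] rect_Ap_finite(2)[OF ap _ pos p that] by auto
  let ?ratio = "\<lambda>a b. (\<integral>\<^sup>+ x\<in>box a b. local_max ?d (box a b) x \<partial>lborel) / (mass ?d (box a b))"
  \<comment> \<open>In particular the \<open>A\<^sub>\<infinity>\<close> constant is finite.\<close>
  have Ainf_le: "Ainf_const \<sigma> \<le> ennreal Q"
    unfolding Ainf_const_def
  proof (rule SUP_least)
    fix R :: "(real ^ 'n) set" assume "R \<in> rectangles"
    then obtain a b where R: "R = box a b" and ab: "\<And>j. a $ j < b $ j" using rectangleE by blast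
    have "?ratio a b \<le> ennreal Q * (mass ?d (box a b)) / (mass ?d (box a b))"
      unfolding Q_def by (intro divide_right_mono_ennreal Ainf_bound_of_Ap[OF ap _ pos p A'(2) ab]) simp
    also have "\<dots> = ennreal Q" using dfin[OF ab] by (simp add: ennreal_mult_divide_eq less_top)
    finally show "(\<integral>\<^sup>+ x\<in>R. strong_maximal (\<lambda>y. \<sigma> y * indicator R y) x \<partial>lebesgue) / wmass \<sigma> R \<le> ennreal Q"
      unfolding R SM WM .
  qed
  then have "Ainf_const \<sigma> < top" by (auto intro: le_less_trans)
  then show K': "Ainf_const \<sigma> = ennreal K" by (simp add: K)
  have ratio: "?ratio a b \<le> ennreal K" if "\<And>j. a $ j < b $ j" for a b
    unfolding K'[symmetric] Ainf_const_def SM[symmetric] WM[symmetric]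
    by (rule SUP_upper) (rule box_in_rectangles[OF that])
  have Ainf: "(\<integral>\<^sup>+ x\<in>box a b. local_max ?d (box a b) x \<partial>lborel) \<le> ennreal K * (mass ?d (box a b))"
    if ab: "\<And>j. a $ j < b $ j" for a b
  proof -
    have "?ratio a b * (mass ?d (box a b)) \<le> ennreal K * (mass ?d (box a b))"
      by (intro mult_right_mono ratio ab) simp
    then show ?thesis using dfin[OF ab] by (simp add: ennreal_divide_times ennreal_divide_self less_top)
  qed
  \<comment> \<open>On the unit cube the maximal function is at least the mean.\<close>
  show K1: "1 \<le> K"
  proof -
    let ?a = "0 :: real ^ 'n" and ?b = "1 :: real ^ 'n"
    have ab: "?a $ j < ?b $ j" for j by simp
    have "(mass ?d (box ?a ?b)) = (\<integral>\<^sup>+ x\<in>box ?a ?b. mean ?d ?a ?b \<partial>lborel)"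
      by (simp add: nn_integral_cmult mean_times[OF ab])
    also have "\<dots> \<le> (\<integral>\<^sup>+ x\<in>box ?a ?b. local_max ?d (box ?a ?b) x \<partial>lborel)"
      by (intro nn_integral_mono) (auto simp: indicator_def intro!: mean_le_rect_max[of _ ?a ?b "box ?a ?b" ?d, unfolded indicator_def])
    finally have "(mass ?d (box ?a ?b)) / (mass ?d (box ?a ?b)) \<le> ?ratio ?a ?b"
      by (rule divide_right_mono_ennreal)
    then have "1 \<le> ?ratio ?a ?b" using dfin[OF ab] by (simp add: ennreal_divide_self less_top)
    also have "\<dots> \<le> ennreal K" by (rule ratio[OF ab])
    finally show ?thesis by simp
  qed
  have KQ: "K \<le> Q" using Ainf_le K1 by (simp add: K' Q_def)
  \<comment> \<open>\<open>A = 0\<close> would force \<open>K = 0\<close>.\<close>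
  show "0 < A"
  proof (rule ccontr)
    assume "\<not> 0 < A"
    then have "Q = 0" using A'(2) by (simp add: Q_def)
    then show False using KQ K1 by simp
  qed
  define C where "C = (3 * 2 ^ CARD('n)) powr p * (2 powr p * A) *
         (12 powr p * A * (10 * (p / (p - 1)) * Q)) ^ (CARD('n) - 1)"
  have C0: "0 \<le> C" unfolding C_def Q_def using A'(2) p by (intro mult_nonneg_nonneg zero_le_power) auto
  obtain r where r: "1 < r" "r < p" "(p - 1) / (10 * K) \<le> p - r"
    and weak: "\<And>F l. F \<in> borel_measurable borel \<Longrightarrow> 0 < l \<Longrightarrow>
      (mass v {x. ennreal l < rect_max F x}) \<le> ennreal (C / l powr r) * (powint r v F)"
    using rect_max_weak_type_below_p[OF ap v pos p A'(2) K1 KQ[unfolded Q_def] Ainf] unfolding C_def Q_def by blast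
  define B where "B = 2 powr p * C"
  have B0: "0 \<le> B" using C0 by (simp add: B_def)
  define c where "c = 5 + (if q = top then 0 else 2 / enn2real q)"
  have norm: "strong_maximal_norm p q w \<le> ennreal (2 * B powr (1 / p) * (c * (p / (p - r))) powr (1 / m))"
    unfolding strong_maximal_norm_def
  proof (rule SUP_least, clarify)
    fix f :: "real ^ 'n \<Rightarrow> real" assume f: "f \<in> borel_measurable lebesgue" and lf: "lorentz_norm p q w (\<lambda>x. ennreal \<bar>f x\<bar>) < top"
    obtain g where g [measurable]: "g \<in> borel_measurable borel" and "AE x in lborel. f x = g x"
      using completion_ex_borel_measurable_real[of f lborel] f by auto
    then have fg: "AE x in lebesgue. f x = g x" by (simp add: AE_completion_iff)
    let ?F = "\<lambda>x. ennreal \<bar>g x\<bar>"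
    let ?D = "\<lambda>t. (mass v {x. ennreal t < ?F x})"
    let ?M = "\<lambda>t. (mass v {x. ennreal t < rect_max ?F x})"
    have M: "lorentz_norm p q w (strong_maximal f) = lorentz_of p q ?M"
    proof -
      have "strong_maximal f x = rect_max ?F x" for x
        by (rule strong_maximal_eq_rect_max) (use fg in eventually_elim, simp)
      moreover have "wmass w {x. ennreal t < rect_max ?F x} = ?M t" for t
        unfolding wmass_def by (rule set_integral_lebesgue_eq_lborel) (use wv in eventually_elim, simp)
      ultimately show ?thesis by (simp add: lorentz_norm_eq)
    qed
    have D: "lorentz_norm p q w (\<lambda>x. ennreal \<bar>f x\<bar>) = lorentz_of p q ?D"
    proof -
      have "wmass w {x. ennreal t < ennreal \<bar>f x\<bar>} = ?D t" for t
        unfolding wmass_def by (rule set_integral_lebesgue_eq_lborel) (use wv fg in eventually_elim, simp add: indicator_def)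
      then show ?thesis by (simp add: lorentz_norm_eq)
    qed
    have [measurable]: "?D \<in> borel_measurable borel" by measurable
    have distr: "?M s \<le> ennreal B * (\<Sum>k. ennreal (2 powr (real k * r)) * ?D (2 powr (real k - 1) * s))" if "0 < s" for s
      unfolding B_def using r by (intro rect_max_distribution[OF v g C0 _ _ weak that]) auto
    have "lorentz_of p q ?M \<le> ennreal (2 * B powr (1 / p) * (c * (p / (p - r))) powr (1 / m)) * lorentz_of p q ?D"
    proof (cases "q = top")
      case True
      then have "m = p" "c = 5" using p by (auto simp: m c_def)
      then show ?thesis using True lorentz_interpolation_top[where D="?D" and M="?M", OF r(1,2) B0 distr] by simp
    next
      case False
      then obtain q' where q': "q = ennreal q'" "0 < q'" using q by (cases q) auto
      have "min (ennreal p) q = ennreal (min p q')" using p q' by (auto simp: min_def ennreal_le_iff)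
      then have "m = min p q'" "c = 5 + 2 / q'" using p q' by (auto simp: m c_def)
      then show ?thesis using lorentz_interpolation_finite[where D="?D" and M="?M", OF _ q'(2) r(1,2) B0 distr] q' by simp
    qed
    then have le: "lorentz_norm p q w (strong_maximal f) \<le> ennreal (2 * B powr (1 / p) * (c * (p / (p - r))) powr (1 / m)) * lorentz_norm p q w (\<lambda>x. ennreal \<bar>f x\<bar>)"
      unfolding M D .
    show "lorentz_norm p q w (strong_maximal f) / lorentz_norm p q w (\<lambda>x. ennreal \<bar>f x\<bar>) \<le> ennreal (2 * B powr (1 / p) * (c * (p / (p - r))) powr (1 / m))"
    proof (cases "lorentz_norm p q w (\<lambda>x. ennreal \<bar>f x\<bar>) = 0")
      case True
      then show ?thesis using le by simp
    next
      case False
      have "lorentz_norm p q w (strong_maximal f) / lorentz_norm p q w (\<lambda>x. ennreal \<bar>f x\<bar>) \<le>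
        ennreal (2 * B powr (1 / p) * (c * (p / (p - r))) powr (1 / m)) * lorentz_norm p q w (\<lambda>x. ennreal \<bar>f x\<bar>) / lorentz_norm p q w (\<lambda>x. ennreal \<bar>f x\<bar>)"
        by (rule divide_right_mono_ennreal[OF le])
      also have "\<dots> = ennreal (2 * B powr (1 / p) * (c * (p / (p - r))) powr (1 / m))"
        using False lf by (intro ennreal_mult_divide_eq) (auto simp: less_top)
      finally show ?thesis .
    qed
  qed
  show "\<exists>r. r < p \<and> (p - 1) / (10 * K) \<le> p - r \<and> strong_maximal_norm p q w \<le>
      ennreal (2 * (2 powr p * ((3 * 2 ^ CARD('n)) powr p * (2 powr p * A) *
         (12 powr p * A * (10 * (p / (p - 1)) * (576 ^ CARD('n) * A powr (1 / (p - 1))))) ^ (CARD('n) - 1))) powr (1 / p)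
      * ((5 + (if q = top then 0 else 2 / enn2real q)) * (p / (p - r))) powr (1 / m))"
    using r norm unfolding B_def C_def Q_def c_def by blast
qed

lemma weight_Borel_representative:
  fixes w :: "real ^ 'n::finite \<Rightarrow> real"
  assumes "weight w"
  obtains v where "v \<in> borel_measurable borel" "\<And>x. 0 < v x" "AE x in lebesgue. w x = v x"
proof -
  obtain u where u [measurable]: "u \<in> borel_measurable borel" and wu: "AE x in lborel. w x = u x"
    using completion_ex_borel_measurable_real[of w lborel] assms by (auto simp: weight_def)
  have "AE x in lebesgue. w x = u x" using wu by (simp add: AE_completion_iff)
  moreover have "AE x in lebesgue. 0 < w x" using assms by (simp add: weight_def)
  ultimately have "AE x in lebesgue. w x = (if 0 < u x then u x else 1)" by eventually_elim auto
  moreover have "(\<lambda>x. if 0 < u x then u x else 1) \<in> borel_measurable borel" by measurable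
  ultimately show thesis by (intro that[of "\<lambda>x. if 0 < u x then u x else 1"]) auto
qed

theorem corollary2p4:
  fixes q :: ennreal
  assumes "0 < q"
  shows "\<exists>C::real. 0 < C \<and>
    (\<forall>(p::real) (w :: real ^ 'n::finite \<Rightarrow> real). 1 < p \<longrightarrow> Ap_weight p w \<longrightarrow>
      (let n = real CARD('n);
           p' = p / (p - 1);
           \<sigma> = (\<lambda>x. w x powr (1 - p'));
           m = enn2real (min (ennreal p) q)
       in strong_maximal_norm p q w
          \<le> ennreal (C * p' powr (n - 1 + 1 / m)
                * ln (exp 1 + enn2real (Ap_const p w)) powr (1 / m))
            * epowr (Ap_const p w) (1 / p + (n - 1) / (p - 1))
            * epowr (Ainf_const \<sigma>) (1 / m)))"
proof -
  define c where "c = 5 + (if q = top then 0 else 2 / enn2real q)"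
  define \<kappa> where "\<kappa> = 1 + (if q = top then 0 else 1 / enn2real q)"
  define n where "n = CARD('n)"
  have n: "1 \<le> n" unfolding n_def by (simp add: Suc_le_eq)
  define C where "C = 24 * 2 ^ n * (120 * 576 ^ n) ^ (n - 1) * (10 * c) powr \<kappa>"
  have c: "1 \<le> c" by (simp add: c_def)
  have C: "0 < C" using c by (simp add: C_def)
  have main: "strong_maximal_norm p q w
          \<le> ennreal (C * (p / (p - 1)) powr (real n - 1 + 1 / m)
                * ln (exp 1 + enn2real (Ap_const p w)) powr (1 / m))
            * epowr (Ap_const p w) (1 / p + (real n - 1) / (p - 1))
            * epowr (Ainf_const \<sigma>) (1 / m)"
    if p: "1 < p" and w: "Ap_weight p w" and \<sigma>: "\<sigma> = (\<lambda>x. w x powr (1 - p / (p - 1)))" and m: "m = enn2real (min (ennreal p) q)"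
    for p m and w \<sigma> :: "real ^ 'n \<Rightarrow> real"
  proof -
    obtain v where v: "v \<in> borel_measurable borel" "\<And>x. 0 < v x" "AE x in lebesgue. w x = v x"
      using weight_Borel_representative w unfolding Ap_weight_def by blast
    have fin: "Ap_const p w < top" using w by (simp add: Ap_weight_def)
    define A where "A = enn2real (Ap_const p w)"
    define K where "K = enn2real (Ainf_const \<sigma>)"
    note * = strong_maximal_norm_bound[OF v p fin assms \<sigma> A_def K_def m]
    obtain r where r: "r < p" "(p - 1) / (10 * K) \<le> p - r" and norm: "strong_maximal_norm p q w \<le>
      ennreal (2 * (2 powr p * ((3 * 2 ^ n) powr p * (2 powr p * A) *
         (12 powr p * A * (10 * (p / (p - 1)) * (576 ^ n * A powr (1 / (p - 1))))) ^ (n - 1))) powr (1 / p)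
      * (c * (p / (p - r))) powr (1 / m))"
      using *(4) unfolding n_def c_def by blast
    \<comment> \<open>A bound for \<open>1 / m\<close> that is independent of \<open>p\<close>.\<close>
    have \<mu>: "0 \<le> 1 / m" "1 / m \<le> \<kappa>"
    proof -
      show "0 \<le> 1 / m" by (simp add: m)
      show "1 / m \<le> \<kappa>"
      proof (cases "q = top")
        case True
        then have "m = p" using p by (simp add: m)
        then show ?thesis using p True by (simp add: \<kappa>_def)
      next
        case False
        then obtain q' where q': "q = ennreal q'" "0 < q'" using assms by (cases q) auto
        have "min (ennreal p) q = ennreal (min p q')" using p q' by (auto simp: min_def ennreal_le_iff)
        then have "m = min p q'" using p q' by (simp add: m)
        then have "1 / m = 1 / p \<or> 1 / m = 1 / q'" by (auto simp: min_def)
        moreover have "1 / p \<le> 1" using p by simp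
        moreover have "0 < 1 / q'" using q' by simp
        moreover have "\<kappa> = 1 + 1 / q'" using q' by (simp add: \<kappa>_def)
        ultimately show ?thesis by linarith
      qed
    qed
    define L where "L = ln (exp 1 + A) powr (1 / m)"
    have L: "1 \<le> L"
    proof -
      have "ln (exp 1) \<le> ln (exp 1 + A)" using *(1) by (subst ln_le_cancel_iff) (auto intro: add_pos_pos)
      then show ?thesis unfolding L_def using \<mu> by (intro ge_one_powr_ge_zero) auto
    qed
    let ?P = "(p / (p - 1)) powr (real n - 1 + 1 / m)" and ?a = "A powr (1 / p + (real n - 1) / (p - 1))" and ?k = "K powr (1 / m)"
    note norm
    also have "2 * (2 powr p * ((3 * 2 ^ n) powr p * (2 powr p * A) *
         (12 powr p * A * (10 * (p / (p - 1)) * (576 ^ n * A powr (1 / (p - 1))))) ^ (n - 1))) powr (1 / p)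
      * (c * (p / (p - r))) powr (1 / m) \<le> C * ?P * ?a * ?k"
      unfolding C_def by (rule constant_bound[OF p *(1,3) r \<mu> c n])
    also have "C * ?P * ?a * ?k \<le> C * ?P * L * ?a * ?k"
    proof -
      have "C * ?P * 1 * ?a * ?k \<le> C * ?P * L * ?a * ?k"
        using C L by (intro mult_right_mono mult_left_mono) auto
      then show ?thesis by simp
    qed
    also have "ennreal (C * ?P * L * ?a * ?k) = ennreal (C * ?P * L) * ennreal ?a * ennreal ?k"
      using C L by (simp add: ennreal_mult)
    also have "ennreal ?a = epowr (Ap_const p w) (1 / p + (real n - 1) / (p - 1))"
      using fin by (simp add: epowr_def A_def less_top)
    also have "ennreal ?k = epowr (Ainf_const \<sigma>) (1 / m)"
      using *(2,3) by (simp add: epowr_ennreal)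
    finally show ?thesis unfolding L_def A_def by (simp add: ennreal_leI)
  qed
  show ?thesis
    by (intro exI[of _ C] conjI allI impI C) (unfold Let_def n_def[symmetric], rule main, auto)
qed

end
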